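(* For every second-order equational presentation $\mathcal{E}=(\Sigma,E)$, the category $\mathrm{Mod}(\mathcal{E})$ of algebraic models of $\mathcal{E}$ is equivalent to the category $\mathrm{FunMod}(\mathbb{M}(\mathcal{E}),\mathrm{Set})$ of set-theoretic functorial models of the second-order algebraic theory $\mathbb{M}\to\mathbb{M}(\mathcal{E})$.
   Context: Syntax. A (unityped second-order) signature $\Sigma=(O,|\cdot|)$ is a set $O$ of operators with arity function $|\cdot|:O\to\mathbb{N}^*$; write $\mathsf{o}:\langle n_1,\dots,n_k\rangle$ ($k$ arguments, the $i$-th binding $n_i$ variables). Terms $\Theta\rhd\Gamma\vdash t$, in a context of metavariables $\Theta=(\mathsf{m}_1:[m_1],\dots,\mathsf{m}_k:[m_k])$ with arities and variables $\Gamma$, are generated by: variables $x\in\Gamma$; $\mathsf{m}[t_1,\dots,t_m]$ for $(\mathsf{m}:[m])\in\Theta$ and terms $t_i$ in context $\Theta\rhd\Gamma$; $\mathsf{o}((\vec x_1)t_1,\dots,(\vec x_k)t_k)$ for $\mathsf{o}:\langle n_1,\dots,n_k\rangle$ and $\Theta\rhd\Gamma,\vec x_i\vdash t_i$ with $\vec x_i$ a list of $n_i$ variables bound in $t_i$; modulo $\alpha$-equivalence. Metasubstitution $t\{\mathsf{m}_i:=(\vec x_i)t_i\}_i$ (for $\mathsf{m}_1:[m_1],\dots,\mathsf{m}_k:[m_k]\rhd\Gamma\vdash t$ and $\Theta\rhd\Gamma,\vec x_i\vdash t_i$, $|\vec x_i|=m_i$) replaces each $\mathsf{m}_\ell[s_1,\dots,s_{m_\ell}]$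 by $t_\ell$ with $x_{\ell,j}$ substituted (capture-avoidingly) by the metasubstituted $s_j$, and commutes with variables and operators. A second-order equational presentation $(\Sigma,E)$ is a signature with a set $E$ of axioms $\Theta\rhd\Gamma\vdash s\equiv t$ (pairs of terms in the same context); second-order equational logic derives judgements from $E$ by: the axioms; reflexivity, symmetry, transitivity; and: from $\mathsf{m}_1:[m_1],\dots,\mathsf{m}_k:[m_k]\rhd\Gamma\vdash s\equiv t$ and $\Theta\rhd\Delta,\vec x_i\vdash s_i\equiv t_i$ ($|\vec x_i|=m_i$) infer $\Theta\rhd\Gamma,\Delta\vdash s\{\mathsf{m}_i:=(\vec x_i)s_i\}\equiv t\{\mathsf{m}_i:=(\vec x_i)t_i\}$. Classifying category. $\mathbb{M}(\mathcal{E})$ has objects $\mathbb{N}^*$; a morphism $\langle m_1,\dots,m_k\rangle\to\langle n_1,\dots,n_\ell\rangle$ is a tuple $\langle[t_1],\dots,[t_\ell]\rangle$ of equivalence classes, modulo derivable equality from $E$, of terms $t_i$ over $\Sigma$ in context $\mathsf{m}_1:[m_1],\dots,\mathsf{m}_k:[m_k]\rhd x_1,\dots,x_{n_i}$; the identity is $\langle[\mathsf{m}_i[x_1,\dots,x_{m_i}]]\rangle_i$ and the composite of $\langle s_p\rangle_{p\le j}:\langle l_1,\dots,l_i\rangle\to\langle m_1,\dots,m_j\rangle$ with $\langle t_q\rangle_q:\langle m_1,\dots,m_j\rangle\to\langle n_1,\dots\rangle$ is $\langle t_q\{\mathsf{m}_p:=(x_1,\dots,x_{m_p})s_p\}_{p}\rangle_q$.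 $\mathbb{M}$ is the same construction for the empty signature and no axioms (no quotient), and $\mathbb{M}\to\mathbb{M}(\mathcal{E})$ is the evident identity-on-objects functor. $\mathbb{M}(\mathcal{E})$ is cartesian (products by concatenation). $\mathrm{FunMod}(\mathbb{M}(\mathcal{E}),\mathrm{Set})$ is the category of cartesian (finite-product-preserving) functors $\mathbb{M}(\mathcal{E})\to\mathrm{Set}$ and natural transformations. Algebraic models. $\mathbb{F}$ is the category with objects $n\in\mathbb{N}$ and morphisms $m\to n$ the functions $[m]\to[n]$, $[n]=\{1,\dots,n\}$; $\mathbf{y}$ is the Yoneda embedding $\mathbb{F}^{op}\to\mathrm{Set}^{\mathbb{F}}$. The substitution monoidal structure on $\mathrm{Set}^{\mathbb{F}}$ has unit $\mathbf{y}1$ and tensor $(X\bullet Y)=\int^{k\in\mathbb{F}}X(k)\times Y^k$. For $A\in\mathrm{Set}^{\mathbb{F}}$, $A^{\mathbf{y}n}(p)\cong A(p+n)$. A $\Sigma$-model is $A\in\mathrm{Set}^{\mathbb{F}}$ with (i) for each $\mathsf{o}:\langle n_1,\dots,n_k\rangle$ a natural transformation $\prod_i A^{\mathbf{y}n_i}\to A$, i.e. maps $\mathsf{o}_p:\prod_{i}A(p+n_i)\to A(p)$ natural in $p$; (ii) a monoid structure $\nu:\mathbf{y}1\to A$, $\varsigma:A\bullet A\to A$ for $(\bullet,\mathbf{y}1)$. Write $v^{(q)}_j\in A(q)$ for the image under $A(1\to q, 1\mapsto j)$ of the element of $A(1)$ given by $\nu$, and $\varsigma_{m,q}:A(m)\times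 A(q)^m\to A(q)$ for the maps induced by $\varsigma$. Compatibility: for all $\mathsf{o}:\langle n_1,\dots,n_k\rangle$, $m,p$, $a_i\in A(m+n_i)$, $b\in A(p)^m$: $\varsigma_{m,p}(\mathsf{o}_m(a_1,\dots,a_k),b)=\mathsf{o}_p(c_1,\dots,c_k)$ where $c_i=\varsigma_{m+n_i,p+n_i}(a_i,(A(\iota)b_1,\dots,A(\iota)b_m,v^{(p+n_i)}_{p+1},\dots,v^{(p+n_i)}_{p+n_i}))$ and $\iota:[p]\hookrightarrow[p+n_i]$ is the inclusion. Morphisms of $\Sigma$-models are maps in $\mathrm{Set}^{\mathbb{F}}$ that are homomorphisms for both the operations and the monoid structures. Interpretation: for $\Theta=(\mathsf{m}_i:[m_i])_{i\le k}$, $\Gamma=(x_1,\dots,x_n)$, a term $\Theta\rhd\Gamma\vdash t$ and $p\in\mathbb{N}$, define $[\![t]\!]^p:\prod_i A(p+m_i)\to A(p+n)$ by: $[\![x_j]\!]^p(\xi)=v^{(p+n)}_{p+j}$; $[\![\mathsf{m}_i[t_1,\dots,t_{m_i}]]\!]^p(\xi)=\varsigma_{p+n+m_i,p+n}(A(\kappa)\xi_i,(v^{(p+n)}_1,\dots,v^{(p+n)}_{p+n},[\![t_1]\!]^p(\xi),\dots,[\![t_{m_i}]\!]^p(\xi)))$ where $\kappa:[p+m_i]\to[p+n+m_i]$ sends $j\le p$ to $j$ and $p+j$ to $p+n+j$; $[\![\mathsf{o}((\vec y_1)t_1,\dots,(\vec y_l)t_l)]\!]^p(\xi)=\mathsf{o}_{p+n}([\![t_1]\!]^p(\xi),\dots,[\![t_l]\!]^p(\xi))$,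 where $t_j$ is interpreted in context $\Theta\rhd\Gamma,\vec y_j$. $A$ satisfies $\Theta\rhd\Gamma\vdash s\equiv t$ iff $[\![s]\!]^p=[\![t]\!]^p$ for all $p$. $\mathrm{Mod}(\Sigma,E)$ is the full subcategory of $\Sigma$-models satisfying all axioms in $E$. *)

theory Defs
  imports "HOL-Library.FuncSet"
begin

section \<open>Categories\<close>

text \<open>
  Hom-sets are indexed by their objects and need not be disjoint, so composition takes the three
  objects as arguments: \<open>cmp C a b c g f\<close> is the composite of \<open>f : a \<rightarrow> b\<close> and \<open>g : b \<rightarrow> c\<close>.
  Functions between sets are extensional (undefined outside their domain), so that equality
  in HOL is equality of morphisms.
\<close>

record ('o, 'm) cat =
  obj :: "'o set"
  hom :: "'o \<Rightarrow> 'o \<Rightarrow> 'm set"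
  idt :: "'o \<Rightarrow> 'm"
  cmp :: "'o \<Rightarrow> 'o \<Rightarrow> 'o \<Rightarrow> 'm \<Rightarrow> 'm \<Rightarrow> 'm"

definition is_category :: "('o, 'm) cat \<Rightarrow> bool" where
  "is_category C \<longleftrightarrow>
     (\<forall>a\<in>obj C. idt C a \<in> hom C a a) \<and>
     (\<forall>a\<in>obj C. \<forall>b\<in>obj C. \<forall>c\<in>obj C. \<forall>f\<in>hom C a b. \<forall>g\<in>hom C b c.
        cmp C a b c g f \<in> hom C a c) \<and>
     (\<forall>a\<in>obj C. \<forall>b\<in>obj C. \<forall>f\<in>hom C a b.
        cmp C a b b (idt C b) f = f \<and> cmp C a a b f (idt C a) = f) \<and>
     (\<forall>a\<in>obj C. \<forall>b\<in>obj C. \<forall>c\<in>obj C. \<forall>d\<in>obj C.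
        \<forall>f\<in>hom C a b. \<forall>g\<in>hom C b c. \<forall>h\<in>hom C c d.
        cmp C a c d h (cmp C a b c g f) = cmp C a b d (cmp C b c d h g) f)"

definition full_subcat :: "('o, 'm) cat \<Rightarrow> ('o \<Rightarrow> bool) \<Rightarrow> ('o, 'm) cat" where
  "full_subcat C P = C\<lparr>obj := {a \<in> obj C. P a}\<rparr>"

definition is_iso :: "('o, 'm) cat \<Rightarrow> 'o \<Rightarrow> 'o \<Rightarrow> 'm \<Rightarrow> bool" where
  "is_iso C a b f \<longleftrightarrow> f \<in> hom C a b \<and>
     (\<exists>g\<in>hom C b a. cmp C a b a g f = idt C a \<and> cmp C b a b f g = idt C b)"

record ('o, 'm, 'p, 'n) ftor =
  fobj :: "'o \<Rightarrow> 'p"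
  fmap :: "'o \<Rightarrow> 'o \<Rightarrow> 'm \<Rightarrow> 'n"

definition is_functor :: "('o, 'm) cat \<Rightarrow> ('p, 'n) cat \<Rightarrow> ('o, 'm, 'p, 'n) ftor \<Rightarrow> bool" where
  "is_functor C D F \<longleftrightarrow> is_category C \<and> is_category D \<and>
     fobj F \<in> obj C \<rightarrow>\<^sub>E obj D \<and>
     fmap F \<in> (\<Pi>\<^sub>E a\<in>obj C. \<Pi>\<^sub>E b\<in>obj C. hom C a b \<rightarrow>\<^sub>E hom D (fobj F a) (fobj F b)) \<and>
     (\<forall>a\<in>obj C. fmap F a a (idt C a) = idt D (fobj F a)) \<and>
     (\<forall>a\<in>obj C. \<forall>b\<in>obj C. \<forall>c\<in>obj C. \<forall>f\<in>hom C a b. \<forall>g\<in>hom C b c.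
        fmap F a c (cmp C a b c g f) =
          cmp D (fobj F a) (fobj F b) (fobj F c) (fmap F b c g) (fmap F a b f))"

definition id_ftor :: "('o, 'm) cat \<Rightarrow> ('o, 'm, 'o, 'm) ftor" where
  "id_ftor C = \<lparr>fobj = (\<lambda>a\<in>obj C. a), fmap = (\<lambda>a\<in>obj C. \<lambda>b\<in>obj C. \<lambda>f\<in>hom C a b. f)\<rparr>"

definition comp_ftor ::
  "('o, 'm) cat \<Rightarrow> ('p, 'n, 'q, 'r) ftor \<Rightarrow> ('o, 'm, 'p, 'n) ftor \<Rightarrow> ('o, 'm, 'q, 'r) ftor" where
  "comp_ftor C G F =
     \<lparr>fobj = (\<lambda>a\<in>obj C. fobj G (fobj F a)),
      fmap = (\<lambda>a\<in>obj C. \<lambda>b\<in>obj C. \<lambda>f\<in>hom C a b.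
                fmap G (fobj F a) (fobj F b) (fmap F a b f))\<rparr>"

definition is_nat_trans ::
  "('o, 'm) cat \<Rightarrow> ('p, 'n) cat \<Rightarrow> ('o, 'm, 'p, 'n) ftor \<Rightarrow> ('o, 'm, 'p, 'n) ftor \<Rightarrow>
   ('o \<Rightarrow> 'n) \<Rightarrow> bool" where
  "is_nat_trans C D F G \<tau> \<longleftrightarrow>
     \<tau> \<in> (\<Pi>\<^sub>E a\<in>obj C. hom D (fobj F a) (fobj G a)) \<and>
     (\<forall>a\<in>obj C. \<forall>b\<in>obj C. \<forall>f\<in>hom C a b.
        cmp D (fobj F a) (fobj F b) (fobj G b) (\<tau> b) (fmap F a b f) =
        cmp D (fobj F a) (fobj G a) (fobj G b) (fmap G a b f) (\<tau> a))"

definition is_nat_iso ::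
  "('o, 'm) cat \<Rightarrow> ('p, 'n) cat \<Rightarrow> ('o, 'm, 'p, 'n) ftor \<Rightarrow> ('o, 'm, 'p, 'n) ftor \<Rightarrow>
   ('o \<Rightarrow> 'n) \<Rightarrow> bool" where
  "is_nat_iso C D F G \<tau> \<longleftrightarrow> is_nat_trans C D F G \<tau> \<and>
     (\<forall>a\<in>obj C. is_iso D (fobj F a) (fobj G a) (\<tau> a))"

definition equivalent_categories :: "('o, 'm) cat \<Rightarrow> ('p, 'n) cat \<Rightarrow> bool" where
  "equivalent_categories C D \<longleftrightarrow>
     (\<exists>F G \<eta> \<epsilon>. is_functor C D F \<and> is_functor D C G \<and>
        is_nat_iso C C (id_ftor C) (comp_ftor C G F) \<eta> \<and>
        is_nat_iso D D (comp_ftor D F G) (id_ftor D) \<epsilon>)"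

definition functor_cat ::
  "('o, 'm) cat \<Rightarrow> ('p, 'n) cat \<Rightarrow> (('o, 'm, 'p, 'n) ftor, 'o \<Rightarrow> 'n) cat" where
  "functor_cat C D =
     \<lparr>obj = {F. is_functor C D F},
      hom = (\<lambda>F G. {\<tau>. is_nat_trans C D F G \<tau>}),
      idt = (\<lambda>F. \<lambda>a\<in>obj C. idt D (fobj F a)),
      cmp = (\<lambda>F G H \<sigma> \<tau>. \<lambda>a\<in>obj C. cmp D (fobj F a) (fobj G a) (fobj H a) (\<sigma> a) (\<tau> a))\<rparr>"

definition is_product :: "('o, 'm) cat \<Rightarrow> 'o list \<Rightarrow> 'o \<Rightarrow> 'm list \<Rightarrow> bool" where
  "is_product C as P ps \<longleftrightarrow>
     P \<in> obj C \<and> set as \<subseteq> obj C \<and> length ps = length as \<and>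
     (\<forall>i<length as. ps ! i \<in> hom C P (as ! i)) \<and>
     (\<forall>Q\<in>obj C. \<forall>fs. length fs = length as \<and> (\<forall>i<length as. fs ! i \<in> hom C Q (as ! i)) \<longrightarrow>
        (\<exists>!h. h \<in> hom C Q P \<and> (\<forall>i<length as. cmp C Q P (as ! i) (ps ! i) h = fs ! i)))"

definition preserves_finite_products ::
  "('o, 'm) cat \<Rightarrow> ('p, 'n) cat \<Rightarrow> ('o, 'm, 'p, 'n) ftor \<Rightarrow> bool" where
  "preserves_finite_products C D F \<longleftrightarrow>
     (\<forall>as P ps. is_product C as P ps \<longrightarrow>
        is_product D (map (fobj F) as) (fobj F P) (map2 (fmap F P) as ps))"

definition cartesian_functor_cat ::
  "('o, 'm) cat \<Rightarrow> ('p, 'n) cat \<Rightarrow> (('o, 'm, 'p, 'n) ftor, 'o \<Rightarrow> 'n) cat" where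
  "cartesian_functor_cat C D = full_subcat (functor_cat C D) (preserves_finite_products C D)"


section \<open>The category of sets\<close>

text \<open>
  HOL has no type of all sets. The category Set is rendered as the full category on a
  collection \<open>U\<close> of subsets of a type \<open>'u\<close>, where \<open>U\<close> is only required to be closed, up to
  bijection, under finite products. Any Grothendieck-style universe of small sets is an instance,
  and so is the collection of all subsets of an arbitrary infinite type.
\<close>

definition Set_cat :: "'u set set \<Rightarrow> ('u set, 'u \<Rightarrow> 'u) cat" where
  "Set_cat U =
     \<lparr>obj = U, hom = (\<lambda>A B. A \<rightarrow>\<^sub>E B), idt = (\<lambda>A. \<lambda>x\<in>A. x), cmp = (\<lambda>A B C g f. compose A g f)\<rparr>"

definition universe_of_sets :: "'u set set \<Rightarrow> bool" where
  "universe_of_sets U \<longleftrightarrow>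
     (\<exists>x. {x} \<in> U) \<and> (\<forall>A\<in>U. \<forall>B\<in>U. \<exists>P\<in>U. \<exists>f. bij_betw f (A \<times> B) P)"

lemma universe_of_sets_infinite_type:
  assumes "infinite (UNIV :: 'u set)"
  shows "universe_of_sets (UNIV :: 'u set set)"
proof -
  obtain g :: "'u \<times> 'u \<Rightarrow> 'u" where "bij_betw g (UNIV \<times> UNIV) UNIV"
    using card_of_Times_same_infinite[OF assms] card_of_ordIso by blast
  then have g: "inj g"
    by (simp add: bij_betw_def)
  show ?thesis
    unfolding universe_of_sets_def
    using g by (blast intro: inj_on_imp_bij_betw inj_on_subset)
qed


section \<open>Second-order syntax\<close>

record 'o signature =
  operators :: "'o set"
  arity :: "'o \<Rightarrow> nat list"

text \<open>
  Terms modulo \<open>\<alpha>\<close>-equivalence are represented with de Bruijn levels. A variable context is its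
  length \<open>n\<close>, its variables being \<open>Var 0, \<dots>, Var (n - 1)\<close>, and an argument \<open>(k, t)\<close> of an operator
  binds the \<open>k\<close> variables \<open>Var n, \<dots>, Var (n + k - 1)\<close> of \<open>t\<close>; a metavariable context is the list of
  its arities. Extending a context on the right by bound variables therefore matches \<open>\<Gamma>, \<^bold>x\<close>, but
  weakening the ambient context renames bound variables.
\<close>

datatype 'o trm =
    Var nat
  | MVar nat "'o trm list"
  | Op 'o "(nat \<times> 'o trm) list"

type_synonym 'o abstr = "nat \<times> 'o trm"

inductive wf_trm :: "'o signature \<Rightarrow> nat list \<Rightarrow> nat \<Rightarrow> 'o trm \<Rightarrow> bool"
  for S :: "'o signature" and \<Theta> :: "nat list" where
  wf_Var: "j < n \<Longrightarrow> wf_trm S \<Theta> n (Var j)"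
| wf_MVar: "i < length \<Theta> \<Longrightarrow> length ts = \<Theta> ! i \<Longrightarrow> (\<And>t. t \<in> set ts \<Longrightarrow> wf_trm S \<Theta> n t) \<Longrightarrow>
    wf_trm S \<Theta> n (MVar i ts)"
| wf_Op: "f \<in> operators S \<Longrightarrow> map fst bs = arity S f \<Longrightarrow>
    (\<And>k t. (k, t) \<in> set bs \<Longrightarrow> wf_trm S \<Theta> (n + k) t) \<Longrightarrow> wf_trm S \<Theta> n (Op f bs)"

text \<open>
  \<open>ext m p \<rho>\<close> extends a map \<open>\<rho> : [m] \<rightarrow> [p]\<close> to \<open>\<rho> + id : [m + k] \<rightarrow> [p + k]\<close>, for every \<open>k\<close>.
\<close>

definition ext :: "nat \<Rightarrow> nat \<Rightarrow> (nat \<Rightarrow> nat) \<Rightarrow> nat \<Rightarrow> nat" where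
  "ext m p \<rho> j = (if j < m then \<rho> j else p + (j - m))"

text \<open>Renaming of a term in context \<open>m\<close> along \<open>\<rho> : [m] \<rightarrow> [p]\<close>.\<close>

fun ren :: "nat \<Rightarrow> nat \<Rightarrow> (nat \<Rightarrow> nat) \<Rightarrow> 'o trm \<Rightarrow> 'o trm" where
  "ren m p \<rho> (Var j) = Var (\<rho> j)"
| "ren m p \<rho> (MVar i ts) = MVar i (map (ren m p \<rho>) ts)"
| "ren m p \<rho> (Op f bs) = Op f (map (\<lambda>(k, t). (k, ren (m + k) (p + k) (ext m p \<rho>) t)) bs)"

text \<open>Simultaneous substitution of terms \<open>\<sigma>\<close> in context \<open>p\<close> for the variables of a term in
  context \<open>length \<sigma>\<close>.\<close>

fun subst :: "nat \<Rightarrow> 'o trm list \<Rightarrow> 'o trm \<Rightarrow> 'o trm" where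
  "subst p \<sigma> (Var j) = \<sigma> ! j"
| "subst p \<sigma> (MVar i ts) = MVar i (map (subst p \<sigma>) ts)"
| "subst p \<sigma> (Op f bs) =
     Op f (map (\<lambda>(k, t). (k, subst (p + k)
                 (map (ren p (p + k) (\<lambda>j. j)) \<sigma> @ map Var [p..<p + k]) t)) bs)"

text \<open>
  Metasubstitution, for a term in variable context \<open>n\<close> and abstractions \<open>(m\<^sub>i, t\<^sub>i)\<close> with \<open>t\<^sub>i\<close> in
  variable context \<open>n + m\<^sub>i\<close>. Under a binder of \<open>k\<close> variables, the \<open>m\<^sub>i\<close> abstracted variables of \<open>t\<^sub>i\<close>
  are moved past the \<open>k\<close> new ones.
\<close>

fun msubst :: "nat \<Rightarrow> 'o abstr list \<Rightarrow> 'o trm \<Rightarrow> 'o trm" where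
  "msubst n \<sigma> (Var j) = Var j"
| "msubst n \<sigma> (MVar i ts) = subst n (map Var [0..<n] @ map (msubst n \<sigma>) ts) (snd (\<sigma> ! i))"
| "msubst n \<sigma> (Op f bs) =
     Op f (map (\<lambda>(k, t). (k, msubst (n + k)
       (map (\<lambda>(m, s). (m, ren (n + m) (n + k + m) (ext n (n + k) (\<lambda>j. j)) s)) \<sigma>) t)) bs)"

text \<open>
  The abstractions \<open>(\<^bold>x\<^sub>i)s\<^sub>i\<close>, with \<open>s\<^sub>i\<close> in variable context \<open>\<Delta>, \<^bold>x\<^sub>i\<close> where \<open>|\<Delta>| = d\<close>,
  weakened to \<open>\<Gamma>, \<Delta>, \<^bold>x\<^sub>i\<close> where \<open>|\<Gamma>| = g\<close>.
\<close>

definition abstrs :: "nat \<Rightarrow> nat \<Rightarrow> nat list \<Rightarrow> 'o trm list \<Rightarrow> 'o abstr list" where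
  "abstrs g d ms ss = map2 (\<lambda>m s. (m, ren (d + m) (g + d + m) (\<lambda>j. g + j) s)) ms ss"

text \<open>An equation \<open>(\<Theta>, n, s, t)\<close> stands for \<open>\<Theta> \<rhd> x\<^sub>1, \<dots>, x\<^sub>n \<turnstile> s \<equiv> t\<close>.\<close>

type_synonym 'o equation = "nat list \<times> nat \<times> 'o trm \<times> 'o trm"

definition is_presentation :: "'o signature \<Rightarrow> 'o equation set \<Rightarrow> bool" where
  "is_presentation S E \<longleftrightarrow> (\<forall>(\<Theta>, n, s, t)\<in>E. wf_trm S \<Theta> n s \<and> wf_trm S \<Theta> n t)"

inductive derivable :: "'o signature \<Rightarrow> 'o equation set \<Rightarrow> nat list \<Rightarrow> nat \<Rightarrow> 'o trm \<Rightarrow> 'o trm \<Rightarrow> bool"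
  for S :: "'o signature" and E :: "'o equation set" where
  axiom: "(\<Theta>, n, s, t) \<in> E \<Longrightarrow> derivable S E \<Theta> n s t"
| refl: "wf_trm S \<Theta> n t \<Longrightarrow> derivable S E \<Theta> n t t"
| sym: "derivable S E \<Theta> n s t \<Longrightarrow> derivable S E \<Theta> n t s"
| trans: "derivable S E \<Theta> n s t \<Longrightarrow> derivable S E \<Theta> n t u \<Longrightarrow> derivable S E \<Theta> n s u"
| msubst: "derivable S E ms g s t \<Longrightarrow> length ss = length ms \<Longrightarrow> length ts = length ms \<Longrightarrow>
    (\<And>i. i < length ms \<Longrightarrow> derivable S E \<Theta> (d + ms ! i) (ss ! i) (ts ! i)) \<Longrightarrow>
    derivable S E \<Theta> (g + d)
      (msubst (g + d) (abstrs g d ms ss) (ren g (g + d) (\<lambda>j. j) s))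
      (msubst (g + d) (abstrs g d ms ts) (ren g (g + d) (\<lambda>j. j) t))"


section \<open>The classifying category\<close>

definition eq_class ::
  "'o signature \<Rightarrow> 'o equation set \<Rightarrow> nat list \<Rightarrow> nat \<Rightarrow> 'o trm \<Rightarrow> 'o trm set" where
  "eq_class S E \<Theta> n t = {u. derivable S E \<Theta> n t u}"

definition term_classes ::
  "'o signature \<Rightarrow> 'o equation set \<Rightarrow> nat list \<Rightarrow> nat \<Rightarrow> 'o trm set set" where
  "term_classes S E \<Theta> n = eq_class S E \<Theta> n ` {t. wf_trm S \<Theta> n t}"

text \<open>
  The composite is formed on representatives: the union below is over classes that all coincide.
\<close>

definition classifying_cat ::
  "'o signature \<Rightarrow> 'o equation set \<Rightarrow> (nat list, 'o trm set list) cat" where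
  "classifying_cat S E =
     \<lparr>obj = UNIV,
      hom = (\<lambda>ms ns. listset (map (term_classes S E ms) ns)),
      idt = (\<lambda>ms. map (\<lambda>i. eq_class S E ms (ms ! i) (MVar i (map Var [0..<ms ! i])))
                    [0..<length ms]),
      cmp = (\<lambda>ls ms ns g f. map2
        (\<lambda>n T. \<Union>t\<in>T. \<Union>ss\<in>listset f. eq_class S E ls n (msubst n (abstrs n 0 ms ss) t)) ns g)\<rparr>"

definition FunMod ::
  "'o signature \<Rightarrow> 'o equation set \<Rightarrow> 'u set set \<Rightarrow>
   ((nat list, 'o trm set list, 'u set, 'u \<Rightarrow> 'u) ftor, nat list \<Rightarrow> 'u \<Rightarrow> 'u) cat" where
  "FunMod S E U = cartesian_functor_cat (classifying_cat S E) (Set_cat U)"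


section \<open>Covariant presheaves on \<open>\<F>\<close> and the substitution tensor\<close>

definition FF :: "(nat, nat \<Rightarrow> nat) cat" where
  "FF = \<lparr>obj = UNIV, hom = (\<lambda>m n. {..<m} \<rightarrow>\<^sub>E {..<n}), idt = (\<lambda>n. \<lambda>i\<in>{..<n}. i),
         cmp = (\<lambda>l m n g f. compose {..<l} g f)\<rparr>"

type_synonym 'a psh = "(nat, nat \<Rightarrow> nat, 'a set, 'a \<Rightarrow> 'a) ftor"

text \<open>
  Natural transformations between presheaves whose elements may have different types, as needed
  for maps such as \<open>A \<bullet> A \<rightarrow> A\<close>.
\<close>

definition psh_hom :: "'a psh \<Rightarrow> 'b psh \<Rightarrow> (nat \<Rightarrow> 'a \<Rightarrow> 'b) set" where
  "psh_hom X Y = {\<tau>. (\<forall>n. \<tau> n \<in> fobj X n \<rightarrow>\<^sub>E fobj Y n) \<and>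
     (\<forall>m n. \<forall>f\<in>hom FF m n. \<forall>x\<in>fobj X m. \<tau> n (fmap X m n f x) = fmap Y m n f (\<tau> m x))}"

definition yoneda :: "nat \<Rightarrow> (nat \<Rightarrow> nat) psh" where
  "yoneda n = \<lparr>fobj = hom FF n,
               fmap = (\<lambda>p q. \<lambda>f\<in>hom FF p q. \<lambda>g\<in>hom FF n p. cmp FF n p q f g)\<rparr>"

text \<open>The exponential \<open>A\<^sup>y\<^sup>n\<close>, in the form \<open>p \<mapsto> A (p + n)\<close>.\<close>

definition psh_shift :: "'a psh \<Rightarrow> nat \<Rightarrow> 'a psh" where
  "psh_shift A n = \<lparr>fobj = (\<lambda>p. fobj A (p + n)),
     fmap = (\<lambda>p q. \<lambda>f\<in>hom FF p q. fmap A (p + n) (q + n) (\<lambda>j\<in>{..<p + n}. ext p q f j))\<rparr>"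

definition psh_prod :: "'a psh list \<Rightarrow> 'a list psh" where
  "psh_prod Xs = \<lparr>fobj = (\<lambda>p. listset (map (\<lambda>X. fobj X p) Xs)),
     fmap = (\<lambda>p q. \<lambda>f\<in>hom FF p q. \<lambda>xs\<in>listset (map (\<lambda>X. fobj X p) Xs).
               map2 (\<lambda>X x. fmap X p q f x) Xs xs)\<rparr>"

text \<open>
  \<open>(X \<bullet> Y)(n) = \<integral>\<^sup>k X(k) \<times> Y(n)\<^sup>k\<close> is the quotient of the disjoint union of the sets \<open>X(k) \<times> Y(n)\<^sup>k\<close>
  by the equivalence relation generated by \<open>(X(f)(x), ys) \<sim> (x, ys \<circ> f)\<close> for \<open>f : [k] \<rightarrow> [l]\<close>.
  The summand of \<open>(x, ys)\<close> is determined by \<open>k = length ys\<close>.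
\<close>

definition tensor_pairs :: "'a psh \<Rightarrow> 'b psh \<Rightarrow> nat \<Rightarrow> ('a \<times> 'b list) set" where
  "tensor_pairs X Y n = {(x, ys). x \<in> fobj X (length ys) \<and> set ys \<subseteq> fobj Y n}"

inductive tensor_step :: "'a psh \<Rightarrow> 'b psh \<Rightarrow> nat \<Rightarrow> 'a \<times> 'b list \<Rightarrow> 'a \<times> 'b list \<Rightarrow> bool"
  for X :: "'a psh" and Y :: "'b psh" and n :: nat where
  "f \<in> hom FF k l \<Longrightarrow> x \<in> fobj X k \<Longrightarrow> length ys = l \<Longrightarrow> set ys \<subseteq> fobj Y n \<Longrightarrow>
   tensor_step X Y n (fmap X k l f x, ys) (x, map (\<lambda>i. ys ! f i) [0..<k])"

definition tensor_class :: "'a psh \<Rightarrow> 'b psh \<Rightarrow> nat \<Rightarrow> 'a \<times> 'b list \<Rightarrow> ('a \<times> 'b list) set" where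
  "tensor_class X Y n z = {w. equivclp (tensor_step X Y n) z w}"

text \<open>
  The value on an equivalence class \<open>c\<close> of a function \<open>g\<close> on representatives (used only for
  \<open>g\<close> constant on \<open>c\<close>).
\<close>

definition on_class :: "('a \<Rightarrow> 'b) \<Rightarrow> 'a set \<Rightarrow> 'b" where
  "on_class g c = the_elem (g ` c)"

definition tensor :: "'a psh \<Rightarrow> 'b psh \<Rightarrow> ('a \<times> 'b list) set psh" where
  "tensor X Y = \<lparr>fobj = (\<lambda>n. tensor_class X Y n ` tensor_pairs X Y n),
     fmap = (\<lambda>n p. \<lambda>f\<in>hom FF n p. \<lambda>c\<in>tensor_class X Y n ` tensor_pairs X Y n.
       on_class (\<lambda>(x, ys). tensor_class X Y p (x, map (fmap Y n p f) ys)) c)\<rparr>"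

text \<open>\<open>tensor_map X Y X' Y' \<tau> \<sigma> = \<tau> \<bullet> \<sigma> : X \<bullet> Y \<rightarrow> X' \<bullet> Y'\<close>.\<close>

definition tensor_map ::
  "'a psh \<Rightarrow> 'b psh \<Rightarrow> 'c psh \<Rightarrow> 'd psh \<Rightarrow> (nat \<Rightarrow> 'a \<Rightarrow> 'c) \<Rightarrow> (nat \<Rightarrow> 'b \<Rightarrow> 'd) \<Rightarrow>
   nat \<Rightarrow> ('a \<times> 'b list) set \<Rightarrow> ('c \<times> 'd list) set" where
  "tensor_map X Y X' Y' \<tau> \<sigma> n = (\<lambda>c\<in>fobj (tensor X Y) n.
     on_class (\<lambda>(x, ys). tensor_class X' Y' n (\<tau> (length ys) x, map (\<sigma> n) ys)) c)"

definition psh_id :: "'a psh \<Rightarrow> nat \<Rightarrow> 'a \<Rightarrow> 'a" where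
  "psh_id X n = (\<lambda>x\<in>fobj X n. x)"

text \<open>The unit and associativity isomorphisms of the substitution monoidal structure:
  \<open>y1 \<bullet> X \<cong> X\<close>, \<open>X \<bullet> y1 \<cong> X\<close> and \<open>(X \<bullet> Y) \<bullet> Z \<cong> X \<bullet> (Y \<bullet> Z)\<close>.\<close>

definition left_unitor :: "'a psh \<Rightarrow> nat \<Rightarrow> ((nat \<Rightarrow> nat) \<times> 'a list) set \<Rightarrow> 'a" where
  "left_unitor X n = (\<lambda>c\<in>fobj (tensor (yoneda 1) X) n. on_class (\<lambda>(f, xs). xs ! f 0) c)"

definition right_unitor :: "'a psh \<Rightarrow> nat \<Rightarrow> ('a \<times> (nat \<Rightarrow> nat) list) set \<Rightarrow> 'a" where
  "right_unitor X n = (\<lambda>c\<in>fobj (tensor X (yoneda 1)) n.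
     on_class (\<lambda>(x, fs). fmap X (length fs) n (\<lambda>i\<in>{..<length fs}. (fs ! i) 0) x) c)"

definition associator ::
  "'a psh \<Rightarrow> 'b psh \<Rightarrow> 'c psh \<Rightarrow> nat \<Rightarrow>
   (('a \<times> 'b list) set \<times> 'c list) set \<Rightarrow> ('a \<times> ('b \<times> 'c list) set list) set" where
  "associator X Y Z n = (\<lambda>c\<in>fobj (tensor (tensor X Y) Z) n.
     on_class (\<lambda>(d, zs). on_class (\<lambda>(x, ys).
       tensor_class X (tensor Y Z) n (x, map (\<lambda>y. tensor_class Y Z n (y, zs)) ys)) d) c)"

definition is_substitution_monoid ::
  "'u psh \<Rightarrow> (nat \<Rightarrow> (nat \<Rightarrow> nat) \<Rightarrow> 'u) \<Rightarrow> (nat \<Rightarrow> ('u \<times> 'u list) set \<Rightarrow> 'u) \<Rightarrow> bool" where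
  "is_substitution_monoid A \<nu> \<mu> \<longleftrightarrow>
     \<nu> \<in> psh_hom (yoneda 1) A \<and> \<mu> \<in> psh_hom (tensor A A) A \<and>
     (\<forall>n. \<forall>c\<in>fobj (tensor (yoneda 1) A) n.
        \<mu> n (tensor_map (yoneda 1) A A A \<nu> (psh_id A) n c) = left_unitor A n c) \<and>
     (\<forall>n. \<forall>c\<in>fobj (tensor A (yoneda 1)) n.
        \<mu> n (tensor_map A (yoneda 1) A A (psh_id A) \<nu> n c) = right_unitor A n c) \<and>
     (\<forall>n. \<forall>c\<in>fobj (tensor (tensor A A) A) n.
        \<mu> n (tensor_map (tensor A A) A A A \<mu> (psh_id A) n c) =
        \<mu> n (tensor_map A (tensor A A) A A (psh_id A) \<mu> n (associator A A A n c)))"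


section \<open>Algebraic models\<close>

record ('o, 'u) model =
  carr :: "'u psh"
  oper :: "'o \<Rightarrow> nat \<Rightarrow> 'u list \<Rightarrow> 'u"
  munit :: "nat \<Rightarrow> (nat \<Rightarrow> nat) \<Rightarrow> 'u"
  mmult :: "nat \<Rightarrow> ('u \<times> 'u list) set \<Rightarrow> 'u"

text \<open>Variables are counted from 0: \<open>mvar A q j\<close> is \<open>v\<^sup>(\<^sup>q\<^sup>)\<close> with index \<open>j + 1\<close>.\<close>

definition mvar :: "('o, 'u) model \<Rightarrow> nat \<Rightarrow> nat \<Rightarrow> 'u" where
  "mvar A q j = fmap (carr A) 1 q (\<lambda>i\<in>{..<1}. j) (munit A 1 (idt FF 1))"

text \<open>\<open>msub A q a bs\<close> is \<open>\<varsigma>\<^bsub>m,q\<^esub>(a, bs)\<close> with \<open>m = length bs\<close>.\<close>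

definition msub :: "('o, 'u) model \<Rightarrow> nat \<Rightarrow> 'u \<Rightarrow> 'u list \<Rightarrow> 'u" where
  "msub A q a bs = mmult A q (tensor_class (carr A) (carr A) q (a, bs))"

definition arg_psh :: "'o signature \<Rightarrow> ('o, 'u) model \<Rightarrow> 'o \<Rightarrow> 'u list psh" where
  "arg_psh S A f = psh_prod (map (psh_shift (carr A)) (arity S f))"

definition compatible :: "'o signature \<Rightarrow> ('o, 'u) model \<Rightarrow> bool" where
  "compatible S A \<longleftrightarrow>
     (\<forall>f\<in>operators S. \<forall>m p. \<forall>as\<in>fobj (arg_psh S A f) m.
        \<forall>bs. length bs = m \<and> set bs \<subseteq> fobj (carr A) p \<longrightarrow>
        msub A p (oper A f m as) bs =
        oper A f p (map2 (\<lambda>n a. msub A (p + n) a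
          (map (fmap (carr A) p (p + n) (\<lambda>j\<in>{..<p}. j)) bs @ map (mvar A (p + n)) [p..<p + n]))
          (arity S f) as))"

definition is_model :: "'o signature \<Rightarrow> 'u set set \<Rightarrow> ('o, 'u) model \<Rightarrow> bool" where
  "is_model S U A \<longleftrightarrow>
     is_functor FF (Set_cat U) (carr A) \<and>
     (\<forall>f\<in>operators S. oper A f \<in> psh_hom (arg_psh S A f) (carr A)) \<and>
     (\<forall>f. f \<notin> operators S \<longrightarrow> oper A f = undefined) \<and>
     is_substitution_monoid (carr A) (munit A) (mmult A) \<and>
     compatible S A"

definition is_model_hom ::
  "'o signature \<Rightarrow> ('o, 'u) model \<Rightarrow> ('o, 'u) model \<Rightarrow> (nat \<Rightarrow> 'u \<Rightarrow> 'u) \<Rightarrow> bool" where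
  "is_model_hom S A B h \<longleftrightarrow>
     h \<in> psh_hom (carr A) (carr B) \<and>
     (\<forall>f\<in>operators S. \<forall>p. \<forall>as\<in>fobj (arg_psh S A f) p.
        h p (oper A f p as) = oper B f p (map2 (\<lambda>n a. h (p + n) a) (arity S f) as)) \<and>
     (\<forall>n. \<forall>f\<in>fobj (yoneda 1) n. h n (munit A n f) = munit B n f) \<and>
     (\<forall>n. \<forall>c\<in>fobj (tensor (carr A) (carr A)) n.
        h n (mmult A n c) = mmult B n (tensor_map (carr A) (carr A) (carr B) (carr B) h h n c))"

definition model_cat ::
  "'o signature \<Rightarrow> 'u set set \<Rightarrow> (('o, 'u) model, nat \<Rightarrow> 'u \<Rightarrow> 'u) cat" where
  "model_cat S U =
     \<lparr>obj = {A. is_model S U A},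
      hom = (\<lambda>A B. {h. is_model_hom S A B h}),
      idt = (\<lambda>A. psh_id (carr A)),
      cmp = (\<lambda>A B C k h n. compose (fobj (carr A) n) (k n) (h n))\<rparr>"

text \<open>
  \<open>interp A p \<xi> n t\<close> is the interpretation at stage \<open>p\<close> of a term \<open>t\<close> in variable context \<open>n\<close>; the
  arity of a metavariable is read off from its argument list.
\<close>

fun interp :: "('o, 'u) model \<Rightarrow> nat \<Rightarrow> 'u list \<Rightarrow> nat \<Rightarrow> 'o trm \<Rightarrow> 'u" where
  "interp A p \<xi> n (Var j) = mvar A (p + n) (p + j)"
| "interp A p \<xi> n (MVar i ts) =
     msub A (p + n)
       (fmap (carr A) (p + length ts) (p + n + length ts)
          (\<lambda>j\<in>{..<p + length ts}. ext p (p + n) (\<lambda>j. j) j) (\<xi> ! i))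
       (map (mvar A (p + n)) [0..<p + n] @ map (interp A p \<xi> n) ts)"
| "interp A p \<xi> n (Op f bs) = oper A f (p + n) (map (\<lambda>(k, t). interp A p \<xi> (n + k) t) bs)"

definition satisfies :: "('o, 'u) model \<Rightarrow> 'o equation \<Rightarrow> bool" where
  "satisfies A = (\<lambda>(\<Theta>, n, s, t).
     \<forall>p. \<forall>\<xi>\<in>listset (map (\<lambda>m. fobj (carr A) (p + m)) \<Theta>). interp A p \<xi> n s = interp A p \<xi> n t)"

definition Mod ::
  "'o signature \<Rightarrow> 'o equation set \<Rightarrow> 'u set set \<Rightarrow> (('o, 'u) model, nat \<Rightarrow> 'u \<Rightarrow> 'u) cat" where
  "Mod S E U = full_subcat (model_cat S U) (\<lambda>A. \<forall>e\<in>E. satisfies A e)"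

end

theory Submission
  imports Defs
begin

text \<open>
  An algebraic model amounts to an abstract clone with operators: sets \<open>A n\<close> of terms in \<open>n\<close>
  variables, with variables, simultaneous substitution and operators compatible with it; renaming is
  substitution of variables, and naturality and the monoid laws over the tensor follow from the clone
  equations on representatives. Terms over a metavariable context \<open>\<Theta>\<close> form such a clone, and metasubstitution
  is evaluation in it, so all laws of metasubstitution come from one evaluation lemma for clones.

  A model gives the functor \<open>\<langle>m\<^sub>1, \<dots>, m\<^sub>k\<rangle> \<mapsto> \<Prod> A m\<^sub>i\<close>, on which a class of terms acts by
  evaluation; this is well defined by soundness. Conversely, a cartesian functor \<open>F\<close> has
  \<open>F \<langle>m\<^sub>1, \<dots>, m\<^sub>k\<rangle> \<cong> \<Prod> F \<langle>m\<^sub>i\<rangle>\<close>, and every \<open>\<xi>\<close> in this product defines a map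
  \<open>t \<mapsto> F [t] \<xi>\<close> from the terms over \<open>\<Theta> = \<langle>m\<^sub>1, \<dots>, m\<^sub>k\<rangle>\<close> to the sets \<open>F \<langle>n\<rangle>\<close> that sends the
  \<open>i\<close>-th metavariable to \<open>\<xi>\<^sub>i\<close>. As finitely many elements of the sets \<open>F \<langle>n\<rangle>\<close> lie in the image
  of one such map, these sets inherit the clone equations from terms.
\<close>


section \<open>Renaming and substitution of terms\<close>

text \<open>Two kinds of bookkeeping shape the proof. The first is the position of parameters. At
  stage \<open>p\<close> of an interpretation the \<open>p\<close> extra variables precede the
  context, in the metasubstitution rule \<open>\<Delta>\<close> follows it, and a binder adds its
  variables at the far right. If the value of a metavariable had to be weakened under each binder,
  these layouts would meet in every induction. Hence \<open>ev\<close> keeps values as closures and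
  moves only the list of parameters; a change of the parameters is isolated in
  \<open>ev_closure\<close>, and context and parameters are permuted in
  \<open>derivable_param\<close>.

  The second is the stage. A functor on the classifying category sees equations at stage 0, but
  satisfaction speaks of all stages. A metavariable of arity \<open>m\<close> at stage
  \<open>p\<close> is one of arity \<open>p + m\<close> at stage 0, so the stage is absorbed into
  the arities (\<open>metas_shift\<close>, \<open>gens_in_metas\<close>).

  Finally, \<open>U\<close> contains products only up to bijection, so the sets in the functor of a
  model consist of codes for tuples. Unit and counit are therefore encodings and decodings rather
  than identities.\<close>

lemma ren_cong:
  "wf_trm S \<Theta> m t \<Longrightarrow> (\<And>j. j < m \<Longrightarrow> \<rho> j = \<rho>' j) \<Longrightarrow> ren m p \<rho> t = ren m p \<rho>' t"
proof (induction arbitrary: p \<rho> \<rho>' rule: wf_trm.induct)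
  case (wf_Op f bs n)
  have "ren (n + k) (p + k) (ext n p \<rho>) t = ren (n + k) (p + k) (ext n p \<rho>') t"
    if "(k, t) \<in> set bs" for k t
    by (rule wf_Op.IH[OF that]) (simp add: ext_def wf_Op.prems)
  then show ?case by auto
next
  case (wf_MVar i ts n)
  have "ren n p \<rho> t = ren n p \<rho>' t" if "t \<in> set ts" for t
    by (rule wf_MVar.IH[OF that]) (simp add: wf_MVar.prems)
  then show ?case by simp
qed simp

lemma ext_less: "(\<And>j. j < m \<Longrightarrow> \<rho> j < p) \<Longrightarrow> j < m + k \<Longrightarrow> ext m p \<rho> j < p + k"
  by (cases "j < m") (simp_all add: ext_def trans_less_add1)

lemma wf_ren:
  "wf_trm S \<Theta> m t \<Longrightarrow> (\<And>j. j < m \<Longrightarrow> \<rho> j < p) \<Longrightarrow> wf_trm S \<Theta> p (ren m p \<rho> t)"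
proof (induction arbitrary: p \<rho> rule: wf_trm.induct)
  case (wf_Op f bs n)
  have "map fst (map (\<lambda>(k, t). (k, ren (n + k) (p + k) (ext n p \<rho>) t)) bs) = arity S f"
    using wf_Op(2) by (simp add: case_prod_beta comp_def)
  moreover have "wf_trm S \<Theta> (p + k) (ren (n + k) (p + k) (ext n p \<rho>) t)" if "(k, t) \<in> set bs" for k t
    by (rule wf_Op(4)[OF that]) (simp add: ext_less wf_Op.prems)
  ultimately show ?case
    using wf_Op(1) by (auto intro!: wf_trm.wf_Op)
next
  case (wf_MVar i ts n)
  have "wf_trm S \<Theta> p (ren n p \<rho> t)" if "t \<in> set ts" for t
    using wf_MVar.IH[OF that] wf_MVar.prems by blast
  then show ?case
    using wf_MVar.hyps by (auto intro!: wf_trm.wf_MVar)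
qed (auto intro: wf_trm.wf_Var)

lemma ren_ren:
  "wf_trm S \<Theta> m t \<Longrightarrow> (\<And>j. j < m \<Longrightarrow> \<rho> j < n) \<Longrightarrow> ren n p \<rho>' (ren m n \<rho> t) = ren m p (\<lambda>j. \<rho>' (\<rho> j)) t"
proof (induction arbitrary: n p \<rho> \<rho>' rule: wf_trm.induct)
  case (wf_Op f bs m)
  have "ren (n + k) (p + k) (ext n p \<rho>') (ren (m + k) (n + k) (ext m n \<rho>) t) =
      ren (m + k) (p + k) (ext m p (\<lambda>j. \<rho>' (\<rho> j))) t" if "(k, t) \<in> set bs" for k t
  proof -
    have "ren (n + k) (p + k) (ext n p \<rho>') (ren (m + k) (n + k) (ext m n \<rho>) t) =
      ren (m + k) (p + k) (\<lambda>j. ext n p \<rho>' (ext m n \<rho> j)) t"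
      by (rule wf_Op(4)[OF that]) (simp add: ext_less wf_Op.prems)
    also have "\<dots> = ren (m + k) (p + k) (ext m p (\<lambda>j. \<rho>' (\<rho> j))) t"
      by (rule ren_cong[OF wf_Op(3)[OF that]]) (use wf_Op.prems in \<open>auto simp: ext_def\<close>)
    finally show ?thesis .
  qed
  then show ?case by (auto simp: case_prod_beta)
qed auto

lemma wf_subst:
  "wf_trm S \<Theta> m t \<Longrightarrow> length \<sigma> = m \<Longrightarrow> (\<And>s. s \<in> set \<sigma> \<Longrightarrow> wf_trm S \<Theta> p s) \<Longrightarrow>
   wf_trm S \<Theta> p (subst p \<sigma> t)"
proof (induction arbitrary: p \<sigma> rule: wf_trm.induct)
  case (wf_Op f bs n)
  let ?l = "\<lambda>k. map (ren p (p + k) (\<lambda>j. j)) \<sigma> @ map Var [p..<p + k]"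
  have "map fst (map (\<lambda>(k, t). (k, subst (p + k) (?l k) t)) bs) = arity S f"
    using wf_Op(2) by (simp add: case_prod_beta comp_def)
  moreover have "wf_trm S \<Theta> (p + k) (subst (p + k) (?l k) t)" if "(k, t) \<in> set bs" for k t
    using wf_Op.prems by (intro wf_Op(4)[OF that]) (auto intro!: wf_ren wf_trm.intros(1))
  ultimately show ?case
    using wf_Op(1) by (auto intro!: wf_trm.wf_Op)
next
  case (wf_MVar i ts n)
  have "wf_trm S \<Theta> p (subst p \<sigma> t)" if "t \<in> set ts" for t
    using wf_MVar.IH[OF that] wf_MVar.prems by blast
  then show ?case
    using wf_MVar.hyps by (auto intro!: wf_trm.wf_MVar)
qed auto

lemma subst_ren:
  "wf_trm S \<Theta> m t \<Longrightarrow> (\<And>j. j < m \<Longrightarrow> \<rho> j < n) \<Longrightarrow> length \<sigma> = n \<Longrightarrow>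
   subst p \<sigma> (ren m n \<rho> t) = subst p (map (\<lambda>j. \<sigma> ! \<rho> j) [0..<m]) t"
proof (induction arbitrary: n p \<rho> \<sigma> rule: wf_trm.induct)
  case (wf_Op f bs m)
  let ?l = "\<lambda>k \<sigma>. map (ren p (p + k) (\<lambda>j. j)) \<sigma> @ map Var [p..<p + k]"
  have "subst (p + k) (?l k \<sigma>) (ren (m + k) (n + k) (ext m n \<rho>) t) =
      subst (p + k) (?l k (map (\<lambda>j. \<sigma> ! \<rho> j) [0..<m])) t" if "(k, t) \<in> set bs" for k t
  proof -
    have "subst (p + k) (?l k \<sigma>) (ren (m + k) (n + k) (ext m n \<rho>) t) =
      subst (p + k) (map (\<lambda>j. ?l k \<sigma> ! ext m n \<rho> j) [0..<m + k]) t"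
      by (rule wf_Op(4)[OF that]) (simp_all add: ext_less wf_Op.prems)
    also have "map (\<lambda>j. ?l k \<sigma> ! ext m n \<rho> j) [0..<m + k] = ?l k (map (\<lambda>j. \<sigma> ! \<rho> j) [0..<m])"
      by (rule nth_equalityI) (use wf_Op.prems in \<open>auto simp: ext_def nth_append\<close>)
    finally show ?thesis .
  qed
  then show ?case by (auto simp: case_prod_beta)
qed auto

lemma ren_subst:
  "wf_trm S \<Theta> m t \<Longrightarrow> length \<sigma> = m \<Longrightarrow> (\<And>s. s \<in> set \<sigma> \<Longrightarrow> wf_trm S \<Theta> n s) \<Longrightarrow>
   (\<And>j. j < n \<Longrightarrow> \<rho> j < p) \<Longrightarrow>
   ren n p \<rho> (subst n \<sigma> t) = subst p (map (ren n p \<rho>) \<sigma>) t"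
proof (induction arbitrary: n p \<rho> \<sigma> rule: wf_trm.induct)
  case (wf_Op f bs m)
  let ?l = "\<lambda>p k \<sigma>. map (ren p (p + k) (\<lambda>j. j)) \<sigma> @ map Var [p..<p + k]"
  have "ren (n + k) (p + k) (ext n p \<rho>) (subst (n + k) (?l n k \<sigma>) t) =
      subst (p + k) (?l p k (map (ren n p \<rho>) \<sigma>)) t" if "(k, t) \<in> set bs" for k t
  proof -
    have *: "ren (n + k) (p + k) (ext n p \<rho>) (ren n (n + k) (\<lambda>j. j) s) =
        ren p (p + k) (\<lambda>j. j) (ren n p \<rho> s)" if "s \<in> set \<sigma>" for s
    proof -
      have s: "wf_trm S \<Theta> n s" using that wf_Op.prems by auto
      have "ren (n + k) (p + k) (ext n p \<rho>) (ren n (n + k) (\<lambda>j. j) s) =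
          ren n (p + k) (\<lambda>j. ext n p \<rho> j) s"
        by (rule ren_ren[OF s]) simp
      also have "\<dots> = ren n (p + k) \<rho> s"
        by (rule ren_cong[OF s]) (simp add: ext_def)
      also have "\<dots> = ren p (p + k) (\<lambda>j. j) (ren n p \<rho> s)"
        by (rule ren_ren[OF s, symmetric]) (simp add: wf_Op.prems)
      finally show ?thesis .
    qed
    have "ren (n + k) (p + k) (ext n p \<rho>) (subst (n + k) (?l n k \<sigma>) t) =
      subst (p + k) (map (ren (n + k) (p + k) (ext n p \<rho>)) (?l n k \<sigma>)) t"
      by (rule wf_Op(4)[OF that])
        (use wf_Op.prems(1,2) in \<open>auto simp: ext_less[OF wf_Op.prems(3)] intro!: wf_ren wf_trm.intros(1)\<close>)
    also have "map (ren (n + k) (p + k) (ext n p \<rho>)) (?l n k \<sigma>) = ?l p k (map (ren n p \<rho>) \<sigma>)"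
      by (rule nth_equalityI) (use wf_Op.prems in \<open>auto simp: ext_def nth_append *\<close>)
    finally show ?thesis .
  qed
  then show ?case by (auto simp: case_prod_beta)
qed auto

text \<open>Under a binder the substituted terms are weakened by \<open>ren\<close>, so the
  induction step needs weakening to commute with \<open>subst p \<tau>\<close>. This is
  \<open>subst_ren\<close> followed by \<open>ren_subst\<close>, which is why those two come
  first.\<close>

lemma subst_subst:
  "wf_trm S \<Theta> m t \<Longrightarrow> length \<sigma> = m \<Longrightarrow> (\<And>s. s \<in> set \<sigma> \<Longrightarrow> wf_trm S \<Theta> n s) \<Longrightarrow>
   length \<tau> = n \<Longrightarrow> (\<And>s. s \<in> set \<tau> \<Longrightarrow> wf_trm S \<Theta> p s) \<Longrightarrow>
   subst p \<tau> (subst n \<sigma> t) = subst p (map (subst p \<tau>) \<sigma>) t"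
proof (induction arbitrary: n p \<sigma> \<tau> rule: wf_trm.induct)
  case (wf_Op f bs m)
  let ?l = "\<lambda>p k \<sigma>. map (ren p (p + k) (\<lambda>j. j)) \<sigma> @ map Var [p..<p + k]"
  have "subst (p + k) (?l p k \<tau>) (subst (n + k) (?l n k \<sigma>) t) =
      subst (p + k) (?l p k (map (subst p \<tau>) \<sigma>)) t" if "(k, t) \<in> set bs" for k t
  proof -
    have *: "subst (p + k) (?l p k \<tau>) (ren n (n + k) (\<lambda>j. j) s) =
        ren p (p + k) (\<lambda>j. j) (subst p \<tau> s)" if "s \<in> set \<sigma>" for s
    proof -
      have s: "wf_trm S \<Theta> n s" using that wf_Op.prems by auto
      have "subst (p + k) (?l p k \<tau>) (ren n (n + k) (\<lambda>j. j) s) =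
         subst (p + k) (map (\<lambda>j. ?l p k \<tau> ! j) [0..<n]) s"
        by (rule subst_ren[OF s]) (use wf_Op.prems in auto)
      also have "map (\<lambda>j. ?l p k \<tau> ! j) [0..<n] = map (ren p (p + k) (\<lambda>j. j)) \<tau>"
        by (rule nth_equalityI) (use wf_Op.prems in \<open>auto simp: nth_append\<close>)
      also have "subst (p + k) \<dots> s = ren p (p + k) (\<lambda>j. j) (subst p \<tau> s)"
        by (rule ren_subst[OF s, symmetric]) (use wf_Op.prems in auto)
      finally show ?thesis .
    qed
    have "subst (p + k) (?l p k \<tau>) (subst (n + k) (?l n k \<sigma>) t) =
      subst (p + k) (map (subst (p + k) (?l p k \<tau>)) (?l n k \<sigma>)) t"
      by (rule wf_Op(4)[OF that])
        (use wf_Op.prems in \<open>auto intro!: wf_ren wf_trm.intros(1)\<close>)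
    also have "map (subst (p + k) (?l p k \<tau>)) (?l n k \<sigma>) = ?l p k (map (subst p \<tau>) \<sigma>)"
      by (rule nth_equalityI) (use wf_Op.prems in \<open>auto simp: nth_append *\<close>)
    finally show ?thesis .
  qed
  then show ?case by (auto simp: case_prod_beta)
qed auto

lemma subst_vars: "wf_trm S \<Theta> m t \<Longrightarrow> subst m (map Var [0..<m]) t = t"
proof (induction rule: wf_trm.induct)
  case (wf_Op f bs m)
  \<comment> \<open>With de Bruijn levels weakening fixes \<open>Var j\<close>, so the list extended
    under a binder is again the list of all variables.\<close>
  have *: "map Var [0..<m] @ map Var [m..<m + k] = map Var [0..<m + k]" for k
    by (simp flip: map_append upt_add_eq_append)
  have **: "ren m (m + k) (\<lambda>j. j) (Var j) = Var j" for k j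
    by simp
  have "map (\<lambda>(k, t). (k, subst (m + k) (map (ren m (m + k) (\<lambda>j. j)) (map Var [0..<m]) @ map Var [m..<m + k]) t)) bs = bs"
    using wf_Op(4) by (intro map_idI) (simp only: map_map comp_def ren.simps * split_beta prod.collapse)
  then show ?case by simp
qed (auto intro!: map_idI)

text \<open>A clone has substitution as its only primitive; in this form renaming of terms becomes
  an instance of \<open>plug\<close> in the term clone.\<close>

lemma ren_conv_subst:
  assumes "wf_trm S \<Theta> m t" "\<And>j. j < m \<Longrightarrow> \<rho> j < p"
  shows "ren m p \<rho> t = subst p (map (\<lambda>j. Var (\<rho> j)) [0..<m]) t"
proof -
  have "ren m p \<rho> t = subst p (map Var [0..<p]) (ren m p \<rho> t)"
    using subst_vars[OF wf_ren[OF assms]] by simp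
  also have "\<dots> = subst p (map (\<lambda>j. map Var [0..<p] ! \<rho> j) [0..<m]) t"
    by (rule subst_ren[OF assms]) auto
  also have "map (\<lambda>j. map Var [0..<p] ! \<rho> j) [0..<m] = map (\<lambda>j. Var (\<rho> j)) [0..<m]"
    using assms(2) by auto
  finally show ?thesis .
qed

section \<open>Abstract clones with operators\<close>

lemma in_listset: "xs \<in> listset As \<longleftrightarrow> length xs = length As \<and> (\<forall>i<length As. xs ! i \<in> As ! i)"
proof (induction As arbitrary: xs)
  case (Cons A As)
  show ?case
    by (cases xs) (auto simp: set_Cons_def Cons.IH nth_Cons split: nat.splits)
qed simp

lemma map_pair_cong:
  "(\<And>k t. (k, t) \<in> set bs \<Longrightarrow> F k t = G k t) \<Longrightarrow> map (\<lambda>(k, t). F k t) bs = map (\<lambda>(k, t). G k t) bs"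
  by auto

text \<open>
  \<open>plug A q x ys\<close> substitutes \<open>ys\<close> in \<open>A q\<close> for the variables of \<open>x\<close> in \<open>A (length ys)\<close>, as
  \<open>msub\<close> does for models.
\<close>

record ('o, 'u) clone_ops =
  elts :: "nat \<Rightarrow> 'u set"
  vbl :: "nat \<Rightarrow> nat \<Rightarrow> 'u"
  plug :: "nat \<Rightarrow> 'u \<Rightarrow> 'u list \<Rightarrow> 'u"
  opr :: "'o \<Rightarrow> nat \<Rightarrow> 'u list \<Rightarrow> 'u"

definition vbls :: "('o, 'u) clone_ops \<Rightarrow> nat \<Rightarrow> nat \<Rightarrow> nat \<Rightarrow> 'u list" where
  "vbls A q a b = map (vbl A q) [a..<b]"

definition wk :: "('o, 'u) clone_ops \<Rightarrow> nat \<Rightarrow> nat \<Rightarrow> 'u \<Rightarrow> 'u" where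
  "wk A p k x = plug A (p + k) x (vbls A (p + k) 0 p)"

text \<open>The substitution extended under a binder of \<open>k\<close> variables, as in the
  \<open>Op\<close> case of \<open>subst\<close>.\<close>

definition lift :: "('o, 'u) clone_ops \<Rightarrow> nat \<Rightarrow> nat \<Rightarrow> 'u list \<Rightarrow> 'u list" where
  "lift A p k xs = map (wk A p k) xs @ vbls A (p + k) p (p + k)"

text \<open>One set with two uses: the valuations of a metavariable context at stage
  \<open>p\<close>, and the argument lists of an operator whose arity is
  \<open>\<Theta>\<close>.\<close>

definition metas :: "('o, 'u) clone_ops \<Rightarrow> nat \<Rightarrow> nat list \<Rightarrow> 'u list set" where
  "metas A p \<Theta> = listset (map (\<lambda>m. elts A (p + m)) \<Theta>)"

text \<open>
  In \<open>ev A q \<phi> e c t\<close> the list \<open>c\<close> assigns values at stage \<open>q\<close> to the variables of \<open>t\<close>. The value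
  of a metavariable of arity \<open>m\<close> is a closure: an element of \<open>A (length e + m)\<close> whose first
  \<open>length e\<close> variables are parameters with values \<open>e\<close>. Only \<open>e\<close> and \<open>c\<close> are weakened under a
  binder, while \<open>\<phi>\<close> stays fixed.
\<close>

fun ev :: "('o, 'u) clone_ops \<Rightarrow> nat \<Rightarrow> 'u list \<Rightarrow> 'u list \<Rightarrow> 'u list \<Rightarrow> 'o trm \<Rightarrow> 'u" where
  "ev A q \<phi> e c (Var j) = c ! j"
| "ev A q \<phi> e c (MVar i ts) = plug A q (\<phi> ! i) (e @ map (ev A q \<phi> e c) ts)"
| "ev A q \<phi> e c (Op f bs) =
     opr A f q (map (\<lambda>(k, t). ev A (q + k) \<phi> (map (wk A q k) e) (lift A q k c) t) bs)"

text \<open>The generic evaluation: the parameters are the first \<open>p\<close> variables of stage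
  \<open>p + n\<close> and the context is the remaining \<open>n\<close>, which is the layout of
  \<open>interp\<close>.\<close>

definition denote :: "('o, 'u) clone_ops \<Rightarrow> nat \<Rightarrow> 'u list \<Rightarrow> nat \<Rightarrow> 'o trm \<Rightarrow> 'u" where
  "denote A p \<phi> n t = ev A (p + n) \<phi> (vbls A (p + n) 0 p) (vbls A (p + n) p (p + n)) t"

lemma in_metas:
  "\<phi> \<in> metas A p \<Theta> \<longleftrightarrow> length \<phi> = length \<Theta> \<and> (\<forall>i<length \<Theta>. \<phi> ! i \<in> elts A (p + \<Theta> ! i))"
  by (auto simp: metas_def in_listset)

lemma length_vbls [simp]: "length (vbls A q a b) = b - a"
  by (simp add: vbls_def)

lemma vbls_empty [simp]: "vbls A q a a = []"
  by (simp add: vbls_def)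

lemma nth_vbls [simp]: "j < b - a \<Longrightarrow> vbls A q a b ! j = vbl A q (a + j)"
  by (simp add: vbls_def)

lemma length_lift [simp]: "length (lift A p k xs) = length xs + k"
  by (simp add: lift_def)

lemma nth_lift:
  "j < length xs + k \<Longrightarrow>
   lift A p k xs ! j = (if j < length xs then wk A p k (xs ! j) else vbl A (p + k) (p + (j - length xs)))"
  by (auto simp: lift_def nth_append)

lemma vbls_append: "a \<le> b \<Longrightarrow> b \<le> c \<Longrightarrow> vbls A q a b @ vbls A q b c = vbls A q a c"
  using upt_add_eq_append[of a b "c - b"] by (simp add: vbls_def flip: map_append)

lemma wf_msubst:
  "wf_trm S ms n t \<Longrightarrow> map fst \<sigma> = ms \<Longrightarrow> (\<And>m s. (m, s) \<in> set \<sigma> \<Longrightarrow> wf_trm S \<Theta> (n + m) s) \<Longrightarrow>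
   wf_trm S \<Theta> n (msubst n \<sigma> t)"
proof (induction arbitrary: \<sigma> rule: wf_trm.induct)
  case (wf_Var j n)
  then show ?case by (auto intro: wf_trm.intros)
next
  case (wf_MVar i ts n)
  obtain m s where ms: "\<sigma> ! i = (m, s)" by fastforce
  have i: "i < length \<sigma>" "m = length ts"
    using wf_MVar.hyps(1,2) ms by (auto simp flip: wf_MVar.prems(1))
  then have "wf_trm S \<Theta> (n + length ts) s"
    using wf_MVar.prems(2)[of m s] ms nth_mem[of i \<sigma>] by simp
  moreover have "wf_trm S \<Theta> n (msubst n \<sigma> t)" if "t \<in> set ts" for t
    using wf_MVar.prems by (intro wf_MVar.IH[OF that])
  ultimately show ?case
    by (auto simp: ms intro!: wf_subst wf_trm.intros(1))
next
  case (wf_Op f bs n)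
  let ?\<sigma> = "\<lambda>k. map (\<lambda>(m, s). (m, ren (n + m) (n + k + m) (ext n (n + k) (\<lambda>j. j)) s)) \<sigma>"
  have "map fst (map (\<lambda>(k, t). (k, msubst (n + k) (?\<sigma> k) t)) bs) = arity S f"
    using wf_Op(2) by (simp add: case_prod_beta comp_def)
  moreover have "wf_trm S \<Theta> (n + k) (msubst (n + k) (?\<sigma> k) t)" if "(k, t) \<in> set bs" for k t
    using wf_Op.prems by (intro wf_Op.IH[OF that]) (auto intro!: wf_ren simp: ext_def)
  ultimately show ?case
    using wf_Op(1) by (auto intro!: wf_trm.wf_Op)
qed

text \<open>\<open>plug_vbl\<close>, \<open>plug_vbls\<close> and \<open>plug_plug\<close> are the
  unit laws and the associativity of the substitution monoid; \<open>plug_opr\<close> is its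
  compatibility with the operators.\<close>

locale clone =
  fixes S :: "'o signature" and A :: "('o, 'u) clone_ops"
  assumes vbl_in: "j < q \<Longrightarrow> vbl A q j \<in> elts A q"
    and plug_in: "x \<in> elts A (length ys) \<Longrightarrow> set ys \<subseteq> elts A q \<Longrightarrow> plug A q x ys \<in> elts A q"
    and opr_in: "f \<in> operators S \<Longrightarrow> xs \<in> metas A p (arity S f) \<Longrightarrow> opr A f p xs \<in> elts A p"
    and plug_vbl: "j < length ys \<Longrightarrow> set ys \<subseteq> elts A q \<Longrightarrow> plug A q (vbl A (length ys) j) ys = ys ! j"
    and plug_vbls: "x \<in> elts A q \<Longrightarrow> plug A q x (vbls A q 0 q) = x"
    and plug_plug: "x \<in> elts A (length ys) \<Longrightarrow> set ys \<subseteq> elts A (length zs) \<Longrightarrow> set zs \<subseteq> elts A r \<Longrightarrow>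
      plug A r (plug A (length zs) x ys) zs = plug A r x (map (\<lambda>y. plug A r y zs) ys)"
    and plug_opr: "f \<in> operators S \<Longrightarrow> xs \<in> metas A (length ys) (arity S f) \<Longrightarrow> set ys \<subseteq> elts A p \<Longrightarrow>
      plug A p (opr A f (length ys) xs) ys =
      opr A f p (map2 (\<lambda>k x. plug A (p + k) x (lift A p k ys)) (arity S f) xs)"
begin

lemma vbls_in: "b \<le> q \<Longrightarrow> set (vbls A q a b) \<subseteq> elts A q"
  by (auto simp: vbls_def intro: vbl_in)

lemma wk_in: "x \<in> elts A p \<Longrightarrow> wk A p k x \<in> elts A (p + k)"
  unfolding wk_def by (rule plug_in) (simp_all add: vbls_in)

lemma map_wk_in: "set xs \<subseteq> elts A p \<Longrightarrow> set (map (wk A p k) xs) \<subseteq> elts A (p + k)"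
  by (auto intro: wk_in)

lemma lift_in: "set xs \<subseteq> elts A p \<Longrightarrow> set (lift A p k xs) \<subseteq> elts A (p + k)"
  using map_wk_in[of xs p k] vbls_in[of "p + k" "p + k" p] by (simp add: lift_def)

lemma map_plug_vbls:
  "length zs = q \<Longrightarrow> set zs \<subseteq> elts A r \<Longrightarrow> b \<le> q \<Longrightarrow>
   map (\<lambda>y. plug A r y zs) (vbls A q a b) = map ((!) zs) [a..<b]"
  using plug_vbl[of _ zs r] by (auto simp: vbls_def)

lemma wk_vbl: "j < p \<Longrightarrow> wk A p k (vbl A p j) = vbl A (p + k) j"
  unfolding wk_def using plug_vbl[of j "vbls A (p + k) 0 p" "p + k"] vbls_in[of p "p + k" 0] by simp

lemma map_wk_vbls: "b \<le> p \<Longrightarrow> map (wk A p k) (vbls A p a b) = vbls A (p + k) a b"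
  by (auto simp: vbls_def wk_vbl)

lemma plug_wk:
  assumes x: "x \<in> elts A p" and zs: "length zs = p + k" "set zs \<subseteq> elts A r"
  shows "plug A r (wk A p k x) zs = plug A r x (take p zs)"
proof -
  have "plug A r (wk A p k x) zs = plug A r x (map (\<lambda>y. plug A r y zs) (vbls A (p + k) 0 p))"
    unfolding wk_def using plug_plug[of x "vbls A (p + k) 0 p" zs r] assms vbls_in[of p "p + k" 0] by simp
  also have "map (\<lambda>y. plug A r y zs) (vbls A (p + k) 0 p) = take p zs"
    using zs by (subst map_plug_vbls) (auto intro!: nth_equalityI)
  finally show ?thesis .
qed

lemma plug_lift_wk:
  assumes x: "x \<in> elts A q" and ys: "length ys = q" "set ys \<subseteq> elts A r"
  shows "plug A (r + k) (wk A q k x) (lift A r k ys) = wk A r k (plug A r x ys)"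
proof -
  have "plug A (r + k) (wk A q k x) (lift A r k ys) = plug A (r + k) x (take q (lift A r k ys))"
    using assms by (intro plug_wk) (auto simp: lift_in)
  also have "take q (lift A r k ys) = map (wk A r k) ys"
    using ys by (simp add: lift_def)
  also have "plug A (r + k) x \<dots> = wk A r k (plug A r x ys)"
    unfolding wk_def using plug_plug[of x ys "vbls A (r + k) 0 r" "r + k"] assms vbls_in[of r "r + k" 0]
    by simp
  finally show ?thesis .
qed

text \<open>Drives the binder case of \<open>ev_plug\<close>: the weakened entries are handled by
  \<open>plug_lift_wk\<close>, and new variables go to new variables.\<close>

lemma lift_plug:
  assumes xs: "set xs \<subseteq> elts A q" and ys: "length ys = q" "set ys \<subseteq> elts A r"
  shows "map (\<lambda>x. plug A (r + k) x (lift A r k ys)) (lift A q k xs) =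
    lift A r k (map (\<lambda>x. plug A r x ys) xs)"
proof -
  have "map (\<lambda>x. plug A (r + k) x (lift A r k ys)) (vbls A (q + k) q (q + k)) = vbls A (r + k) r (r + k)"
    using ys by (subst map_plug_vbls) (auto simp: lift_in nth_lift intro!: nth_equalityI)
  moreover have "map (\<lambda>x. plug A (r + k) (wk A q k x) (lift A r k ys)) xs =
      map (\<lambda>x. wk A r k (plug A r x ys)) xs"
    using assms by (auto simp: plug_lift_wk)
  ultimately show ?thesis
    by (simp add: lift_def[of A q] lift_def[of A r k "map _ _"] comp_def)
qed

lemma map_plug_map_wk:
  assumes xs: "set xs \<subseteq> elts A q" and ys: "length ys = q" "set ys \<subseteq> elts A r"
  shows "map (\<lambda>x. plug A (r + k) x (lift A r k ys)) (map (wk A q k) xs) =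
    map (wk A r k) (map (\<lambda>x. plug A r x ys) xs)"
  using assms by (auto simp: plug_lift_wk)

lemma ev_in:
  "wf_trm S \<Theta> n t \<Longrightarrow> \<phi> \<in> metas A p \<Theta> \<Longrightarrow> length e = p \<Longrightarrow> set e \<subseteq> elts A q \<Longrightarrow>
   length c = n \<Longrightarrow> set c \<subseteq> elts A q \<Longrightarrow> ev A q \<phi> e c t \<in> elts A q"
proof (induction arbitrary: q e c rule: wf_trm.induct)
  case (wf_Var j n)
  then show ?case by auto
next
  case (wf_MVar i ts n)
  then show ?case by (auto simp: in_metas intro!: plug_in)
next
  case (wf_Op f bs n)
  have "ev A (q + k) \<phi> (map (wk A q k) e) (lift A q k c) t \<in> elts A (q + k)" if "(k, t) \<in> set bs" for k t
    using wf_Op.prems by (intro wf_Op.IH[OF that] lift_in map_wk_in) auto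
  then show ?case
    by (auto simp: in_metas case_prod_beta simp flip: wf_Op(2) intro!: opr_in wf_Op(1))
qed

text \<open>Closures in \<open>\<phi>\<close> have no free variables beyond their parameters and
  arguments, so a substitution into the result reaches only the parameter values \<open>e\<close>
  and the variable values \<open>c\<close>. The metavariable case is \<open>plug_plug\<close>, the
  operator case \<open>plug_opr\<close>.\<close>

lemma ev_plug:
  "wf_trm S \<Theta> n t \<Longrightarrow> \<phi> \<in> metas A p \<Theta> \<Longrightarrow> length e = p \<Longrightarrow> set e \<subseteq> elts A q \<Longrightarrow>
   length c = n \<Longrightarrow> set c \<subseteq> elts A q \<Longrightarrow> length ys = q \<Longrightarrow> set ys \<subseteq> elts A r \<Longrightarrow>
   plug A r (ev A q \<phi> e c t) ys =
   ev A r \<phi> (map (\<lambda>x. plug A r x ys) e) (map (\<lambda>x. plug A r x ys) c) t"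
proof (induction arbitrary: q e c r ys rule: wf_trm.induct)
  case (wf_Var j n)
  then show ?case by auto
next
  case (wf_MVar i ts n)
  have "set (map (ev A q \<phi> e c) ts) \<subseteq> elts A q"
    using wf_MVar by (auto intro: ev_in)
  then have "plug A r (ev A q \<phi> e c (MVar i ts)) ys =
      plug A r (\<phi> ! i) (map (\<lambda>x. plug A r x ys) (e @ map (ev A q \<phi> e c) ts))"
    using wf_MVar.prems wf_MVar.hyps plug_plug[of "\<phi> ! i" "e @ map (ev A q \<phi> e c) ts" ys r]
    by (simp add: in_metas)
  then show ?case
    using wf_MVar.prems by (auto simp: wf_MVar.IH cong: map_cong)
next
  case (wf_Op f bs n)
  let ?as = "map (\<lambda>(k, t). ev A (q + k) \<phi> (map (wk A q k) e) (lift A q k c) t) bs"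
  have "ev A (q + k) \<phi> (map (wk A q k) e) (lift A q k c) t \<in> elts A (q + k)" if "(k, t) \<in> set bs" for k t
    using wf_Op.prems by (intro ev_in[OF wf_Op(3)[OF that]] lift_in map_wk_in) auto
  then have as: "?as \<in> metas A (length ys) (arity S f)"
    using wf_Op.prems by (auto simp: in_metas case_prod_beta simp flip: wf_Op(2))
  have IH: "plug A (r + k) (ev A (q + k) \<phi> (map (wk A q k) e) (lift A q k c) t) (lift A r k ys) =
     ev A (r + k) \<phi> (map (wk A r k) (map (\<lambda>x. plug A r x ys) e)) (lift A r k (map (\<lambda>x. plug A r x ys) c)) t"
    if "(k, t) \<in> set bs" for k t
    using wf_Op.prems
    by (subst wf_Op.IH[OF that]) (simp_all add: map_plug_map_wk lift_plug lift_in map_wk_in del: map_map set_map)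
  have "plug A r (ev A q \<phi> e c (Op f bs)) ys =
     opr A f r (map2 (\<lambda>k x. plug A (r + k) x (lift A r k ys)) (arity S f) ?as)"
    using plug_opr[OF wf_Op(1) as] wf_Op.prems by simp
  also have "map2 (\<lambda>k x. plug A (r + k) x (lift A r k ys)) (arity S f) ?as =
     map (\<lambda>(k, t). ev A (r + k) \<phi> (map (wk A r k) (map (\<lambda>x. plug A r x ys) e))
       (lift A r k (map (\<lambda>x. plug A r x ys) c)) t) bs"
    unfolding wf_Op(2)[symmetric] map2_map_map using IH by (auto simp del: map_map)
  finally show ?case by (simp del: map_map)
qed

lemma ev_ren:
  "wf_trm S \<Theta> n t \<Longrightarrow> (\<And>j. j < n \<Longrightarrow> \<rho> j < n') \<Longrightarrow> length c = n' \<Longrightarrow>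
   ev A q \<phi> e c (ren n n' \<rho> t) = ev A q \<phi> e (map (\<lambda>j. c ! \<rho> j) [0..<n]) t"
proof (induction arbitrary: q e c n' \<rho> rule: wf_trm.induct)
  case (wf_MVar i ts n)
  have "ev A q \<phi> e c (ren n n' \<rho> t) = ev A q \<phi> e (map (\<lambda>j. c ! \<rho> j) [0..<n]) t" if "t \<in> set ts" for t
    by (rule wf_MVar.IH[OF that]) (simp_all add: wf_MVar.prems)
  then show ?case by (auto simp: comp_def cong: map_cong)
next
  case (wf_Op f bs n)
  have "ev A (q + k) \<phi> (map (wk A q k) e) (lift A q k c) (ren (n + k) (n' + k) (ext n n' \<rho>) t) =
      ev A (q + k) \<phi> (map (wk A q k) e) (lift A q k (map (\<lambda>j. c ! \<rho> j) [0..<n])) t"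
    if "(k, t) \<in> set bs" for k t
  proof -
    have "ev A (q + k) \<phi> (map (wk A q k) e) (lift A q k c) (ren (n + k) (n' + k) (ext n n' \<rho>) t) =
      ev A (q + k) \<phi> (map (wk A q k) e) (map (\<lambda>j. lift A q k c ! ext n n' \<rho> j) [0..<n + k]) t"
      by (rule wf_Op.IH[OF that]) (simp_all add: ext_less wf_Op.prems)
    also have "map (\<lambda>j. lift A q k c ! ext n n' \<rho> j) [0..<n + k] = lift A q k (map (\<lambda>j. c ! \<rho> j) [0..<n])"
      by (rule nth_equalityI) (auto simp: nth_lift ext_def wf_Op.prems trans_less_add1)
    finally show ?thesis .
  qed
  then show ?case
    by (auto simp: case_prod_beta comp_def intro!: arg_cong[of _ _ "opr A f q"])
qed simp

lemma ev_wk: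
  assumes "wf_trm S \<Theta> n t" "\<phi> \<in> metas A p \<Theta>" "length e = p" "set e \<subseteq> elts A q"
   "length c = n" "set c \<subseteq> elts A q"
  shows "ev A (q + k) \<phi> (map (wk A q k) e) (map (wk A q k) c) t = wk A q k (ev A q \<phi> e c t)"
  unfolding wk_def using assms by (subst ev_plug[of \<Theta> n _ _ p]) (simp_all add: vbls_in)

lemma ev_subst:
  "wf_trm S \<Theta> m t \<Longrightarrow> length \<sigma> = m \<Longrightarrow> (\<And>s. s \<in> set \<sigma> \<Longrightarrow> wf_trm S \<Theta> n s) \<Longrightarrow>
   \<phi> \<in> metas A p \<Theta> \<Longrightarrow> length e = p \<Longrightarrow> set e \<subseteq> elts A q \<Longrightarrow>
   length c = n \<Longrightarrow> set c \<subseteq> elts A q \<Longrightarrow>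
   ev A q \<phi> e c (subst n \<sigma> t) = ev A q \<phi> e (map (ev A q \<phi> e c) \<sigma>) t"
proof (induction arbitrary: q e c n \<sigma> rule: wf_trm.induct)
  case (wf_MVar i ts m)
  have "ev A q \<phi> e c (subst n \<sigma> t) = ev A q \<phi> e (map (ev A q \<phi> e c) \<sigma>) t" if "t \<in> set ts" for t
    by (rule wf_MVar.IH[OF that]) (use wf_MVar.prems in simp_all)
  then show ?case by (auto simp: comp_def cong: map_cong)
next
  case (wf_Op f bs m)
  let ?\<sigma> = "\<lambda>k. map (ren n (n + k) (\<lambda>j. j)) \<sigma> @ map Var [n..<n + k]"
  have "ev A (q + k) \<phi> (map (wk A q k) e) (lift A q k c) (subst (n + k) (?\<sigma> k) t) =
      ev A (q + k) \<phi> (map (wk A q k) e) (lift A q k (map (ev A q \<phi> e c) \<sigma>)) t"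
    if "(k, t) \<in> set bs" for k t
  proof -
    have wk: "ev A (q + k) \<phi> (map (wk A q k) e) (lift A q k c) (ren n (n + k) (\<lambda>j. j) s) =
        wk A q k (ev A q \<phi> e c s)" if "s \<in> set \<sigma>" for s
    proof -
      have s: "wf_trm S \<Theta> n s" using that wf_Op.prems by simp
      have "ev A (q + k) \<phi> (map (wk A q k) e) (lift A q k c) (ren n (n + k) (\<lambda>j. j) s) =
        ev A (q + k) \<phi> (map (wk A q k) e) (map (\<lambda>j. lift A q k c ! j) [0..<n]) s"
        by (rule ev_ren[OF s]) (simp_all add: wf_Op.prems)
      also have "map (\<lambda>j. lift A q k c ! j) [0..<n] = map (wk A q k) c"
        by (rule nth_equalityI) (auto simp: nth_lift wf_Op.prems)
      also have "ev A (q + k) \<phi> (map (wk A q k) e) \<dots> s = wk A q k (ev A q \<phi> e c s)"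
        by (rule ev_wk[OF s]) (use wf_Op.prems in auto)
      finally show ?thesis .
    qed
    have "ev A (q + k) \<phi> (map (wk A q k) e) (lift A q k c) (subst (n + k) (?\<sigma> k) t) =
      ev A (q + k) \<phi> (map (wk A q k) e)
        (map (ev A (q + k) \<phi> (map (wk A q k) e) (lift A q k c)) (?\<sigma> k)) t"
      using wf_Op.prems
      by (intro wf_Op.IH[OF that] lift_in map_wk_in) (auto intro!: wf_ren wf_trm.intros(1))
    also have "map (ev A (q + k) \<phi> (map (wk A q k) e) (lift A q k c)) (?\<sigma> k) =
        lift A q k (map (ev A q \<phi> e c) \<sigma>)"
      by (rule nth_equalityI) (use wf_Op.prems in \<open>auto simp: nth_lift nth_append wk\<close>)
    finally show ?thesis .
  qed
  then show ?case
    by (auto simp: case_prod_beta comp_def intro!: arg_cong[of _ _ "opr A f q"])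
qed simp

text \<open>Each \<open>\<psi> ! i\<close> is \<open>\<phi> ! i\<close> with its parameters replaced
  by the entries of \<open>xs\<close>, which in turn depend on \<open>p'\<close> new parameters. By
  \<open>plug_plug\<close> only the composite of \<open>xs\<close> with the parameter values
  matters. This absorbs the change in the number of parameters when abstractions are
  weakened.\<close>

lemma ev_closure:
  assumes \<phi>: "\<phi> \<in> metas A p \<Theta>" "length xs = p" and \<psi>: "length \<psi> = length \<Theta>"
    "\<And>i. i < length \<Theta> \<Longrightarrow> \<psi> ! i = plug A (p' + \<Theta> ! i) (\<phi> ! i) (lift A p' (\<Theta> ! i) xs)"
    and xs: "set xs \<subseteq> elts A p'"
  shows "wf_trm S \<Theta> n t \<Longrightarrow> length e = p' \<Longrightarrow> set e \<subseteq> elts A q \<Longrightarrow>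
    length c = n \<Longrightarrow> set c \<subseteq> elts A q \<Longrightarrow>
    ev A q \<psi> e c t = ev A q \<phi> (map (\<lambda>x. plug A q x e) xs) c t"
proof (induction arbitrary: q e c rule: wf_trm.induct)
  case (wf_MVar i ts n)
  let ?e = "map (\<lambda>x. plug A q x e) xs"
  let ?ts = "map (ev A q \<phi> ?e c) ts"
  have e: "set ?e \<subseteq> elts A q"
    using xs wf_MVar.prems by (auto intro!: plug_in)
  have ts: "set ?ts \<subseteq> elts A q"
  proof -
    have "ev A q \<phi> ?e c t \<in> elts A q" if "t \<in> set ts" for t
      by (rule ev_in[OF wf_MVar.hyps(3)[OF that] \<phi>(1) _ e]) (simp_all add: \<phi>(2) wf_MVar.prems)
    then show ?thesis by auto
  qed
  have i: "\<Theta> ! i = length ts" using wf_MVar.hyps by simp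
  then have \<phi>i: "\<phi> ! i \<in> elts A (p + length ts)"
    using \<phi>(1) wf_MVar.hyps(1) by (metis in_metas)
  have lift: "set (lift A p' (length ts) xs) \<subseteq> elts A (p' + length ts)"
    by (rule lift_in[OF xs])
  have "map (ev A q \<psi> e c) ts = ?ts"
    by (rule map_cong[OF HOL.refl wf_MVar.IH[OF _ wf_MVar.prems]])
  then have "ev A q \<psi> e c (MVar i ts) = plug A q (\<psi> ! i) (e @ ?ts)"
    by (simp only: ev.simps)
  also have "\<dots> = plug A q (\<phi> ! i) (map (\<lambda>y. plug A q y (e @ ?ts)) (lift A p' (length ts) xs))"
    using plug_plug[of "\<phi> ! i" "lift A p' (length ts) xs" "e @ ?ts" q] wf_MVar.prems wf_MVar.hyps(1) \<phi>(2) \<psi>(2)[of i] lift ts \<phi>i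
    by (simp add: i)
  also have "map (\<lambda>y. plug A q y (e @ ?ts)) (lift A p' (length ts) xs) = ?e @ ?ts"
  proof -
    have "plug A q (wk A p' (length ts) x) (e @ ?ts) = plug A q x e" if "x \<in> set xs" for x
      using plug_wk[of x p' "e @ ?ts" "length ts" q] that xs ts wf_MVar.prems by auto
    moreover have "map (\<lambda>y. plug A q y (e @ ?ts)) (vbls A (p' + length ts) p' (p' + length ts)) = ?ts"
      using wf_MVar.prems ts
      by (subst map_plug_vbls) (auto intro!: nth_equalityI simp: nth_append)
    ultimately show ?thesis by (simp add: lift_def)
  qed
  finally show ?case by simp
next
  case (wf_Op f bs n)
  have "ev A (q + k) \<psi> (map (wk A q k) e) (lift A q k c) t =
     ev A (q + k) \<phi> (map (wk A q k) (map (\<lambda>x. plug A q x e) xs)) (lift A q k c) t" if "(k, t) \<in> set bs" for k t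
  proof -
    have "ev A (q + k) \<psi> (map (wk A q k) e) (lift A q k c) t =
     ev A (q + k) \<phi> (map (\<lambda>x. plug A (q + k) x (map (wk A q k) e)) xs) (lift A q k c) t"
      using wf_Op.prems by (intro wf_Op.IH[OF that] lift_in map_wk_in) auto
    also have "map (\<lambda>x. plug A (q + k) x (map (wk A q k) e)) xs = map (wk A q k) (map (\<lambda>x. plug A q x e) xs)"
      using xs wf_Op.prems plug_plug[of _ e "vbls A (q + k) 0 q" "q + k"] vbls_in[of q "q + k" 0]
      by (auto simp: wk_def[abs_def])
    finally show ?thesis .
  qed
  then show ?case
    unfolding ev.simps by (rule arg_cong[OF map_pair_cong])
qed simp

lemma denote_in: "wf_trm S \<Theta> n t \<Longrightarrow> \<phi> \<in> metas A p \<Theta> \<Longrightarrow> denote A p \<phi> n t \<in> elts A (p + n)"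
  unfolding denote_def by (rule ev_in) (simp_all add: vbls_in)

text \<open>\<open>denote\<close> evaluates at variables, so by \<open>ev_plug\<close> every other
  evaluation arises from it by substituting \<open>e @ c\<close>. An equation between denotations
  therefore holds for all parameters and all values.\<close>

lemma ev_conv_denote:
  assumes "wf_trm S \<Theta> n t" "\<phi> \<in> metas A p \<Theta>" "length e = p" "set e \<subseteq> elts A q"
   "length c = n" "set c \<subseteq> elts A q"
  shows "ev A q \<phi> e c t = plug A q (denote A p \<phi> n t) (e @ c)"
proof -
  have "map ((!) (e @ c)) [0..<p] = e" "map ((!) (e @ c)) [p..<p + n] = c"
    using assms by (auto intro!: nth_equalityI simp: nth_append)
  then show ?thesis
    unfolding denote_def using assms vbls_in[of _ "p + n"]
    by (subst ev_plug[of \<Theta> n _ _ p]) (simp_all add: map_plug_vbls)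
qed

text \<open>An abstracted term may mention the \<open>n\<close> context variables, so its closure
  has the parameters \<open>e @ c\<close>. Thus \<open>c\<close> occurs twice on the right: inside
  the parameters and as the values for the variables of \<open>t\<close>. Under a binder the first
  copy is merely weakened while the second is extended by the bound variables; the induction
  hypothesis extends both, which \<open>ev_closure\<close> repairs.\<close>

lemma ev_msubst:
  "wf_trm S ms n t \<Longrightarrow> map fst \<sigma> = ms \<Longrightarrow> (\<And>m s. (m, s) \<in> set \<sigma> \<Longrightarrow> wf_trm S \<Theta> (n + m) s) \<Longrightarrow>
   \<phi> \<in> metas A p \<Theta> \<Longrightarrow> length e = p \<Longrightarrow> set e \<subseteq> elts A q \<Longrightarrow>
   length c = n \<Longrightarrow> set c \<subseteq> elts A q \<Longrightarrow>
   ev A q \<phi> e c (msubst n \<sigma> t) = ev A q (map (\<lambda>(m, s). denote A p \<phi> (n + m) s) \<sigma>) (e @ c) c t"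
proof (induction arbitrary: q e c \<sigma> rule: wf_trm.induct)
  case (wf_Var j n)
  then show ?case by simp
next
  case (wf_MVar i ts n)
  let ?\<psi> = "map (\<lambda>(m, s). denote A p \<phi> (n + m) s) \<sigma>"
  let ?ts = "map (ev A q ?\<psi> (e @ c) c) ts"
  obtain m s where ms: "\<sigma> ! i = (m, s)" by fastforce
  have i: "i < length \<sigma>" "m = length ts"
    using wf_MVar.hyps(1,2) ms by (auto simp flip: wf_MVar.prems(1))
  then have s: "wf_trm S \<Theta> (n + length ts) s"
    using wf_MVar.prems(2)[of m s] ms nth_mem[of i \<sigma>] by simp
  have IH: "map (ev A q \<phi> e c) (map (msubst n \<sigma>) ts) = ?ts"
  proof -
    have "ev A q \<phi> e c (msubst n \<sigma> t) = ev A q ?\<psi> (e @ c) c t" if "t \<in> set ts" for t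
      using wf_MVar.prems by (intro wf_MVar.IH[OF that])
    then show ?thesis by simp
  qed
  have wf: "wf_trm S \<Theta> n (msubst n \<sigma> t)" if "t \<in> set ts" for t
    using wf_MVar.hyps(3)[OF that] wf_MVar.prems by (intro wf_msubst)
  have ts: "set ?ts \<subseteq> elts A q"
    unfolding IH[symmetric] using wf_MVar.prems wf by (auto intro!: ev_in[of \<Theta> n _ \<phi> p])
  have vars: "map (ev A q \<phi> e c) (map Var [0..<n]) = c"
    by (rule nth_equalityI) (simp_all add: wf_MVar.prems)
  have wf': "wf_trm S \<Theta> n u" if "u \<in> set (map Var [0..<n] @ map (msubst n \<sigma>) ts)" for u
    using that wf by (auto intro: wf_trm.intros(1))
  have c: "length (c @ ?ts) = n + length ts" "set (c @ ?ts) \<subseteq> elts A q"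
    using wf_MVar.prems ts by simp_all
  have "ev A q \<phi> e c (msubst n \<sigma> (MVar i ts)) =
      ev A q \<phi> e c (subst n (map Var [0..<n] @ map (msubst n \<sigma>) ts) s)"
    by (simp add: ms)
  also have "\<dots> = ev A q \<phi> e (map (ev A q \<phi> e c) (map Var [0..<n] @ map (msubst n \<sigma>) ts)) s"
    by (rule ev_subst[OF s _ wf' wf_MVar.prems(3-)]) simp_all
  also have "\<dots> = ev A q \<phi> e (c @ ?ts) s"
    by (simp only: map_append vars IH)
  also have "\<dots> = plug A q (denote A p \<phi> (n + length ts) s) (e @ c @ ?ts)"
    by (rule ev_conv_denote[OF s wf_MVar.prems(3-5) c])
  finally show ?case
    using i by (simp add: ms)
next
  case (wf_Op f bs n)
  let ?\<psi> = "map (\<lambda>(m, s). denote A p \<phi> (n + m) s) \<sigma>"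
  let ?\<sigma> = "\<lambda>k. map (\<lambda>(m, s). (m, ren (n + m) (n + k + m) (ext n (n + k) (\<lambda>j. j)) s)) \<sigma>"
  have "ev A (q + k) \<phi> (map (wk A q k) e) (lift A q k c) (msubst (n + k) (?\<sigma> k) t) =
     ev A (q + k) ?\<psi> (map (wk A q k) (e @ c)) (lift A q k c) t" if "(k, t) \<in> set bs" for k t
  proof -
    let ?\<chi> = "map (\<lambda>(m, s). denote A p \<phi> (n + k + m) s) (?\<sigma> k)"
    let ?e = "map (wk A q k) e @ lift A q k c"
    have e: "length ?e = p + (n + k)" "set ?e \<subseteq> elts A (q + k)"
      using wf_Op.prems lift_in[of c q k] map_wk_in[of e q k] by (simp_all del: set_map)
    have "map fst (?\<sigma> k) = ms"
      using wf_Op.prems(1) by (simp add: comp_def split_beta)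
    moreover have "wf_trm S \<Theta> (n + k + m) s" if "(m, s) \<in> set (?\<sigma> k)" for m s
      using that wf_Op.prems(2) by (auto intro!: wf_ren simp: ext_def)
    ultimately have "ev A (q + k) \<phi> (map (wk A q k) e) (lift A q k c) (msubst (n + k) (?\<sigma> k) t) =
      ev A (q + k) ?\<chi> ?e (lift A q k c) t"
      by (rule wf_Op.IH[OF that])
        (simp_all add: wf_Op.prems lift_in map_wk_in del: set_map)
    \<comment> \<open>The weakened abstractions in \<open>?\<sigma> k\<close> denote closures
      \<open>?\<chi>\<close> over \<open>p + (n + k)\<close> parameters. They depend only on the
      first \<open>p + n\<close> of these, so \<open>ev_closure\<close> with \<open>xs\<close> the
      first \<open>p + n\<close> variables brings back \<open>?\<psi>\<close>.\<close>
    also have "\<dots> = ev A (q + k) ?\<psi>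
        (map (\<lambda>x. plug A (q + k) x ?e) (vbls A (p + (n + k)) 0 (p + n))) (lift A q k c) t"
    proof (rule ev_closure[OF _ _ _ _ _ wf_Op(3)[OF that] e])
      show "?\<psi> \<in> metas A (p + n) ms"
        unfolding in_metas
      proof (intro conjI allI impI)
        fix i assume "i < length ms"
        moreover obtain m s where "\<sigma> ! i = (m, s)" by fastforce
        ultimately show "?\<psi> ! i \<in> elts A (p + n + ms ! i)"
          using wf_Op.prems(2)[of m s] nth_mem[of i \<sigma>] denote_in[of \<Theta> "n + m" s \<phi> p] wf_Op.prems(3)
          by (simp add: add.assoc flip: wf_Op.prems(1))
      qed (simp flip: wf_Op.prems(1))
      show "?\<chi> ! i = plug A (p + (n + k) + ms ! i) (?\<psi> ! i)
          (lift A (p + (n + k)) (ms ! i) (vbls A (p + (n + k)) 0 (p + n)))" if "i < length ms" for i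
      proof -
        obtain m s where "\<sigma> ! i = (m, s)" by fastforce
        moreover have "i < length \<sigma>" using that by (simp flip: wf_Op.prems(1))
        ultimately have i: "i < length \<sigma>" "\<sigma> ! i = (m, s)" and m: "ms ! i = m" and s: "wf_trm S \<Theta> (n + m) s"
          using wf_Op.prems(2)[of m s] nth_mem[of i \<sigma>] by (simp_all flip: wf_Op.prems(1))
        \<comment> \<open>\<open>?ds\<close> lists all variables except the \<open>k\<close> bound
          ones, which lie between the context and the \<open>m\<close> abstracted variables.\<close>
        let ?ds = "lift A (p + (n + k)) m (vbls A (p + (n + k)) 0 (p + n))"
        have ds: "length ?ds = p + (n + m)" "set ?ds \<subseteq> elts A (p + (n + k) + m)"
          by simp (rule lift_in, rule vbls_in, simp)
        have 1: "map (\<lambda>x. plug A (p + (n + k) + m) x ?ds) (vbls A (p + (n + m)) 0 p) =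
            vbls A (p + (n + k + m)) 0 p"
          unfolding map_plug_vbls[OF ds le_add1]
          by (rule nth_equalityI) (simp_all add: nth_lift wk_vbl add.assoc)
        have 2: "map (\<lambda>x. plug A (p + (n + k) + m) x ?ds) (vbls A (p + (n + m)) p (p + (n + m))) =
            map (\<lambda>j. vbls A (p + (n + k + m)) p (p + (n + k + m)) ! ext n (n + k) (\<lambda>j. j) j) [0..<n + m]"
          unfolding map_plug_vbls[OF ds order.refl]
          by (rule nth_equalityI) (auto simp: nth_lift wk_vbl ext_def add.assoc)
        have "?\<chi> ! i = denote A p \<phi> (n + k + m) (ren (n + m) (n + k + m) (ext n (n + k) (\<lambda>j. j)) s)"
          using i by simp
        also have "\<dots> = ev A (p + (n + k + m)) \<phi> (vbls A (p + (n + k + m)) 0 p)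
            (map (\<lambda>j. vbls A (p + (n + k + m)) p (p + (n + k + m)) ! ext n (n + k) (\<lambda>j. j) j) [0..<n + m]) s"
          unfolding denote_def by (rule ev_ren[OF s]) (auto simp: ext_def)
        also have "\<dots> = plug A (p + (n + k) + m) (denote A p \<phi> (n + m) s) ?ds"
          unfolding 1[symmetric] 2[symmetric] denote_def using ds wf_Op.prems
          by (subst ev_plug[OF s, where p = p]) (simp_all add: vbls_in add.assoc)
        finally show ?thesis using i by (simp add: m)
      qed
    qed (simp_all add: wf_Op.prems lift_in vbls_in flip: wf_Op.prems(1))
    also have "map (\<lambda>x. plug A (q + k) x ?e) (vbls A (p + (n + k)) 0 (p + n)) = map (wk A q k) (e @ c)"
      using e wf_Op.prems by (subst map_plug_vbls) (auto intro!: nth_equalityI simp: nth_append nth_lift)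
    finally show ?thesis .
  qed
  note * = this
  have "ev A q \<phi> e c (msubst n \<sigma> (Op f bs)) = opr A f q
      (map (\<lambda>(k, t). ev A (q + k) \<phi> (map (wk A q k) e) (lift A q k c) (msubst (n + k) (?\<sigma> k) t)) bs)"
    by (simp add: comp_def split_def)
  also have "\<dots> = opr A f q (map (\<lambda>(k, t). ev A (q + k) ?\<psi> (map (wk A q k) (e @ c)) (lift A q k c) t) bs)"
    by (rule arg_cong[OF map_pair_cong[OF *]])
  finally show ?case by simp
qed

end

section \<open>Terms as a clone, and soundness\<close>

definition term_clone :: "'o signature \<Rightarrow> nat list \<Rightarrow> ('o, 'o trm) clone_ops" where
  "term_clone S \<Theta> = \<lparr>elts = (\<lambda>n. {t. wf_trm S \<Theta> n t}), vbl = (\<lambda>n j. Var j),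
     plug = (\<lambda>q t ts. subst q ts t), opr = (\<lambda>f p ts. Op f (zip (arity S f) ts))\<rparr>"

lemma term_clone_sel [simp]:
  "elts (term_clone S \<Theta>) n = {t. wf_trm S \<Theta> n t}"
  "vbl (term_clone S \<Theta>) n j = Var j"
  "plug (term_clone S \<Theta>) q t ts = subst q ts t"
  "opr (term_clone S \<Theta>) f p ts = Op f (zip (arity S f) ts)"
  by (simp_all add: term_clone_def)

lemma vbls_term_clone [simp]: "vbls (term_clone S \<Theta>) q a b = map Var [a..<b]"
  by (simp add: vbls_def)

lemma wk_term_clone: "wf_trm S \<Theta> p t \<Longrightarrow> wk (term_clone S \<Theta>) p k t = ren p (p + k) (\<lambda>j. j) t"
  by (simp add: wk_def ren_conv_subst)

lemma lift_term_clone: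
  "set ts \<subseteq> {t. wf_trm S \<Theta> p t} \<Longrightarrow>
   lift (term_clone S \<Theta>) p k ts = map (ren p (p + k) (\<lambda>j. j)) ts @ map Var [p..<p + k]"
  by (auto simp: lift_def wk_term_clone)

lemma wf_Op_zip:
  assumes "f \<in> operators S" "length ts = length (arity S f)"
    "\<And>i. i < length ts \<Longrightarrow> wf_trm S \<Theta> (n + arity S f ! i) (ts ! i)"
  shows "wf_trm S \<Theta> n (Op f (zip (arity S f) ts))"
  using assms by (auto simp: in_set_zip intro!: wf_trm.wf_Op)

lemma clone_term_clone: "clone S (term_clone S \<Theta>)"
proof
  fix f xs ys p
  assume f: "f \<in> operators S" and xs: "xs \<in> metas (term_clone S \<Theta>) (length ys) (arity S f)"
    and ys: "set ys \<subseteq> elts (term_clone S \<Theta>) p"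
  show "plug (term_clone S \<Theta>) p (opr (term_clone S \<Theta>) f (length ys) xs) ys =
      opr (term_clone S \<Theta>) f p
        (map2 (\<lambda>k x. plug (term_clone S \<Theta>) (p + k) x (lift (term_clone S \<Theta>) p k ys)) (arity S f) xs)"
    using xs ys by (auto simp: lift_term_clone in_metas intro!: nth_equalityI)
next
  fix x ys zs r
  assume "x \<in> elts (term_clone S \<Theta>) (length ys)" "set ys \<subseteq> elts (term_clone S \<Theta>) (length zs)"
    "set zs \<subseteq> elts (term_clone S \<Theta>) r"
  then show "plug (term_clone S \<Theta>) r (plug (term_clone S \<Theta>) (length zs) x ys) zs =
      plug (term_clone S \<Theta>) r x (map (\<lambda>y. plug (term_clone S \<Theta>) r y zs) ys)"
    using subst_subst[of S \<Theta> "length ys" x ys "length zs" zs r] by auto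
qed (auto simp: in_metas subst_vars intro!: wf_Op_zip intro: wf_subst wf_trm.wf_Var)

section \<open>Homomorphisms of clones\<close>

definition is_clone_hom ::
  "'o signature \<Rightarrow> ('o, 'a) clone_ops \<Rightarrow> ('o, 'b) clone_ops \<Rightarrow> (nat \<Rightarrow> 'a \<Rightarrow> 'b) \<Rightarrow> bool" where
  "is_clone_hom S A B h \<longleftrightarrow>
     (\<forall>n. \<forall>x\<in>elts A n. h n x \<in> elts B n) \<and>
     (\<forall>n. \<forall>j<n. h n (vbl A n j) = vbl B n j) \<and>
     (\<forall>q x ys. x \<in> elts A (length ys) \<longrightarrow> set ys \<subseteq> elts A q \<longrightarrow>
        h q (plug A q x ys) = plug B q (h (length ys) x) (map (h q) ys)) \<and>
     (\<forall>f\<in>operators S. \<forall>p. \<forall>xs\<in>metas A p (arity S f).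
        h p (opr A f p xs) = opr B f p (map2 (\<lambda>k x. h (p + k) x) (arity S f) xs))"

context clone
begin

context
  fixes B :: "('o, 'b) clone_ops" and h :: "nat \<Rightarrow> 'u \<Rightarrow> 'b"
  assumes h: "is_clone_hom S A B h"
begin

lemma hom_vbls: "b \<le> q \<Longrightarrow> map (h q) (vbls A q a b) = vbls B q a b"
  using h by (auto simp: vbls_def is_clone_hom_def)

lemma hom_wk: "x \<in> elts A p \<Longrightarrow> h (p + k) (wk A p k x) = wk B p k (h p x)"
  using h vbls_in[of p "p + k" 0] by (simp add: wk_def is_clone_hom_def hom_vbls)

lemma hom_lift: "set xs \<subseteq> elts A p \<Longrightarrow> map (h (p + k)) (lift A p k xs) = lift B p k (map (h p) xs)"
  by (auto simp: lift_def hom_vbls hom_wk)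

lemma ev_hom:
  "wf_trm S \<Theta> n t \<Longrightarrow> \<phi> \<in> metas A p \<Theta> \<Longrightarrow> length e = p \<Longrightarrow> set e \<subseteq> elts A q \<Longrightarrow>
   length c = n \<Longrightarrow> set c \<subseteq> elts A q \<Longrightarrow>
   h q (ev A q \<phi> e c t) = ev B q (map2 (\<lambda>m x. h (p + m) x) \<Theta> \<phi>) (map (h q) e) (map (h q) c) t"
proof (induction arbitrary: q e c rule: wf_trm.induct)
  case (wf_Var j n)
  then show ?case by simp
next
  case (wf_MVar i ts n)
  have "ev A q \<phi> e c t \<in> elts A q" if "t \<in> set ts" for t
    by (rule ev_in[OF wf_MVar.hyps(3)[OF that] wf_MVar.prems])
  then have ts: "set (e @ map (ev A q \<phi> e c) ts) \<subseteq> elts A q"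
    using wf_MVar.prems by auto
  have \<phi>: "\<phi> ! i \<in> elts A (length (e @ map (ev A q \<phi> e c) ts))"
    using wf_MVar.prems(1,2) wf_MVar.hyps(1,2) by (simp add: in_metas)
  have IH: "map (h q) (map (ev A q \<phi> e c) ts) =
      map (ev B q (map2 (\<lambda>m x. h (p + m) x) \<Theta> \<phi>) (map (h q) e) (map (h q) c)) ts"
    unfolding map_map comp_def by (rule map_cong[OF HOL.refl wf_MVar.IH[OF _ wf_MVar.prems]])
  have "h q (ev A q \<phi> e c (MVar i ts)) =
      plug B q (h (p + \<Theta> ! i) (\<phi> ! i)) (map (h q) e @ map (h q) (map (ev A q \<phi> e c) ts))"
    using h \<phi> ts wf_MVar.hyps(2) wf_MVar.prems(2) by (simp add: is_clone_hom_def)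
  then show ?case
    using wf_MVar.hyps(1) wf_MVar.prems(1) by (simp only: IH) (simp add: in_metas)
next
  case (wf_Op f bs n)
  let ?as = "map (\<lambda>(k, t). ev A (q + k) \<phi> (map (wk A q k) e) (lift A q k c) t) bs"
  let ?\<psi> = "map2 (\<lambda>m x. h (p + m) x) \<Theta> \<phi>"
  note e = wf_Op.prems(1-3)
  have "ev A (q + k) \<phi> (map (wk A q k) e) (lift A q k c) t \<in> elts A (q + k)" if "(k, t) \<in> set bs" for k t
    using wf_Op.prems by (intro ev_in[OF wf_Op(3)[OF that]] lift_in map_wk_in) auto
  then have as: "?as \<in> metas A q (arity S f)"
    by (auto simp: in_metas case_prod_beta simp flip: wf_Op(2))
  have IH: "h (q + k) (ev A (q + k) \<phi> (map (wk A q k) e) (lift A q k c) t) =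
      ev B (q + k) ?\<psi> (map (wk B q k) (map (h q) e)) (lift B q k (map (h q) c)) t"
    if "(k, t) \<in> set bs" for k t
  proof -
    have "h (q + k) (ev A (q + k) \<phi> (map (wk A q k) e) (lift A q k c) t) =
      ev B (q + k) ?\<psi> (map (h (q + k)) (map (wk A q k) e)) (map (h (q + k)) (lift A q k c)) t"
      using wf_Op.prems by (intro wf_Op.IH[OF that] lift_in map_wk_in) auto
    also have "map (h (q + k)) (map (wk A q k) e) = map (wk B q k) (map (h q) e)"
      using wf_Op.prems by (auto simp: hom_wk)
    also have "map (h (q + k)) (lift A q k c) = lift B q k (map (h q) c)"
      using wf_Op.prems by (simp add: hom_lift)
    finally show ?thesis .
  qed
  have "h q (ev A q \<phi> e c (Op f bs)) = opr B f q (map2 (\<lambda>k x. h (q + k) x) (arity S f) ?as)"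
    using h as wf_Op(1) by (simp add: is_clone_hom_def)
  also have "map2 (\<lambda>k x. h (q + k) x) (arity S f) ?as =
      map (\<lambda>(k, t). ev B (q + k) ?\<psi> (map (wk B q k) (map (h q) e)) (lift B q k (map (h q) c)) t) bs"
    unfolding wf_Op(2)[symmetric] map2_map_map using IH by (auto simp del: map_map)
  finally show ?case by simp
qed

lemma denote_hom:
  assumes "wf_trm S \<Theta> n t" "\<phi> \<in> metas A p \<Theta>"
  shows "h (p + n) (denote A p \<phi> n t) = denote B p (map2 (\<lambda>m x. h (p + m) x) \<Theta> \<phi>) n t"
  unfolding denote_def using assms
  by (subst ev_hom[where \<Theta> = \<Theta> and p = p and n = n]) (simp_all add: vbls_in hom_vbls)

end

text \<open>In the metasubstitution rule \<open>t\<close> lives over the first \<open>g\<close>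
  variables and the abstractions over the last \<open>d\<close>. Hence \<open>t\<close> takes its
  variables from \<open>take g c\<close>, while the closures get \<open>drop g c\<close> as
  additional parameters.\<close>

lemma ev_abstrs:
  assumes t: "wf_trm S ms g t" and ss: "length ss = length ms"
      "\<And>i. i < length ms \<Longrightarrow> wf_trm S \<Theta> (d + ms ! i) (ss ! i)"
    and \<phi>: "\<phi> \<in> metas A p \<Theta>" and e: "length e = p" "set e \<subseteq> elts A q"
    and c: "length c = g + d" "set c \<subseteq> elts A q"
  shows "ev A q \<phi> e c (msubst (g + d) (abstrs g d ms ss) (ren g (g + d) (\<lambda>j. j) t)) =
    ev A q (map2 (\<lambda>m s. denote A p \<phi> (d + m) s) ms ss) (e @ drop g c) (take g c) t"
proof -
  let ?\<psi> = "map (\<lambda>(m, s). denote A p \<phi> (g + d + m) s) (abstrs g d ms ss)"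
  let ?\<chi> = "map2 (\<lambda>m s. denote A p \<phi> (d + m) s) ms ss"
  let ?N = "p + (g + d)"
  \<comment> \<open>\<open>ev_msubst\<close> produces closures whose parameters include the
    \<open>g\<close> variables of \<open>\<Gamma>\<close>; \<open>?xs\<close> omits these, as the
    weakened \<open>ss\<close> do not mention them.\<close>
  let ?xs = "vbls A ?N 0 p @ vbls A ?N (p + g) ?N"
  have wf: "wf_trm S \<Theta> (g + d + m) s" if "(m, s) \<in> set (abstrs g d ms ss)" for m s
    using that ss by (auto simp: abstrs_def in_set_zip add.assoc intro!: wf_ren)
  have xs: "set ?xs \<subseteq> elts A ?N"
    using vbls_in[of p ?N 0] vbls_in[of ?N ?N "p + g"] by auto
  have c': "set (take g c) \<subseteq> elts A q" "set (drop g c) \<subseteq> elts A q"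
    using c(2) set_take_subset[of g c] set_drop_subset[of g c] by auto
  have ec: "set (e @ c) \<subseteq> elts A q" "length (e @ c) = ?N"
    using e c by auto
  have "ev A q \<phi> e c (msubst (g + d) (abstrs g d ms ss) (ren g (g + d) (\<lambda>j. j) t)) =
      ev A q ?\<psi> (e @ c) c (ren g (g + d) (\<lambda>j. j) t)"
    by (rule ev_msubst[OF wf_ren[OF t] _ wf \<phi> e c]) (auto simp: abstrs_def ss(1) intro!: nth_equalityI)
  also have "\<dots> = ev A q ?\<psi> (e @ c) (map (\<lambda>j. c ! j) [0..<g]) t"
    by (rule ev_ren[OF t]) (simp_all add: c)
  also have "map (\<lambda>j. c ! j) [0..<g] = take g c"
    using c by (auto intro!: nth_equalityI)
  also have "ev A q ?\<psi> (e @ c) (take g c) t = ev A q ?\<chi> (map (\<lambda>x. plug A q x (e @ c)) ?xs) (take g c) t"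
  proof (rule ev_closure[OF _ _ _ _ xs t])
    show "?\<chi> \<in> metas A (p + d) ms"
      using denote_in[OF ss(2) \<phi>] by (simp add: in_metas ss(1) add.assoc)
    fix i assume i: "i < length ms"
    let ?m = "ms ! i"
    let ?M = "p + (g + d + ?m)"
    have 1: "lift A ?N ?m ?xs = vbls A ?M 0 p @ vbls A ?M (p + g) ?M"
      unfolding lift_def map_append by (simp add: map_wk_vbls add.assoc vbls_append)
    have "?\<psi> ! i = ev A ?M \<phi> (vbls A ?M 0 p) (vbls A ?M p ?M)
        (ren (d + ?m) (g + d + ?m) (\<lambda>j. g + j) (ss ! i))"
      using i by (simp add: abstrs_def ss(1) denote_def)
    also have "\<dots> = ev A ?M \<phi> (vbls A ?M 0 p) (map (\<lambda>j. vbls A ?M p ?M ! (g + j)) [0..<d + ?m]) (ss ! i)"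
      by (rule ev_ren[OF ss(2)[OF i]]) simp_all
    also have "map (\<lambda>j. vbls A ?M p ?M ! (g + j)) [0..<d + ?m] = vbls A ?M (p + g) ?M"
      by (rule nth_equalityI) (simp_all add: add.assoc)
    also have "ev A ?M \<phi> (vbls A ?M 0 p) (vbls A ?M (p + g) ?M) (ss ! i) =
       plug A ?M (denote A p \<phi> (d + ?m) (ss ! i)) (vbls A ?M 0 p @ vbls A ?M (p + g) ?M)"
      by (rule ev_conv_denote[OF ss(2)[OF i] \<phi>]) (simp_all add: vbls_in)
    finally show "?\<psi> ! i = plug A (?N + ?m) (?\<chi> ! i) (lift A ?N ?m ?xs)"
      using i by (simp add: 1 ss(1) add.assoc)
  qed (use ec c' in \<open>simp_all add: c abstrs_def ss(1)\<close>)
  also have "map (\<lambda>x. plug A q x (e @ c)) ?xs = e @ drop g c"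
    using ec e c unfolding map_append
    by (subst (1 2) map_plug_vbls) (auto intro!: nth_equalityI simp: nth_append)
  finally show ?thesis .
qed

end

section \<open>Soundness of second-order equational logic in clones\<close>

lemma wf_abstrs:
  assumes "wf_trm S ms g t" "length ss = length ms"
      "\<And>i. i < length ms \<Longrightarrow> wf_trm S \<Theta> (d + ms ! i) (ss ! i)"
  shows "wf_trm S \<Theta> (g + d) (msubst (g + d) (abstrs g d ms ss) (ren g (g + d) (\<lambda>j. j) t))"
proof (rule wf_msubst)
  show "wf_trm S ms (g + d) (ren g (g + d) (\<lambda>j. j) t)"
    using assms(1) by (rule wf_ren) simp
  show "map fst (abstrs g d ms ss) = ms"
    using assms(2) by (auto simp: abstrs_def intro!: nth_equalityI)
  show "wf_trm S \<Theta> (g + d + m) s" if "(m, s) \<in> set (abstrs g d ms ss)" for m s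
    using that assms by (auto simp: abstrs_def in_set_zip add.assoc intro!: wf_ren)
qed

lemma derivable_wf:
  assumes "is_presentation S E"
  shows "derivable S E \<Theta> n s t \<Longrightarrow> wf_trm S \<Theta> n s \<and> wf_trm S \<Theta> n t"
proof (induction rule: derivable.induct)
  case (axiom \<Theta> n s t)
  then show ?case using assms by (auto simp: is_presentation_def)
next
  case (msubst ms g s t ss ts \<Theta> d)
  then show ?case by (auto intro!: wf_abstrs)
qed auto

definition clone_satisfies :: "('o, 'u) clone_ops \<Rightarrow> 'o equation \<Rightarrow> bool" where
  "clone_satisfies A = (\<lambda>(\<Theta>, n, s, t). \<forall>p. \<forall>\<phi>\<in>metas A p \<Theta>. denote A p \<phi> n s = denote A p \<phi> n t)"

text \<open>The stage has to be arbitrary in the induction: in the metasubstitution rule the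
  \<open>d\<close> variables of \<open>\<Delta>\<close> become parameters, so the hypothesis for
  \<open>s\<close> and \<open>t\<close> is used at stage \<open>p + d\<close>.
  \<open>ev_conv_denote\<close> carries it from denotations to the evaluation at hand.\<close>

lemma (in clone) soundness:
  assumes E: "is_presentation S E" "\<forall>eq\<in>E. clone_satisfies A eq"
  shows "derivable S E \<Theta> n s t \<Longrightarrow> \<phi> \<in> metas A p \<Theta> \<Longrightarrow> denote A p \<phi> n s = denote A p \<phi> n t"
proof (induction arbitrary: p \<phi> rule: derivable.induct)
  case (axiom \<Theta> n s t)
  then show ?case using E(2) by (auto simp: clone_satisfies_def)
next
  case (trans \<Theta> n s t u)
  then show ?case by metis
next
  case (msubst ms g s t ss ts \<Theta> d)
  note wf = derivable_wf[OF E(1)]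
  let ?N = "p + (g + d)"
  let ?e = "vbls A ?N 0 p" and ?c = "vbls A ?N p ?N"
  have ss: "wf_trm S \<Theta> (d + ms ! i) (ss ! i)" "wf_trm S \<Theta> (d + ms ! i) (ts ! i)" if "i < length ms" for i
    using wf[OF msubst.hyps(4)[OF that]] by auto
  have st: "wf_trm S ms g s" "wf_trm S ms g t"
    using wf[OF msubst.hyps(1)] by auto
  have eq: "map2 (\<lambda>m s. denote A p \<phi> (d + m) s) ms ss = map2 (\<lambda>m s. denote A p \<phi> (d + m) s) ms ts"
    using msubst.IH(2)[OF _ msubst.prems] msubst.hyps(2,3) by (auto intro!: nth_equalityI)
  have \<psi>: "map2 (\<lambda>m s. denote A p \<phi> (d + m) s) ms ss \<in> metas A (p + d) ms"
    using msubst.hyps(2) msubst.prems ss by (auto simp: in_metas add.assoc intro!: denote_in[of \<Theta>])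
  have "set (drop g ?c) \<subseteq> elts A ?N" "set (take g ?c) \<subseteq> elts A ?N"
    using vbls_in[of ?N ?N p] set_take_subset[of g ?c] set_drop_subset[of g ?c] by auto
  moreover have "set ?e \<subseteq> elts A ?N" by (simp add: vbls_in)
  ultimately have ec: "set (?e @ drop g ?c) \<subseteq> elts A ?N" "set (take g ?c) \<subseteq> elts A ?N" by auto
  have "ev A ?N (map2 (\<lambda>m s. denote A p \<phi> (d + m) s) ms ss) (?e @ drop g ?c) (take g ?c) s =
     ev A ?N (map2 (\<lambda>m s. denote A p \<phi> (d + m) s) ms ss) (?e @ drop g ?c) (take g ?c) t"
    using ev_conv_denote[OF st(1) \<psi> _ ec(1) _ ec(2)] ev_conv_denote[OF st(2) \<psi> _ ec(1) _ ec(2)]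
      msubst.IH(1)[OF \<psi>] by simp
  then show ?case
    unfolding denote_def[of A p \<phi> "g + d"] using msubst.prems msubst.hyps(2,3) ss st eq
    by (subst (1 2) ev_abstrs[where \<Theta> = \<Theta> and p = p]) (simp_all add: vbls_in)
qed auto

section \<open>The substitution tensor on representatives\<close>

lemma obj_FF [simp]: "obj FF = UNIV" and hom_FF: "hom FF m n = {..<m} \<rightarrow>\<^sub>E {..<n}"
  and idt_FF: "idt FF n = (\<lambda>i\<in>{..<n}. i)" and cmp_FF: "cmp FF l m n g f = compose {..<l} g f"
  by (simp_all add: FF_def)

lemma hom_FF_less: "f \<in> hom FF m n \<Longrightarrow> i < m \<Longrightarrow> f i < n"
  by (auto simp: hom_FF)

lemma restrict_in_hom_FF: "(\<And>i. i < m \<Longrightarrow> f i < n) \<Longrightarrow> (\<lambda>i\<in>{..<m}. f i) \<in> hom FF m n"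
  by (auto simp: hom_FF)

text \<open>The functor laws on elements only, without a collection \<open>U\<close> of sets and
  without extensionality conditions.\<close>

definition is_psh :: "'a psh \<Rightarrow> bool" where
  "is_psh X \<longleftrightarrow>
     (\<forall>m n. \<forall>f\<in>hom FF m n. \<forall>x\<in>fobj X m. fmap X m n f x \<in> fobj X n) \<and>
     (\<forall>n. \<forall>x\<in>fobj X n. fmap X n n (idt FF n) x = x) \<and>
     (\<forall>l m n. \<forall>f\<in>hom FF l m. \<forall>g\<in>hom FF m n. \<forall>x\<in>fobj X l.
        fmap X l n (compose {..<l} g f) x = fmap X m n g (fmap X l m f x))"

lemma is_psh_fmap_in: "is_psh X \<Longrightarrow> f \<in> hom FF m n \<Longrightarrow> x \<in> fobj X m \<Longrightarrow> fmap X m n f x \<in> fobj X n"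
  by (auto simp: is_psh_def)

lemma is_psh_fmap_fmap:
  "is_psh X \<Longrightarrow> f \<in> hom FF l m \<Longrightarrow> g \<in> hom FF m n \<Longrightarrow> x \<in> fobj X l \<Longrightarrow>
   fmap X m n g (fmap X l m f x) = fmap X l n (compose {..<l} g f) x"
  by (auto simp: is_psh_def)

lemma tensor_glue:
  "f \<in> hom FF k l \<Longrightarrow> x \<in> fobj X k \<Longrightarrow> length ys = l \<Longrightarrow> set ys \<subseteq> fobj Y n \<Longrightarrow>
   tensor_class X Y n (fmap X k l f x, ys) = tensor_class X Y n (x, map (\<lambda>i. ys ! f i) [0..<k])"
proof -
  assume "f \<in> hom FF k l" "x \<in> fobj X k" "length ys = l" "set ys \<subseteq> fobj Y n"
  then have e: "equivclp (tensor_step X Y n) (fmap X k l f x, ys) (x, map (\<lambda>i. ys ! f i) [0..<k])"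
    by (intro r_into_equivclp tensor_step.intros)
  then show ?thesis
    unfolding tensor_class_def
    by (intro Collect_cong iffI) (rule equivclp_trans[OF equivclp_sym[OF e]] equivclp_trans[OF e], assumption)+
qed

text \<open>Invariance under a generating step extends to the generated equivalence, so
  \<open>g\<close> is constant on the class, and the class contains \<open>z\<close>. All structure
  maps of the tensor are computed on representatives through this lemma.\<close>

lemma on_tensor_class:
  assumes "\<And>k l f x ys. f \<in> hom FF k l \<Longrightarrow> x \<in> fobj X k \<Longrightarrow> length ys = l \<Longrightarrow> set ys \<subseteq> fobj Y n \<Longrightarrow>
    g (fmap X k l f x, ys) = g (x, map (\<lambda>i. ys ! f i) [0..<k])"
  shows "on_class g (tensor_class X Y n z) = g z"
proof -
  have g: "g w = g w'" if "tensor_step X Y n w w'" for w w'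
    using that
  proof cases
    case (1 f k l x ys)
    show ?thesis unfolding 1(1,2) by (rule assms[OF 1(3-6)])
  qed
  have const: "g w = g z" if "equivclp (tensor_step X Y n) z w" for w
    using that
  proof (induction rule: equivclp_induct)
    case (step y z)
    then show ?case using g[of y z] g[of z y] by argo
  qed simp
  have "z \<in> tensor_class X Y n z"
    by (simp add: tensor_class_def)
  moreover have "y = g z" if "y \<in> g ` tensor_class X Y n z" for y
    using that const unfolding tensor_class_def by blast
  ultimately have "g ` tensor_class X Y n z = {g z}"
    by blast
  then show ?thesis by (simp add: on_class_def)
qed

lemma in_tensor:
  "x \<in> fobj X (length ys) \<Longrightarrow> set ys \<subseteq> fobj Y n \<Longrightarrow> tensor_class X Y n (x, ys) \<in> fobj (tensor X Y) n"
  unfolding tensor_def ftor.simps by (rule imageI) (simp add: tensor_pairs_def)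

lemma tensorE:
  assumes "c \<in> fobj (tensor X Y) n"
  obtains x ys where "c = tensor_class X Y n (x, ys)" "x \<in> fobj X (length ys)" "set ys \<subseteq> fobj Y n"
  using assms by (auto simp: tensor_def tensor_pairs_def)

lemma ball_tensor:
  "(\<forall>c\<in>fobj (tensor X Y) n. P c) \<longleftrightarrow>
   (\<forall>x ys. x \<in> fobj X (length ys) \<longrightarrow> set ys \<subseteq> fobj Y n \<longrightarrow> P (tensor_class X Y n (x, ys)))"
  by (auto simp: tensor_def tensor_pairs_def)

text \<open>Serves the outer tensor of \<open>(A \<bullet> A) \<bullet> A\<close>, where the first
  component is again a class, at the stage \<open>length zs\<close> that the second component
  determines.\<close>

lemma all_tensor:
  "(\<forall>c zs. c \<in> fobj (tensor X Y) (length zs) \<longrightarrow> R zs \<longrightarrow> Q c zs) \<longleftrightarrow>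
   (\<forall>x ys zs. x \<in> fobj X (length ys) \<longrightarrow> set ys \<subseteq> fobj Y (length zs) \<longrightarrow> R zs \<longrightarrow>
      Q (tensor_class X Y (length zs) (x, ys)) zs)"
  by (auto simp: tensor_def tensor_pairs_def)

lemma map_nth_hom_FF:
  "f \<in> hom FF k l \<Longrightarrow> length ys = l \<Longrightarrow>
   map h (map (\<lambda>i. ys ! f i) [0..<k]) = map (\<lambda>i. map h ys ! f i) [0..<k]"
  by (auto dest: hom_FF_less)

lemma fmap_tensor:
  assumes Y: "is_psh Y" and f: "f \<in> hom FF n p" and x: "x \<in> fobj X (length ys)" "set ys \<subseteq> fobj Y n"
  shows "fmap (tensor X Y) n p f (tensor_class X Y n (x, ys)) =
    tensor_class X Y p (x, map (fmap Y n p f) ys)"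
proof -
  have "on_class (\<lambda>(x, ys). tensor_class X Y p (x, map (fmap Y n p f) ys)) (tensor_class X Y n (x, ys)) =
      (\<lambda>(x, ys). tensor_class X Y p (x, map (fmap Y n p f) ys)) (x, ys)"
  proof (rule on_tensor_class, unfold prod.case)
    fix k l g x ys
    assume g: "g \<in> hom FF k l" and x: "x \<in> fobj X k" and ys: "length ys = l" "set ys \<subseteq> fobj Y n"
    have "set (map (fmap Y n p f) ys) \<subseteq> fobj Y p"
      using ys is_psh_fmap_in[OF Y f] by auto
    then show "tensor_class X Y p (fmap X k l g x, map (fmap Y n p f) ys) =
        tensor_class X Y p (x, map (fmap Y n p f) (map (\<lambda>i. ys ! g i) [0..<k]))"
      unfolding map_nth_hom_FF[OF g ys(1)] using x ys g by (intro tensor_glue) auto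
  qed
  then show ?thesis
    using f in_tensor[of x X ys Y n] x by (simp add: tensor_def)
qed

lemma tensor_map_class:
  assumes \<tau>: "\<tau> \<in> psh_hom X X'" and \<sigma>: "\<sigma> n \<in> fobj Y n \<rightarrow> fobj Y' n"
    and x: "x \<in> fobj X (length ys)" "set ys \<subseteq> fobj Y n"
  shows "tensor_map X Y X' Y' \<tau> \<sigma> n (tensor_class X Y n (x, ys)) =
    tensor_class X' Y' n (\<tau> (length ys) x, map (\<sigma> n) ys)"
proof -
  have "on_class (\<lambda>(x, ys). tensor_class X' Y' n (\<tau> (length ys) x, map (\<sigma> n) ys)) (tensor_class X Y n (x, ys)) =
      (\<lambda>(x, ys). tensor_class X' Y' n (\<tau> (length ys) x, map (\<sigma> n) ys)) (x, ys)"
  proof (rule on_tensor_class, unfold prod.case)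
    fix k l g x ys
    assume g: "g \<in> hom FF k l" and x: "x \<in> fobj X k" and ys: "length ys = l" "set ys \<subseteq> fobj Y n"
    have "set (map (\<sigma> n) ys) \<subseteq> fobj Y' n"
      using ys \<sigma> by auto
    moreover have "\<tau> l (fmap X k l g x) = fmap X' k l g (\<tau> k x)" "\<tau> k x \<in> fobj X' k"
      using \<tau> g x by (auto simp: psh_hom_def)
    ultimately show "tensor_class X' Y' n (\<tau> (length ys) (fmap X k l g x), map (\<sigma> n) ys) =
        tensor_class X' Y' n (\<tau> (length (map (\<lambda>i. ys ! g i) [0..<k])) x, map (\<sigma> n) (map (\<lambda>i. ys ! g i) [0..<k]))"
      unfolding map_nth_hom_FF[OF g ys(1)] using ys g by (simp add: tensor_glue)
  qed
  then show ?thesis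
    using in_tensor[of x X ys Y n] x by (simp add: tensor_map_def)
qed

lemma left_unitor_class:
  assumes "f \<in> hom FF 1 (length xs)" "set xs \<subseteq> fobj X n"
  shows "left_unitor X n (tensor_class (yoneda 1) X n (f, xs)) = xs ! f 0"
proof -
  have "on_class (\<lambda>(f, xs). xs ! f 0) (tensor_class (yoneda 1) X n (f, xs)) = (\<lambda>(f, xs). xs ! f 0) (f, xs)"
    by (rule on_tensor_class) (auto simp: yoneda_def cmp_FF compose_def dest: hom_FF_less)
  then show ?thesis
    using in_tensor[of f "yoneda 1" xs X n] assms by (simp add: left_unitor_def yoneda_def)
qed

lemma right_unitor_class:
  assumes X: "is_psh X" and x: "x \<in> fobj X (length fs)" and fs: "set fs \<subseteq> hom FF 1 n"
  shows "right_unitor X n (tensor_class X (yoneda 1) n (x, fs)) =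
    fmap X (length fs) n (\<lambda>i\<in>{..<length fs}. (fs ! i) 0) x"
proof -
  have "on_class (\<lambda>(x, fs). fmap X (length fs) n (\<lambda>i\<in>{..<length fs}. (fs ! i) 0) x)
      (tensor_class X (yoneda 1) n (x, fs)) =
    (\<lambda>(x, fs). fmap X (length fs) n (\<lambda>i\<in>{..<length fs}. (fs ! i) 0) x) (x, fs)"
  proof (rule on_tensor_class, unfold prod.case)
    fix k l g x and fs :: "(nat \<Rightarrow> nat) list"
    assume g: "g \<in> hom FF k l" and x: "x \<in> fobj X k" and fs: "length fs = l" "set fs \<subseteq> fobj (yoneda 1) n"
    have fs': "(fs ! i) 0 < n" if "i < l" for i
      using fs nth_mem[of i fs] that by (intro hom_FF_less[of "fs ! i" 1]) (auto simp: yoneda_def)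
    have "compose {..<k} (\<lambda>i\<in>{..<l}. (fs ! i) 0) g = (\<lambda>i\<in>{..<k}. (map (\<lambda>i. fs ! g i) [0..<k] ! i) 0)"
      using hom_FF_less[OF g] by (auto simp: compose_def restrict_def)
    then show "fmap X (length fs) n (\<lambda>i\<in>{..<length fs}. (fs ! i) 0) (fmap X k l g x) =
        fmap X (length (map (\<lambda>i. fs ! g i) [0..<k])) n
          (\<lambda>i\<in>{..<length (map (\<lambda>i. fs ! g i) [0..<k])}. (map (\<lambda>i. fs ! g i) [0..<k] ! i) 0) x"
      using is_psh_fmap_fmap[OF X g restrict_in_hom_FF[of l "\<lambda>i. (fs ! i) 0" n] x] fs' fs(1) by simp
  qed
  then show ?thesis
    using in_tensor[of x X fs "yoneda 1" n] x fs by (simp add: right_unitor_def yoneda_def)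
qed

text \<open>Two nested quotients. Invariance in the inner one is gluing in
  \<open>X \<bullet> (Y \<bullet> Z)\<close>. In the outer one a map \<open>g\<close> renames the
  entries of \<open>ys\<close>, and gluing in \<open>Y \<bullet> Z\<close> moves \<open>g\<close>
  over to \<open>zs\<close>.\<close>

lemma associator_class:
  assumes Y: "is_psh Y" and x: "x \<in> fobj X (length ys)" and ys: "set ys \<subseteq> fobj Y (length zs)"
    and zs: "set zs \<subseteq> fobj Z n"
  shows "associator X Y Z n (tensor_class (tensor X Y) Z n (tensor_class X Y (length zs) (x, ys), zs)) =
    tensor_class X (tensor Y Z) n (x, map (\<lambda>y. tensor_class Y Z n (y, zs)) ys)"
proof -
  let ?g = "\<lambda>zs (x, ys). tensor_class X (tensor Y Z) n (x, map (\<lambda>y. tensor_class Y Z n (y, zs)) ys)"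
  have inner: "on_class (?g zs) (tensor_class X Y (length zs) z) = ?g zs z"
    if zs: "set zs \<subseteq> fobj Z n" for zs z
  proof (rule on_tensor_class, unfold prod.case)
    fix k l g x ys
    assume g: "g \<in> hom FF k l" and x: "x \<in> fobj X k" and ys: "length ys = l" "set ys \<subseteq> fobj Y (length zs)"
    have "set (map (\<lambda>y. tensor_class Y Z n (y, zs)) ys) \<subseteq> fobj (tensor Y Z) n"
      using ys zs by (auto intro: in_tensor)
    then show "tensor_class X (tensor Y Z) n (fmap X k l g x, map (\<lambda>y. tensor_class Y Z n (y, zs)) ys) =
        tensor_class X (tensor Y Z) n (x, map (\<lambda>y. tensor_class Y Z n (y, zs)) (map (\<lambda>i. ys ! g i) [0..<k]))"
      unfolding map_nth_hom_FF[OF g ys(1)] using ys g x by (intro tensor_glue) auto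
  qed
  have "on_class (\<lambda>(d, zs). on_class (?g zs) d)
      (tensor_class (tensor X Y) Z n (tensor_class X Y (length zs) (x, ys), zs)) =
    (\<lambda>(d, zs). on_class (?g zs) d) (tensor_class X Y (length zs) (x, ys), zs)"
  proof (rule on_tensor_class, unfold prod.case)
    fix k l g d zs
    assume g: "g \<in> hom FF k l" and d: "d \<in> fobj (tensor X Y) k" and zs: "length zs = l" "set zs \<subseteq> fobj Z n"
    from d obtain x ys where d: "d = tensor_class X Y k (x, ys)" and x: "x \<in> fobj X (length ys)"
      and ys: "set ys \<subseteq> fobj Y k" by (rule tensorE)
    let ?zs = "map (\<lambda>i. zs ! g i) [0..<k]"
    have zs': "set ?zs \<subseteq> fobj Z n"
      using zs hom_FF_less[OF g] nth_mem[of _ zs] by auto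
    have "on_class (?g zs) (fmap (tensor X Y) k l g d) = ?g zs (x, map (fmap Y k l g) ys)"
      using inner[OF zs(2), of "(x, map (fmap Y k l g) ys)"] zs(1) by (simp add: d fmap_tensor[OF Y g x ys])
    also have "\<dots> = ?g ?zs (x, ys)"
    proof -
      have "tensor_class Y Z n (fmap Y k l g y, zs) = tensor_class Y Z n (y, ?zs)" if "y \<in> set ys" for y
        using that ys g zs by (intro tensor_glue) auto
      then have "map (\<lambda>y. tensor_class Y Z n (y, zs)) (map (fmap Y k l g) ys) =
          map (\<lambda>y. tensor_class Y Z n (y, ?zs)) ys"
        by simp
      then show ?thesis by (simp only: prod.case)
    qed
    also have "\<dots> = on_class (?g ?zs) d"
      using inner[OF zs', of "(x, ys)"] by (simp add: d)
    finally show "on_class (?g zs) (fmap (tensor X Y) k l g d) = on_class (?g ?zs) d" .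
  qed
  also have "\<dots> = ?g zs (x, ys)"
    using inner[OF zs] by simp
  finally show ?thesis
    using in_tensor[of "tensor_class X Y (length zs) (x, ys)" "tensor X Y" zs Z n]
      in_tensor[of x X ys Y "length zs"] x ys zs by (simp add: associator_def)
qed

text \<open>The conjuncts are the left unit, right unit and associativity laws on representatives.
  Naturality of \<open>\<nu>\<close> and \<open>\<mu>\<close> is a hypothesis because
  \<open>tensor_map_class\<close> computes only with a natural first map.\<close>

lemma is_substitution_monoid_iff:
  assumes A: "is_psh A" and \<nu>: "\<nu> \<in> psh_hom (yoneda 1) A" and \<mu>: "\<mu> \<in> psh_hom (tensor A A) A"
  shows "is_substitution_monoid A \<nu> \<mu> \<longleftrightarrow>
    (\<forall>n f xs. f \<in> hom FF 1 (length xs) \<longrightarrow> set xs \<subseteq> fobj A n \<longrightarrow>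
       \<mu> n (tensor_class A A n (\<nu> (length xs) f, xs)) = xs ! f 0) \<and>
    (\<forall>n x fs. x \<in> fobj A (length fs) \<longrightarrow> set fs \<subseteq> hom FF 1 n \<longrightarrow>
       \<mu> n (tensor_class A A n (x, map (\<nu> n) fs)) =
       fmap A (length fs) n (\<lambda>i\<in>{..<length fs}. (fs ! i) 0) x) \<and>
    (\<forall>n x ys zs. x \<in> fobj A (length ys) \<longrightarrow> set ys \<subseteq> fobj A (length zs) \<longrightarrow> set zs \<subseteq> fobj A n \<longrightarrow>
       \<mu> n (tensor_class A A n (\<mu> (length zs) (tensor_class A A (length zs) (x, ys)), zs)) =
       \<mu> n (tensor_class A A n (x, map (\<lambda>y. \<mu> n (tensor_class A A n (y, zs))) ys)))"
proof -
  have y1: "fobj (yoneda 1) = hom FF 1" by (simp add: yoneda_def)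
  have id: "psh_id A n \<in> fobj A n \<rightarrow> fobj A n" "psh_id A \<in> psh_hom A A" for n
    using is_psh_fmap_in[OF A] by (auto simp: psh_id_def psh_hom_def)
  have \<nu>': "\<nu> n \<in> hom FF 1 n \<rightarrow> fobj A n" for n
    using \<nu> unfolding psh_hom_def y1 by blast
  have map_id: "map (psh_id A n) xs = xs" if "set xs \<subseteq> fobj A n" for n xs
    using that by (auto simp: psh_id_def intro!: map_idI)
  have \<mu>_in: "\<mu> n (tensor_class A A n (x, ys)) \<in> fobj A n"
    if "x \<in> fobj A (length ys)" "set ys \<subseteq> fobj A n" for n x ys
    using \<mu> in_tensor[OF that] by (auto simp: psh_hom_def)
  have left: "\<mu> n (tensor_map (yoneda 1) A A A \<nu> (psh_id A) n (tensor_class (yoneda 1) A n (f, xs))) =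
      \<mu> n (tensor_class A A n (\<nu> (length xs) f, xs))"
    if "f \<in> hom FF 1 (length xs)" "set xs \<subseteq> fobj A n" for f xs n
    using tensor_map_class[OF \<nu>, where \<sigma> = "psh_id A" and n = n and Y = A and Y' = A and x = f and ys = xs] id that
    by (simp add: y1 map_id del: One_nat_def)
  have right: "\<mu> n (tensor_map A (yoneda 1) A A (psh_id A) \<nu> n (tensor_class A (yoneda 1) n (x, fs))) =
       \<mu> n (tensor_class A A n (x, map (\<nu> n) fs))"
    if "x \<in> fobj A (length fs)" "set fs \<subseteq> hom FF 1 n" for x fs n
    using tensor_map_class[OF id(2), where \<sigma> = \<nu> and n = n and Y = "yoneda 1" and Y' = A and x = x and ys = fs] that \<nu>'
    by (simp add: y1 psh_id_def del: One_nat_def)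
  have assoc: "\<mu> n (tensor_map (tensor A A) A A A \<mu> (psh_id A) n
        (tensor_class (tensor A A) A n (tensor_class A A (length zs) (x, ys), zs))) =
      \<mu> n (tensor_class A A n (\<mu> (length zs) (tensor_class A A (length zs) (x, ys)), zs))"
    "\<mu> n (tensor_map A (tensor A A) A A (psh_id A) \<mu> n
        (associator A A A n (tensor_class (tensor A A) A n (tensor_class A A (length zs) (x, ys), zs)))) =
      \<mu> n (tensor_class A A n (x, map (\<lambda>y. \<mu> n (tensor_class A A n (y, zs))) ys))"
    if "x \<in> fobj A (length ys)" "set ys \<subseteq> fobj A (length zs)" "set zs \<subseteq> fobj A n" for x ys zs n
  proof -
    show "\<mu> n (tensor_map (tensor A A) A A A \<mu> (psh_id A) n
        (tensor_class (tensor A A) A n (tensor_class A A (length zs) (x, ys), zs))) =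
      \<mu> n (tensor_class A A n (\<mu> (length zs) (tensor_class A A (length zs) (x, ys)), zs))"
      using tensor_map_class[OF \<mu>, where \<sigma> = "psh_id A" and n = n and Y = A and Y' = A
          and x = "tensor_class A A (length zs) (x, ys)" and ys = zs] id that
      by (simp add: in_tensor map_id)
    have "set (map (\<lambda>y. tensor_class A A n (y, zs)) ys) \<subseteq> fobj (tensor A A) n"
      using that by (auto intro: in_tensor)
    moreover have "\<mu> n \<in> fobj (tensor A A) n \<rightarrow> fobj A n"
      using \<mu> by (auto simp: psh_hom_def)
    ultimately show "\<mu> n (tensor_map A (tensor A A) A A (psh_id A) \<mu> n
        (associator A A A n (tensor_class (tensor A A) A n (tensor_class A A (length zs) (x, ys), zs)))) =
      \<mu> n (tensor_class A A n (x, map (\<lambda>y. \<mu> n (tensor_class A A n (y, zs))) ys))"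
      using tensor_map_class[OF id(2), where \<sigma> = \<mu> and n = n and Y = "tensor A A" and Y' = A and x = x
          and ys = "map (\<lambda>y. tensor_class A A n (y, zs)) ys"] that
      by (simp add: associator_class[OF A that] psh_id_def comp_def)
  qed
  show ?thesis
    unfolding is_substitution_monoid_def ball_tensor all_tensor y1 using \<nu> \<mu>
    by (simp add: left right assoc left_unitor_class right_unitor_class[OF A] del: One_nat_def cong: imp_cong)
qed

section \<open>Models are clones\<close>

lemma functor_fobj: "is_functor C D F \<Longrightarrow> a \<in> obj C \<Longrightarrow> fobj F a \<in> obj D"
  by (auto simp: is_functor_def)

lemma functor_fmap:
  assumes "is_functor C D F" "a \<in> obj C" "b \<in> obj C"
  shows "fmap F a b \<in> hom C a b \<rightarrow>\<^sub>E hom D (fobj F a) (fobj F b)"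
proof -
  have "fmap F \<in> (\<Pi>\<^sub>E a\<in>obj C. \<Pi>\<^sub>E b\<in>obj C. hom C a b \<rightarrow>\<^sub>E hom D (fobj F a) (fobj F b))"
    using assms(1) by (simp add: is_functor_def)
  from PiE_mem[OF PiE_mem[OF this assms(2)] assms(3)] show ?thesis .
qed

lemma functor_idt: "is_functor C D F \<Longrightarrow> a \<in> obj C \<Longrightarrow> fmap F a a (idt C a) = idt D (fobj F a)"
  by (simp add: is_functor_def)

lemma functor_cmp:
  "is_functor C D F \<Longrightarrow> a \<in> obj C \<Longrightarrow> b \<in> obj C \<Longrightarrow> c \<in> obj C \<Longrightarrow> f \<in> hom C a b \<Longrightarrow> g \<in> hom C b c \<Longrightarrow>
   fmap F a c (cmp C a b c g f) = cmp D (fobj F a) (fobj F b) (fobj F c) (fmap F b c g) (fmap F a b f)"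
  by (simp add: is_functor_def)

lemma Set_cat_sel [simp]:
  "obj (Set_cat U) = U" "hom (Set_cat U) X Y = X \<rightarrow>\<^sub>E Y" "idt (Set_cat U) X = (\<lambda>x\<in>X. x)"
  "cmp (Set_cat U) X Y Z g f = compose X g f"
  by (simp_all add: Set_cat_def)

lemma psh_hom_nat:
  "\<tau> \<in> psh_hom X Y \<Longrightarrow> f \<in> hom FF m n \<Longrightarrow> x \<in> fobj X m \<Longrightarrow> \<tau> n (fmap X m n f x) = fmap Y m n f (\<tau> m x)"
  by (simp add: psh_hom_def)

lemma is_psh_functor:
  assumes X: "is_functor FF (Set_cat U) X"
  shows "is_psh X"
proof -
  have "fmap X m n f x \<in> fobj X n" if "f \<in> hom FF m n" "x \<in> fobj X m" for m n f x
    using functor_fmap[OF X, of m n] that by (auto dest!: PiE_mem)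
  moreover have "fmap X n n (idt FF n) x = x" if "x \<in> fobj X n" for n x
    using functor_idt[OF X, of n] that by simp
  moreover have "fmap X l n (compose {..<l} g f) x = fmap X m n g (fmap X l m f x)"
    if "f \<in> hom FF l m" "g \<in> hom FF m n" "x \<in> fobj X l" for l m n f g x
    using functor_cmp[OF X, of l m n f g] that by (simp add: cmp_FF compose_eq)
  ultimately show ?thesis
    unfolding is_psh_def by blast
qed

definition clone_of :: "('o, 'u) model \<Rightarrow> ('o, 'u) clone_ops" where
  "clone_of A = \<lparr>elts = fobj (carr A), vbl = mvar A, plug = msub A, opr = oper A\<rparr>"

lemma clone_of_sel [simp]:
  "elts (clone_of A) = fobj (carr A)" "vbl (clone_of A) = mvar A"
  "plug (clone_of A) = msub A" "opr (clone_of A) = oper A"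
  by (simp_all add: clone_of_def)

lemma fobj_arg_psh: "fobj (arg_psh S A f) p = metas (clone_of A) p (arity S f)"
  by (simp add: arg_psh_def psh_prod_def psh_shift_def metas_def comp_def)

locale model =
  fixes S :: "'o signature" and U :: "'u set set" and A :: "('o, 'u) model"
  assumes is_model: "is_model S U A"
begin

lemma is_psh: "is_psh (carr A)"
  using is_model by (auto simp: is_model_def intro: is_psh_functor)

lemma munit: "munit A \<in> psh_hom (yoneda 1) (carr A)"
  and mmult: "mmult A \<in> psh_hom (tensor (carr A) (carr A)) (carr A)"
  using is_model by (auto simp: is_model_def is_substitution_monoid_def)

text \<open>Yoneda: \<open>f\<close> is the image under \<open>f\<close> of the identity of 1, so
  naturality fixes the value of \<open>munit\<close> at \<open>f\<close>.\<close>

lemma munit_conv_mvar: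
  assumes f: "f \<in> hom FF 1 q"
  shows "munit A q f = mvar A q (f 0)"
proof -
  have f': "(\<lambda>i\<in>{..<1}. f 0) = f"
    using f by (auto simp: hom_FF PiE_def extensional_def fun_eq_iff)
  have id: "idt FF 1 \<in> fobj (yoneda 1) 1"
    by (auto simp: yoneda_def hom_FF idt_FF)
  have "cmp FF 1 1 q f (idt FF 1) = f"
    using f by (auto simp: cmp_FF idt_FF compose_def hom_FF PiE_def extensional_def fun_eq_iff)
  then have "fmap (yoneda 1) 1 q f (idt FF 1) = f"
    using f id by (simp add: yoneda_def del: One_nat_def)
  then have "munit A q f = fmap (carr A) 1 q f (munit A 1 (idt FF 1))"
    using psh_hom_nat[OF munit f id] by simp
  then show ?thesis
    unfolding mvar_def f' .
qed

lemma mvar_in: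
  assumes "j < q"
  shows "mvar A q j \<in> fobj (carr A) q"
proof -
  have f: "(\<lambda>i\<in>{..<1}. j) \<in> hom FF 1 q"
    using assms by (auto simp: hom_FF)
  then have "munit A q (\<lambda>i\<in>{..<1}. j) \<in> fobj (carr A) q"
    using munit by (auto simp: psh_hom_def yoneda_def)
  then show ?thesis
    using munit_conv_mvar[OF f] by simp
qed

lemma msub_in: "x \<in> fobj (carr A) (length ys) \<Longrightarrow> set ys \<subseteq> fobj (carr A) q \<Longrightarrow> msub A q x ys \<in> fobj (carr A) q"
  using mmult in_tensor[of x "carr A" ys "carr A" q] by (auto simp: psh_hom_def msub_def)

lemma msub_munit:
    "f \<in> hom FF 1 (length ys) \<Longrightarrow> set ys \<subseteq> fobj (carr A) q \<Longrightarrow> msub A q (munit A (length ys) f) ys = ys ! f 0"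
  and msub_map_munit:
    "x \<in> fobj (carr A) (length fs) \<Longrightarrow> set fs \<subseteq> hom FF 1 q \<Longrightarrow>
     msub A q x (map (munit A q) fs) = fmap (carr A) (length fs) q (\<lambda>i\<in>{..<length fs}. (fs ! i) 0) x"
  and msub_msub:
    "x \<in> fobj (carr A) (length ys) \<Longrightarrow> set ys \<subseteq> fobj (carr A) (length zs) \<Longrightarrow> set zs \<subseteq> fobj (carr A) q \<Longrightarrow>
     msub A q (msub A (length zs) x ys) zs = msub A q x (map (\<lambda>y. msub A q y zs) ys)"
proof -
  have "is_substitution_monoid (carr A) (munit A) (mmult A)"
    using is_model by (simp add: is_model_def)
  note * = this[unfolded is_substitution_monoid_iff[OF is_psh munit mmult], folded msub_def]
  show "f \<in> hom FF 1 (length ys) \<Longrightarrow> set ys \<subseteq> fobj (carr A) q \<Longrightarrow> msub A q (munit A (length ys) f) ys = ys ! f 0"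
    using * by blast
  show "x \<in> fobj (carr A) (length fs) \<Longrightarrow> set fs \<subseteq> hom FF 1 q \<Longrightarrow>
     msub A q x (map (munit A q) fs) = fmap (carr A) (length fs) q (\<lambda>i\<in>{..<length fs}. (fs ! i) 0) x"
    using * by blast
  show "x \<in> fobj (carr A) (length ys) \<Longrightarrow> set ys \<subseteq> fobj (carr A) (length zs) \<Longrightarrow> set zs \<subseteq> fobj (carr A) q \<Longrightarrow>
     msub A q (msub A (length zs) x ys) zs = msub A q x (map (\<lambda>y. msub A q y zs) ys)"
    using * by blast
qed

lemma msub_mvar:
  assumes "j < length ys" "set ys \<subseteq> fobj (carr A) q"
  shows "msub A q (mvar A (length ys) j) ys = ys ! j"
proof -
  have f: "(\<lambda>i\<in>{..<1}. j) \<in> hom FF 1 (length ys)"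
    using assms by (auto simp: hom_FF)
  then show ?thesis
    using msub_munit[OF f assms(2)] munit_conv_mvar[OF f] by simp
qed

text \<open>The right unit law, with \<open>fs\<close> the list of the points
  \<open>1 \<rightarrow> n\<close> that make up \<open>f\<close>.\<close>

lemma fmap_conv_msub:
  assumes x: "x \<in> fobj (carr A) m" and f: "f \<in> hom FF m n"
  shows "fmap (carr A) m n f x = msub A n x (map (\<lambda>i. mvar A n (f i)) [0..<m])"
proof -
  let ?fs = "map (\<lambda>i. \<lambda>_\<in>{..<1::nat}. f i) [0..<m]"
  have fs: "set ?fs \<subseteq> hom FF 1 n"
    using hom_FF_less[OF f] by (auto intro: restrict_in_hom_FF)
  then have "map (munit A n) ?fs = map (\<lambda>i. mvar A n (f i)) [0..<m]"
    by (auto simp: munit_conv_mvar)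
  moreover have "(\<lambda>i\<in>{..<length ?fs}. (?fs ! i) 0) = f"
    using f by (auto simp: hom_FF PiE_def extensional_def fun_eq_iff)
  moreover have "x \<in> fobj (carr A) (length ?fs)"
    using x by simp
  ultimately show ?thesis
    using msub_map_munit[of x ?fs n, OF _ fs] by (simp only: length_map length_upt diff_zero)
qed

lemma wk_clone_of:
  "x \<in> fobj (carr A) p \<Longrightarrow> wk (clone_of A) p k x = fmap (carr A) p (p + k) (\<lambda>j\<in>{..<p}. j) x"
  by (subst fmap_conv_msub) (auto simp: wk_def vbls_def hom_FF intro!: arg_cong[of _ _ "msub A (p + k) x"])

lemma lift_clone_of:
  "set xs \<subseteq> fobj (carr A) p \<Longrightarrow>
   lift (clone_of A) p k xs =
     map (fmap (carr A) p (p + k) (\<lambda>j\<in>{..<p}. j)) xs @ map (mvar A (p + k)) [p..<p + k]"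
  by (auto simp: lift_def wk_clone_of vbls_def)

lemma clone_clone_of: "clone S (clone_of A)"
proof
  fix j q :: nat assume "j < q"
  then show "vbl (clone_of A) q j \<in> elts (clone_of A) q" by (simp add: mvar_in)
next
  fix f xs p
  assume "f \<in> operators S" "xs \<in> metas (clone_of A) p (arity S f)"
  then show "opr (clone_of A) f p xs \<in> elts (clone_of A) p"
    using is_model by (auto simp: is_model_def psh_hom_def fobj_arg_psh)
next
  fix q x assume x: "x \<in> elts (clone_of A) q"
  have "idt FF q \<in> hom FF q q"
    by (auto simp: hom_FF idt_FF)
  then have "fmap (carr A) q q (idt FF q) x = msub A q x (map (\<lambda>i. mvar A q (idt FF q i)) [0..<q])"
    using fmap_conv_msub x by simp
  also have "map (\<lambda>i. mvar A q (idt FF q i)) [0..<q] = vbls (clone_of A) q 0 q"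
    by (simp add: vbls_def idt_FF)
  finally show "plug (clone_of A) q x (vbls (clone_of A) q 0 q) = x"
    using is_psh x by (simp add: is_psh_def)
next
  fix x ys zs r
  assume "x \<in> elts (clone_of A) (length ys)" "set ys \<subseteq> elts (clone_of A) (length zs)"
    "set zs \<subseteq> elts (clone_of A) r"
  then show "plug (clone_of A) r (plug (clone_of A) (length zs) x ys) zs =
      plug (clone_of A) r x (map (\<lambda>y. plug (clone_of A) r y zs) ys)"
    by (simp add: msub_msub)
next
  fix f xs ys p
  assume "f \<in> operators S" "xs \<in> metas (clone_of A) (length ys) (arity S f)" "set ys \<subseteq> elts (clone_of A) p"
  then show "plug (clone_of A) p (opr (clone_of A) f (length ys) xs) ys =
       opr (clone_of A) f p
         (map2 (\<lambda>k x. plug (clone_of A) (p + k) x (lift (clone_of A) p k ys)) (arity S f) xs)"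
    using is_model by (simp add: is_model_def compatible_def fobj_arg_psh lift_clone_of)
qed (simp_all add: msub_in msub_mvar)

sublocale clone S "clone_of A"
  by (rule clone_clone_of)

text \<open>In the metavariable case \<open>interp\<close> first weakens \<open>\<xi> ! i\<close>
  past the \<open>n\<close> context variables and then substitutes all \<open>p + n\<close>
  variables together with the arguments, while \<open>denote\<close> substitutes only the
  \<open>p\<close> parameters and the arguments. By \<open>plug_plug\<close> the detour through the
  context variables cancels.\<close>

lemma interp_conv_denote:
  assumes \<xi>: "\<xi> \<in> metas (clone_of A) p \<Theta>"
  shows "wf_trm S \<Theta> n t \<Longrightarrow> interp A p \<xi> n t = denote (clone_of A) p \<xi> n t"
proof (induction rule: wf_trm.induct)
  case (wf_Var j n)
  then show ?case by (simp add: denote_def)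
next
  case (wf_MVar i ts n)
  let ?k = "length ts" and ?N = "p + n"
  let ?ts = "map (denote (clone_of A) p \<xi> n) ts"
  have ts: "set ?ts \<subseteq> fobj (carr A) ?N"
    using denote_in[OF wf_MVar.hyps(3) \<xi>] by auto
  have i: "\<Theta> ! i = ?k" using wf_MVar.hyps(2) by simp
  have \<xi>i: "\<xi> ! i \<in> fobj (carr A) (p + ?k)"
    using \<xi> wf_MVar.hyps(1) by (auto simp: in_metas simp flip: i)
  have "(\<lambda>j\<in>{..<p + ?k}. ext p ?N (\<lambda>j. j) j) \<in> hom FF (p + ?k) (?N + ?k)"
    by (rule restrict_in_hom_FF) (auto simp: ext_def)
  then have "fmap (carr A) (p + ?k) (?N + ?k) (\<lambda>j\<in>{..<p + ?k}. ext p ?N (\<lambda>j. j) j) (\<xi> ! i) =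
      msub A (?N + ?k) (\<xi> ! i) (map (\<lambda>j. mvar A (?N + ?k) ((\<lambda>j\<in>{..<p + ?k}. ext p ?N (\<lambda>j. j) j) j)) [0..<p + ?k])"
    by (rule fmap_conv_msub[OF \<xi>i])
  also have "map (\<lambda>j. mvar A (?N + ?k) ((\<lambda>j\<in>{..<p + ?k}. ext p ?N (\<lambda>j. j) j) j)) [0..<p + ?k] =
      vbls (clone_of A) (?N + ?k) 0 p @ vbls (clone_of A) (?N + ?k) ?N (?N + ?k)" (is "_ = ?vs")
    by (rule nth_equalityI) (auto simp: ext_def nth_append)
  finally have *: "fmap (carr A) (p + ?k) (?N + ?k) (\<lambda>j\<in>{..<p + ?k}. ext p ?N (\<lambda>j. j) j) (\<xi> ! i) =
      msub A (?N + ?k) (\<xi> ! i) ?vs" .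
  have vs: "set ?vs \<subseteq> fobj (carr A) (?N + ?k)"
    using vbls_in[of p "?N + ?k" 0] vbls_in[of "?N + ?k" "?N + ?k" ?N] by simp
  have ds: "set (vbls (clone_of A) ?N 0 ?N @ ?ts) \<subseteq> fobj (carr A) ?N"
    using vbls_in[of ?N ?N 0] ts by auto
  have "map (\<lambda>y. msub A ?N y (vbls (clone_of A) ?N 0 ?N @ ?ts)) ?vs = vbls (clone_of A) ?N 0 p @ ?ts"
    using ds map_plug_vbls[of "vbls (clone_of A) ?N 0 ?N @ ?ts" "?N + ?k" ?N]
    by (auto simp: nth_append intro!: nth_equalityI)
  then have "msub A ?N (msub A (?N + ?k) (\<xi> ! i) ?vs) (vbls (clone_of A) ?N 0 ?N @ ?ts) =
      msub A ?N (\<xi> ! i) (vbls (clone_of A) ?N 0 p @ ?ts)"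
    using plug_plug[of "\<xi> ! i" ?vs "vbls (clone_of A) ?N 0 ?N @ ?ts" ?N] \<xi>i vs ds by simp
  moreover have IH: "map (interp A p \<xi> n) ts = ?ts"
    using wf_MVar.IH by simp
  ultimately show ?case
    unfolding interp.simps IH * denote_def[of _ _ _ _ "MVar i ts"] ev.simps
    by (simp add: vbls_def denote_def[abs_def])
next
  case (wf_Op f bs n)
  have "interp A p \<xi> (n + k) t = ev (clone_of A) (p + n + k) \<xi> (map (wk (clone_of A) (p + n) k) (vbls (clone_of A) (p + n) 0 p))
      (lift (clone_of A) (p + n) k (vbls (clone_of A) (p + n) p (p + n))) t" if "(k, t) \<in> set bs" for k t
    using wf_Op.IH[OF that]
    by (simp add: denote_def lift_def map_wk_vbls vbls_append add.assoc)
  then show ?case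
    unfolding interp.simps denote_def ev.simps clone_of_sel by (rule arg_cong[OF map_pair_cong])
qed

lemma satisfies_iff:
  assumes "wf_trm S \<Theta> n s" "wf_trm S \<Theta> n t"
  shows "satisfies A (\<Theta>, n, s, t) \<longleftrightarrow> clone_satisfies (clone_of A) (\<Theta>, n, s, t)"
  unfolding satisfies_def clone_satisfies_def prod.case
  using assms interp_conv_denote by (auto simp: metas_def)

end

lemma compose_in_PiE: "f \<in> A \<rightarrow>\<^sub>E B \<Longrightarrow> g \<in> B \<rightarrow>\<^sub>E C \<Longrightarrow> compose A g f \<in> A \<rightarrow>\<^sub>E C"
  by (auto simp: compose_def)

lemma compose_restrict_id: "f \<in> A \<rightarrow>\<^sub>E B \<Longrightarrow> compose A (\<lambda>x\<in>B. x) f = f"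
  and compose_id_restrict: "f \<in> A \<rightarrow>\<^sub>E B \<Longrightarrow> compose A f (\<lambda>x\<in>A. x) = f"
  by (auto simp: compose_def PiE_def extensional_def fun_eq_iff Pi_def)

lemma compose_compose: "f \<in> A \<rightarrow>\<^sub>E B \<Longrightarrow> compose A h (compose A g f) = compose A (compose B h g) f"
  by (auto simp: compose_def fun_eq_iff dest: PiE_mem)

lemma category_Set_cat: "is_category (Set_cat U)"
  unfolding is_category_def Set_cat_sel
  by (simp add: compose_in_PiE compose_restrict_id compose_id_restrict compose_compose)

lemma cmp_in_hom_FF: "f \<in> hom FF l m \<Longrightarrow> g \<in> hom FF m n \<Longrightarrow> cmp FF l m n g f \<in> hom FF l n"
  unfolding hom_FF cmp_FF by (rule compose_in_PiE)

lemma category_FF: "is_category FF"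
  unfolding is_category_def hom_FF cmp_FF idt_FF obj_FF
  by (simp add: compose_in_PiE compose_restrict_id compose_id_restrict compose_compose)

section \<open>From clones back to algebraic models\<close>

definition psh_of :: "('o, 'u) clone_ops \<Rightarrow> 'u psh" where
  "psh_of B = \<lparr>fobj = elts B,
     fmap = (\<lambda>m n. \<lambda>f\<in>hom FF m n. \<lambda>x\<in>elts B m. plug B n x (map (\<lambda>i. vbl B n (f i)) [0..<m]))\<rparr>"

text \<open>The restrictions and the value \<open>undefined\<close> are what \<open>psh_hom\<close>
  and \<open>is_model\<close> demand outside the domains.\<close>

definition model_of :: "'o signature \<Rightarrow> ('o, 'u) clone_ops \<Rightarrow> ('o, 'u) model" where
  "model_of S B = \<lparr>carr = psh_of B,
     oper = (\<lambda>f. if f \<in> operators S then (\<lambda>p. \<lambda>xs\<in>metas B p (arity S f). opr B f p xs) else undefined),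
     munit = (\<lambda>n. \<lambda>f\<in>hom FF 1 n. vbl B n (f 0)),
     mmult = (\<lambda>n. \<lambda>c\<in>fobj (tensor (psh_of B) (psh_of B)) n. on_class (\<lambda>(x, ys). plug B n x ys) c)\<rparr>"

lemma fobj_psh_of [simp]: "fobj (psh_of B) = elts B"
  by (simp add: psh_of_def)

lemma carr_model_of [simp]: "carr (model_of S B) = psh_of B"
  by (simp add: model_of_def)

lemma fmap_psh_of:
  "f \<in> hom FF m n \<Longrightarrow> x \<in> elts B m \<Longrightarrow>
   fmap (psh_of B) m n f x = plug B n x (map (\<lambda>i. vbl B n (f i)) [0..<m])"
  by (simp add: psh_of_def)

context clone
begin

abbreviation Psh :: "'u psh" where
  "Psh \<equiv> psh_of A"

abbreviation Mdl :: "('o, 'u) model" where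
  "Mdl \<equiv> model_of S A"

lemma vbl_map_in: "f \<in> hom FF m n \<Longrightarrow> set (map (\<lambda>i. vbl A n (f i)) [0..<m]) \<subseteq> elts A n"
  by (auto intro!: vbl_in simp: hom_FF_less)

text \<open>The gluing relation of the tensor, for \<open>plug\<close>. It makes
  \<open>mmult\<close> well defined on classes, and with variables for \<open>ys\<close> it is the
  functoriality of \<open>psh_of\<close>.\<close>

lemma plug_rename:
  assumes x: "x \<in> elts A k" and f: "f \<in> hom FF k l" and ys: "length ys = l" "set ys \<subseteq> elts A n"
  shows "plug A n (plug A l x (map (\<lambda>i. vbl A l (f i)) [0..<k])) ys =
    plug A n x (map (\<lambda>i. ys ! f i) [0..<k])"
proof -
  have *: "map (\<lambda>y. plug A n y ys) (map (\<lambda>i. vbl A l (f i)) [0..<k]) = map (\<lambda>i. ys ! f i) [0..<k]"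
    using hom_FF_less[OF f] plug_vbl[of _ ys n] ys by auto
  show ?thesis
    using plug_plug[of x "map (\<lambda>i. vbl A l (f i)) [0..<k]" ys n] x vbl_map_in[OF f] ys
    unfolding * by simp
qed

lemma functor_psh_of:
  assumes "\<And>n. elts A n \<in> U"
  shows "is_functor FF (Set_cat U) Psh"
proof -
  have in_hom: "fmap Psh m n f \<in> elts A m \<rightarrow>\<^sub>E elts A n" if "f \<in> hom FF m n" for m n f
    using that vbl_map_in[OF that] by (auto simp: psh_of_def intro!: plug_in)
  have ext: "fmap Psh m n \<in> extensional (hom FF m n)" for m n
    by (simp add: psh_of_def)
  have id: "fmap Psh n n (idt FF n) = (\<lambda>x\<in>elts A n. x)" for n
  proof -
    have *: "map (\<lambda>i. vbl A n (idt FF n i)) [0..<n] = vbls A n 0 n"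
      by (simp add: vbls_def idt_FF)
    have "idt FF n \<in> hom FF n n" by (simp add: idt_FF hom_FF)
    then show ?thesis
      unfolding psh_of_def ftor.simps by (simp add: * plug_vbls cong: restrict_cong)
  qed
  have cmp: "fmap Psh l n (cmp FF l m n g f) = compose (elts A l) (fmap Psh m n g) (fmap Psh l m f)"
    if f: "f \<in> hom FF l m" and g: "g \<in> hom FF m n" for l m n f g
  proof
    fix x
    have gf: "cmp FF l m n g f \<in> hom FF l n"
      using f g by (rule cmp_in_hom_FF)
    show "fmap Psh l n (cmp FF l m n g f) x = compose (elts A l) (fmap Psh m n g) (fmap Psh l m f) x"
    proof (cases "x \<in> elts A l")
      case True
      have "plug A m x (map (\<lambda>i. vbl A m (f i)) [0..<l]) \<in> elts A m"
        using True vbl_map_in[OF f] by (intro plug_in) simp_all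
      moreover have e: "map (\<lambda>i. map (\<lambda>i. vbl A n (g i)) [0..<m] ! f i) [0..<l] = map (\<lambda>i. vbl A n (cmp FF l m n g f i)) [0..<l]"
        using hom_FF_less[OF f] by (simp add: cmp_FF compose_eq)
      ultimately show ?thesis
        using True f g gf plug_rename[OF True f _ vbl_map_in[OF g]] unfolding e
        by (simp add: compose_eq fmap_psh_of)
    next
      case False
      then show ?thesis using gf by (simp add: compose_def psh_of_def)
    qed
  qed
  show ?thesis
    unfolding is_functor_def Set_cat_sel obj_FF fobj_psh_of
    using assms category_FF category_Set_cat in_hom ext id cmp
    by (auto simp: PiE_iff extensional_def)
qed

lemma is_psh_psh_of: "is_psh Psh"
  \<comment> \<open>With all subsets of the type as \<open>U\<close> the condition on the carrier
    sets is trivial.\<close>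
  by (rule is_psh_functor[OF functor_psh_of[of UNIV]]) simp

lemma mmult_model_of:
  assumes x: "x \<in> elts A (length ys)" "set ys \<subseteq> elts A n"
  shows "mmult Mdl n (tensor_class Psh Psh n (x, ys)) = plug A n x ys"
proof -
  have "on_class (\<lambda>(x, ys). plug A n x ys) (tensor_class Psh Psh n (x, ys)) =
      (\<lambda>(x, ys). plug A n x ys) (x, ys)"
    by (rule on_tensor_class) (simp add: fmap_psh_of plug_rename)
  then show ?thesis
    using in_tensor[of x "Psh" ys "Psh" n] assms by (simp add: model_of_def)
qed

lemma msub_model_of: "x \<in> elts A (length ys) \<Longrightarrow> set ys \<subseteq> elts A n \<Longrightarrow> msub Mdl n x ys = plug A n x ys"
  by (simp add: msub_def mmult_model_of)

lemma munit_model_of: "f \<in> hom FF 1 n \<Longrightarrow> munit Mdl n f = vbl A n (f 0)"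
  by (simp add: model_of_def)

lemma mvar_model_of:
  assumes "j < n"
  shows "mvar Mdl n j = vbl A n j"
proof -
  have "idt FF 1 \<in> hom FF 1 1" "(\<lambda>i\<in>{..<1}. j) \<in> hom FF 1 n"
    using assms by (auto simp: idt_FF hom_FF)
  then show ?thesis
    using plug_vbl[of 0 "[vbl A n j]" n] assms vbl_in
    by (simp add: mvar_def munit_model_of fmap_psh_of idt_FF)
qed

lemma metas_clone_of_model_of: "metas (clone_of Mdl) = metas A"
  by (simp add: metas_def fun_eq_iff)

lemma fobj_arg_psh_model_of: "fobj (arg_psh S Mdl f) p = metas A p (arity S f)"
  by (simp add: fobj_arg_psh metas_clone_of_model_of)

lemma oper_model_of:
  "f \<in> operators S \<Longrightarrow> xs \<in> metas A p (arity S f) \<Longrightarrow> oper Mdl f p xs = opr A f p xs"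
  by (simp add: model_of_def)

lemma munit_model_of_psh_hom: "munit Mdl \<in> psh_hom (yoneda 1) Psh"
proof -
  have "munit Mdl n (fmap (yoneda 1) m n f g) = fmap Psh m n f (munit Mdl m g)"
    if f: "f \<in> hom FF m n" and g: "g \<in> hom FF 1 m" for m n f g
  proof -
    have g0: "g 0 < m" by (rule hom_FF_less[OF g]) simp
    have "cmp FF 1 m n f g \<in> hom FF 1 n"
      using g f by (rule cmp_in_hom_FF)
    then have "munit Mdl n (fmap (yoneda 1) m n f g) = vbl A n (f (g 0))"
      using f g by (simp add: yoneda_def munit_model_of del: One_nat_def) (simp add: cmp_FF compose_eq)
    also have "\<dots> = fmap Psh m n f (munit Mdl m g)"
      using f g g0 plug_vbl[of "g 0" "map (\<lambda>i. vbl A n (f i)) [0..<m]" n] vbl_map_in[OF f]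
      by (simp add: munit_model_of fmap_psh_of vbl_in del: One_nat_def)
    finally show ?thesis .
  qed
  moreover have "munit Mdl n \<in> hom FF 1 n \<rightarrow>\<^sub>E elts A n" for n
  proof (rule PiE_I)
    fix f assume f: "f \<in> hom FF 1 n"
    then have "f 0 < n" by (rule hom_FF_less) simp
    then show "munit Mdl n f \<in> elts A n" by (simp add: munit_model_of[OF f] vbl_in)
  qed (simp add: model_of_def)
  ultimately show ?thesis
    by (simp add: psh_hom_def yoneda_def del: One_nat_def)
qed

lemma mmult_model_of_psh_hom: "mmult Mdl \<in> psh_hom (tensor Psh Psh) Psh"
proof -
  have "mmult Mdl n \<in> fobj (tensor Psh Psh) n \<rightarrow>\<^sub>E elts A n" for n
  proof (rule PiE_I)
    fix c assume "c \<in> fobj (tensor Psh Psh) n"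
    then show "mmult Mdl n c \<in> elts A n"
      by (rule tensorE) (simp add: mmult_model_of plug_in)
  qed (simp add: model_of_def)
  moreover have "mmult Mdl n (fmap (tensor Psh Psh) m n f c) =
      fmap Psh m n f (mmult Mdl m c)"
    if f: "f \<in> hom FF m n" and c: "c \<in> fobj (tensor Psh Psh) m" for m n f c
  proof -
    from c obtain x ys where c: "c = tensor_class Psh Psh m (x, ys)"
      and "x \<in> fobj Psh (length ys)" "set ys \<subseteq> fobj Psh m"
      by (rule tensorE)
    then have x: "x \<in> elts A (length ys)" and ys: "set ys \<subseteq> elts A m"
      by simp_all
    let ?vs = "map (\<lambda>i. vbl A n (f i)) [0..<m]"
    have e: "map (fmap Psh m n f) ys = map (\<lambda>y. plug A n y ?vs) ys"
      using ys f by (auto simp: fmap_psh_of)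
    have "set (map (\<lambda>y. plug A n y ?vs) ys) \<subseteq> elts A n"
      using ys vbl_map_in[OF f] by (auto intro!: plug_in)
    then have "mmult Mdl n (fmap (tensor Psh Psh) m n f c) =
       plug A n x (map (\<lambda>y. plug A n y ?vs) ys)"
      unfolding c using fmap_tensor[OF is_psh_psh_of f, of x "Psh" ys] x ys unfolding e
      by (simp add: mmult_model_of)
    also have "\<dots> = plug A n (plug A m x ys) ?vs"
      using plug_plug[of x ys ?vs n] x ys vbl_map_in[OF f] by simp
    also have "\<dots> = fmap Psh m n f (mmult Mdl m c)"
      unfolding c using x ys f by (simp add: mmult_model_of fmap_psh_of plug_in)
    finally show ?thesis .
  qed
  ultimately show ?thesis
    by (simp add: psh_hom_def)
qed

text \<open>Naturality is compatibility with substitution, taken at a list of variables: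
  \<open>lift\<close> of the variables chosen by \<open>g\<close> is the list of variables chosen by
  \<open>ext p q g\<close>.\<close>

lemma oper_model_of_psh_hom:
  assumes f: "f \<in> operators S"
  shows "oper Mdl f \<in> psh_hom (arg_psh S Mdl f) Psh"
proof -
  have "oper Mdl f p \<in> metas A p (arity S f) \<rightarrow>\<^sub>E elts A p" for p
    using f by (auto simp: model_of_def intro: opr_in)
  moreover have "oper Mdl f q (fmap (arg_psh S Mdl f) p q g xs) =
      fmap Psh p q g (oper Mdl f p xs)"
    if g: "g \<in> hom FF p q" and xs: "xs \<in> metas A p (arity S f)" for p q g xs
  proof -
    let ?vs = "map (\<lambda>i. vbl A q (g i)) [0..<p]"
    have lift: "lift A q k ?vs = map (\<lambda>i. vbl A (q + k) ((\<lambda>j\<in>{..<p + k}. ext p q g j) i)) [0..<p + k]" for k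
      by (rule nth_equalityI) (auto simp: nth_lift ext_def wk_vbl hom_FF_less[OF g])
    have ext: "(\<lambda>j\<in>{..<p + k}. ext p q g j) \<in> hom FF (p + k) (q + k)" for k
      by (intro restrict_in_hom_FF ext_less hom_FF_less[OF g])
    have "fmap (arg_psh S Mdl f) p q g xs =
        map2 (\<lambda>k x. fmap Psh (p + k) (q + k) (\<lambda>j\<in>{..<p + k}. ext p q g j) x) (arity S f) xs"
      using g xs by (auto simp: arg_psh_def psh_prod_def psh_shift_def metas_def comp_def intro!: nth_equalityI)
    also have "\<dots> = map2 (\<lambda>k x. plug A (q + k) x (lift A q k ?vs)) (arity S f) xs" (is "_ = ?ys")
    proof -
      have "fmap Psh (p + k) (q + k) (\<lambda>j\<in>{..<p + k}. ext p q g j) x = plug A (q + k) x (lift A q k ?vs)"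
        if "x \<in> elts A (p + k)" for k x
        unfolding lift by (rule fmap_psh_of[OF ext that])
      then show ?thesis
        using xs by (auto simp: in_metas in_set_zip)
    qed
    finally have 1: "fmap (arg_psh S Mdl f) p q g xs = ?ys" .
    have "?ys \<in> metas A q (arity S f)"
      using xs lift_in[OF vbl_map_in[OF g]] by (auto simp: in_metas intro!: plug_in)
    then have "oper Mdl f q (fmap (arg_psh S Mdl f) p q g xs) = opr A f q ?ys"
      unfolding 1 using f by (simp add: oper_model_of)
    also have "\<dots> = plug A q (opr A f p xs) ?vs"
      using plug_opr[OF f, of xs ?vs q] xs vbl_map_in[OF g] by simp
    also have "\<dots> = fmap Psh p q g (oper Mdl f p xs)"
      using f xs g by (simp add: oper_model_of fmap_psh_of opr_in)
    finally show ?thesis .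
  qed
  ultimately show ?thesis
    by (simp add: psh_hom_def fobj_arg_psh_model_of)
qed

lemma compatible_model_of: "compatible S Mdl"
  unfolding compatible_def fobj_arg_psh_model_of carr_model_of fobj_psh_of
proof (intro ballI allI impI, elim conjE)
  fix f m p xs ys
  assume f: "f \<in> operators S" and xs: "xs \<in> metas A m (arity S f)"
    and ys: "length ys = m" "set ys \<subseteq> elts A p"
  have lift: "map (fmap Psh p (p + k) (\<lambda>j\<in>{..<p}. j)) ys @ map (mvar Mdl (p + k)) [p..<p + k] =
      lift A p k ys" for k
  proof -
    have "(\<lambda>j\<in>{..<p}. j) \<in> hom FF p (p + k)"
      by (rule restrict_in_hom_FF) simp
    then have "fmap Psh p (p + k) (\<lambda>j\<in>{..<p}. j) x = wk A p k x" if "x \<in> elts A p" for x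
    proof -
      have *: "map (\<lambda>i. vbl A (p + k) ((\<lambda>j\<in>{..<p}. j) i)) [0..<p] = vbls A (p + k) 0 p"
        by (simp add: vbls_def)
      show ?thesis using fmap_psh_of[OF \<open>_ \<in> hom FF p (p + k)\<close> that] unfolding * by (simp add: wk_def)
    qed
    then show ?thesis
      using ys by (auto simp: lift_def vbls_def mvar_model_of)
  qed
  have eq: "map2 (\<lambda>k x. msub Mdl (p + k) x (lift A p k ys)) (arity S f) xs =
      map2 (\<lambda>k x. plug A (p + k) x (lift A p k ys)) (arity S f) xs"
    using xs ys lift_in[OF ys(2)] by (auto simp: in_metas in_set_zip msub_model_of)
  have "map2 (\<lambda>k x. plug A (p + k) x (lift A p k ys)) (arity S f) xs \<in> metas A p (arity S f)"
    using xs ys lift_in[OF ys(2)] by (auto simp: in_metas intro!: plug_in)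
  then show "msub Mdl p (oper Mdl f m xs) ys =
        oper Mdl f p (map2 (\<lambda>k x. msub Mdl (p + k) x
          (map (fmap Psh p (p + k) (\<lambda>j\<in>{..<p}. j)) ys @ map (mvar Mdl (p + k)) [p..<p + k]))
          (arity S f) xs)"
    unfolding lift eq using f xs ys plug_opr[of f xs ys p]
    by (simp add: oper_model_of msub_model_of opr_in)
qed

lemma is_model_model_of:
  assumes "\<And>n. elts A n \<in> U"
  shows "is_model S U Mdl"
proof -
  have "is_substitution_monoid Psh (munit Mdl) (mmult Mdl)"
    unfolding is_substitution_monoid_iff[OF is_psh_psh_of munit_model_of_psh_hom mmult_model_of_psh_hom]
      fobj_psh_of
  proof (intro conjI allI impI)
    fix n f and xs :: "'u list"
    assume f: "f \<in> hom FF 1 (length xs)" and xs: "set xs \<subseteq> elts A n"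
    have "f 0 < length xs" by (rule hom_FF_less[OF f]) simp
    then show "mmult Mdl n (tensor_class Psh Psh n (munit Mdl (length xs) f, xs)) = xs ! f 0"
      using f xs by (simp add: munit_model_of mmult_model_of vbl_in plug_vbl del: One_nat_def)
  next
    fix n x and fs :: "(nat \<Rightarrow> nat) list"
    assume x: "x \<in> elts A (length fs)" and fs: "set fs \<subseteq> hom FF 1 n"
    have *: "(fs ! i) 0 < n" if "i < length fs" for i
      using fs that by (intro hom_FF_less[of "fs ! i" 1]) auto
    then have f: "(\<lambda>i\<in>{..<length fs}. (fs ! i) 0) \<in> hom FF (length fs) n"
      by (rule restrict_in_hom_FF)
    have vs: "map (munit Mdl n) fs = map (\<lambda>i. vbl A n ((\<lambda>i\<in>{..<length fs}. (fs ! i) 0) i)) [0..<length fs]"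
      using fs by (auto simp: munit_model_of subset_eq simp del: One_nat_def intro!: nth_equalityI)
    show "mmult Mdl n (tensor_class Psh Psh n (x, map (munit Mdl n) fs)) =
         fmap Psh (length fs) n (\<lambda>i\<in>{..<length fs}. (fs ! i) 0) x"
      unfolding vs fmap_psh_of[OF f x] using x vbl_map_in[OF f] by (intro mmult_model_of) simp_all
  next
    fix n x ys and zs :: "'u list"
    assume x: "x \<in> elts A (length ys)" and ys: "set ys \<subseteq> elts A (length zs)" and zs: "set zs \<subseteq> elts A n"
    have eq: "map (\<lambda>y. mmult Mdl n (tensor_class Psh Psh n (y, zs))) ys =
        map (\<lambda>y. plug A n y zs) ys"
      using ys zs by (auto simp: mmult_model_of)
    have "set (map (\<lambda>y. plug A n y zs) ys) \<subseteq> elts A n"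
      using ys zs by (auto intro!: plug_in)
    then show "mmult Mdl n (tensor_class Psh Psh n
          (mmult Mdl (length zs) (tensor_class Psh Psh (length zs) (x, ys)), zs)) =
        mmult Mdl n (tensor_class Psh Psh n
          (x, map (\<lambda>y. mmult Mdl n (tensor_class Psh Psh n (y, zs))) ys))"
      unfolding eq using x ys zs by (simp add: mmult_model_of plug_in plug_plug)
  qed
  then show ?thesis
    unfolding is_model_def using functor_psh_of[OF assms] oper_model_of_psh_hom compatible_model_of
    by (auto simp: model_of_def)
qed

text \<open>\<open>model_of\<close> restricts the operations to their domains, so the clone of the
  resulting model agrees with \<open>A\<close> on elements but need not be equal to it. The identity
  as a homomorphism records this agreement.\<close>

lemma clone_hom_model_of: "is_clone_hom S (clone_of (model_of S A)) A (\<lambda>n x. x)"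
  by (auto simp: is_clone_hom_def mvar_model_of msub_model_of metas_clone_of_model_of oper_model_of
      in_metas intro!: arg_cong[of _ _ "opr A _ _"] nth_equalityI)

end

text \<open>From right to left, naturality in the stage has to be recovered: by
  \<open>fmap_conv_msub\<close> renaming is substitution of variables, and \<open>h\<close>
  preserves both.\<close>

lemma is_model_hom_iff:
  assumes A: "is_model S U A" and B: "is_model S U B"
  shows "is_model_hom S A B h \<longleftrightarrow>
    (\<forall>n. h n \<in> extensional (fobj (carr A) n)) \<and> is_clone_hom S (clone_of A) (clone_of B) h"
proof -
  interpret A: model S U A by (rule model.intro[OF A])
  interpret B: model S U B by (rule model.intro[OF B])
  show ?thesis
  proof
    assume h: "is_model_hom S A B h"
    then have psh: "h \<in> psh_hom (carr A) (carr B)" by (simp add: is_model_hom_def)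
    then have cl: "h n \<in> fobj (carr A) n \<rightarrow>\<^sub>E fobj (carr B) n" for n
      by (simp add: psh_hom_def)
    have var: "h n (mvar A n j) = mvar B n j" if "j < n" for n j
    proof -
      have f: "(\<lambda>i\<in>{..<1}. j) \<in> hom FF 1 n"
        using that by (auto simp: hom_FF)
      then have "h n (munit A n (\<lambda>i\<in>{..<1}. j)) = munit B n (\<lambda>i\<in>{..<1}. j)"
        using h by (simp add: is_model_hom_def yoneda_def del: One_nat_def)
      then show ?thesis
        using A.munit_conv_mvar[OF f] B.munit_conv_mvar[OF f] by simp
    qed
    have sub: "h q (msub A q x ys) = msub B q (h (length ys) x) (map (h q) ys)"
      if "x \<in> fobj (carr A) (length ys)" "set ys \<subseteq> fobj (carr A) q" for q x ys
    proof -
      have "h q \<in> fobj (carr A) q \<rightarrow> fobj (carr B) q" using cl by blast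
      then show ?thesis
        unfolding msub_def using h that in_tensor[OF that]
        by (simp add: is_model_hom_def tensor_map_class[where \<tau> = h and \<sigma> = h, OF psh])
    qed
    show "(\<forall>n. h n \<in> extensional (fobj (carr A) n)) \<and> is_clone_hom S (clone_of A) (clone_of B) h"
      using h cl var sub unfolding is_clone_hom_def is_model_hom_def fobj_arg_psh clone_of_sel
      by (auto simp: PiE_iff)
  next
    assume h: "(\<forall>n. h n \<in> extensional (fobj (carr A) n)) \<and> is_clone_hom S (clone_of A) (clone_of B) h"
    then have cl: "h n \<in> fobj (carr A) n \<rightarrow>\<^sub>E fobj (carr B) n" for n
      by (auto simp: is_clone_hom_def PiE_iff)
    have sub: "h q (msub A q x ys) = msub B q (h (length ys) x) (map (h q) ys)"
      if "x \<in> fobj (carr A) (length ys)" "set ys \<subseteq> fobj (carr A) q" for q x ys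
      using h that by (simp add: is_clone_hom_def)
    have var: "h n (mvar A n j) = mvar B n j" if "j < n" for n j
      using h that by (simp add: is_clone_hom_def)
    have "h n (fmap (carr A) m n f x) = fmap (carr B) m n f (h m x)"
      if f: "f \<in> hom FF m n" and x: "x \<in> fobj (carr A) m" for m n f x
    proof -
      have "set (map (\<lambda>i. mvar A n (f i)) [0..<m]) \<subseteq> fobj (carr A) n"
        using A.vbl_map_in[OF f] by simp
      moreover have e: "map (h n) (map (\<lambda>i. mvar A n (f i)) [0..<m]) = map (\<lambda>i. mvar B n (f i)) [0..<m]"
        using var hom_FF_less[OF f] by auto
      moreover have "h m x \<in> fobj (carr B) m" using cl x by blast
      ultimately show ?thesis
        using sub[of x "map (\<lambda>i. mvar A n (f i)) [0..<m]" n] x f unfolding e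
        by (simp add: A.fmap_conv_msub B.fmap_conv_msub)
    qed
    with cl have psh: "h \<in> psh_hom (carr A) (carr B)"
      by (simp add: psh_hom_def)
    have "h n (munit A n f) = munit B n f" if "f \<in> fobj (yoneda 1) n" for n f
    proof -
      have f: "f \<in> hom FF 1 n" using that by (simp add: yoneda_def)
      then have "f 0 < n" by (rule hom_FF_less) simp
      then show ?thesis
        using A.munit_conv_mvar[OF f] B.munit_conv_mvar[OF f] var by simp
    qed
    moreover have "h n (mmult A n c) = mmult B n (tensor_map (carr A) (carr A) (carr B) (carr B) h h n c)"
      if c: "c \<in> fobj (tensor (carr A) (carr A)) n" for n c
    proof -
      from c obtain x ys where c: "c = tensor_class (carr A) (carr A) n (x, ys)"
        and x: "x \<in> fobj (carr A) (length ys)" "set ys \<subseteq> fobj (carr A) n" by (rule tensorE)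
      have "h n \<in> fobj (carr A) n \<rightarrow> fobj (carr B) n" using cl by blast
      then show ?thesis
        using sub[OF x] x unfolding c msub_def
        by (simp add: tensor_map_class[where \<tau> = h and \<sigma> = h, OF psh])
    qed
    ultimately show "is_model_hom S A B h"
      using h psh unfolding is_clone_hom_def is_model_hom_def fobj_arg_psh clone_of_sel by simp
  qed
qed

section \<open>The classifying category\<close>

text \<open>The generic terms \<open>m\<^sub>i[x\<^sub>1, \<dots>]\<close>, which are the components of the identity of
  \<open>\<Theta>\<close> in the classifying category.\<close>

definition gens :: "nat list \<Rightarrow> 'o trm list" where
  "gens \<Theta> = map (\<lambda>i. MVar i (map Var [0..<\<Theta> ! i])) [0..<length \<Theta>]"

lemma length_gens [simp]: "length (gens \<Theta>) = length \<Theta>"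
  by (simp add: gens_def)

lemma nth_gens: "i < length \<Theta> \<Longrightarrow> gens \<Theta> ! i = MVar i (map Var [0..<\<Theta> ! i])"
  by (simp add: gens_def)

lemma wf_gens: "i < length \<Theta> \<Longrightarrow> wf_trm S \<Theta> (\<Theta> ! i) (gens \<Theta> ! i)"
  by (auto simp: nth_gens intro!: wf_trm.intros)

text \<open>A metavariable of arity \<open>p + m\<close> applied to all \<open>p + m\<close>
  variables is a term with \<open>p\<close> parameters and \<open>m\<close> arguments. These terms
  form the generic valuation of \<open>\<Theta>\<close> at stage \<open>p\<close>, on which
  \<open>derivable_param\<close> and \<open>clone_satisfies_C\<close> rest.\<close>

lemma gens_in_metas: "gens (map ((+) p) \<Theta>) \<in> metas (term_clone S (map ((+) p) \<Theta>)) p \<Theta>"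
  using wf_gens[of _ "map ((+) p) \<Theta>" S] by (auto simp: in_metas)

lemma gens_in_metas_0: "gens \<Theta> \<in> metas (term_clone S \<Theta>) 0 \<Theta>"
  using wf_gens[of _ \<Theta> S] by (auto simp: in_metas)

lemma in_metas_term_clone:
  "ts \<in> metas (term_clone S \<Theta>) p ns \<longleftrightarrow>
   length ts = length ns \<and> (\<forall>i<length ns. wf_trm S \<Theta> (p + ns ! i) (ts ! i))"
  by (simp add: in_metas)

text \<open>With this an equation between terms can be checked by evaluating both sides in the term
  clone, which is how \<open>msubst_conv_denote\<close> is obtained.\<close>

lemma ev_gens: "wf_trm S \<Theta> n t \<Longrightarrow> ev (term_clone S \<Theta>) n (gens \<Theta>) [] (map Var [0..<n]) t = t"
proof (induction rule: wf_trm.induct)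
  case (wf_MVar i ts n)
  have "map (ev (term_clone S \<Theta>) n (gens \<Theta>) [] (map Var [0..<n])) ts = ts"
    by (rule map_idI) (rule wf_MVar.IH)
  then show ?case
    using wf_MVar.hyps(1) by (simp add: nth_gens flip: wf_MVar.hyps(2))
      (auto intro: nth_equalityI)
next
  case (wf_Op f bs n)
  interpret T: clone S "term_clone S \<Theta>" by (rule clone_term_clone)
  have "lift (term_clone S \<Theta>) n k (map Var [0..<n]) = map Var [0..<n + k]" for k
    using T.map_wk_vbls[of n n k 0] vbls_append[of 0 n "n + k" "term_clone S \<Theta>" "n + k"]
    by (simp only: lift_def vbls_term_clone le_add1 order.refl zero_le simp_thms)
  then have *: "map (\<lambda>(k, t). ev (term_clone S \<Theta>) (n + k) (gens \<Theta>) [] (lift (term_clone S \<Theta>) n k (map Var [0..<n])) t) bs =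
      map snd bs"
    using wf_Op.IH by auto
  show ?case
    by (simp only: ev.simps term_clone_sel list.map(1) * zip_map_fst_snd flip: wf_Op(2))
qed auto

lemma denote_gens: "wf_trm S \<Theta> n t \<Longrightarrow> denote (term_clone S \<Theta>) 0 (gens \<Theta>) n t = t"
  by (simp add: denote_def ev_gens)

lemma ren_id: "wf_trm S \<Theta> n t \<Longrightarrow> ren n n (\<lambda>j. j) t = t"
  using ren_conv_subst[of S \<Theta> n t "\<lambda>j. j" n] subst_vars[of S \<Theta> n t] by simp

context clone
begin

lemma denote_gen:
  assumes "\<phi> \<in> metas A 0 \<Theta>" "i < length \<Theta>"
  shows "denote A 0 \<phi> (\<Theta> ! i) (gens \<Theta> ! i) = \<phi> ! i"
proof -
  have "map (ev A (\<Theta> ! i) \<phi> [] (vbls A (\<Theta> ! i) 0 (\<Theta> ! i))) (map Var [0..<\<Theta> ! i]) = vbls A (\<Theta> ! i) 0 (\<Theta> ! i)"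
    by (rule nth_equalityI) simp_all
  then show ?thesis
    using assms plug_vbls[of "\<phi> ! i" "\<Theta> ! i"] by (simp add: denote_def nth_gens in_metas)
qed

lemma map2_denote_gens:
  assumes "\<phi> \<in> metas A 0 \<Theta>"
  shows "map2 (denote A 0 \<phi>) \<Theta> (gens \<Theta>) = \<phi>"
  using assms denote_gen[OF assms] by (auto simp: in_metas intro!: nth_equalityI)

lemma denote_msubst:
  assumes "wf_trm S ms n t" "ss \<in> metas (term_clone S \<Theta>) 0 ms" "\<phi> \<in> metas A 0 \<Theta>"
  shows "denote A 0 \<phi> n (msubst n (abstrs n 0 ms ss) t) = denote A 0 (map2 (denote A 0 \<phi>) ms ss) n t"
  using ev_abstrs[of ms n t ss \<Theta> 0 \<phi> 0 "[]" n "vbls A n 0 n"] assms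
  by (simp add: denote_def[abs_def] in_metas_term_clone ren_id vbls_in)

end

text \<open>Terms that denote the clone operations; they are used to define these operations on the
  values of a functorial model.\<close>

definition plug_term :: "nat \<Rightarrow> nat \<Rightarrow> 'o trm" where
  "plug_term m q = MVar 0 (map (\<lambda>i. MVar (Suc i) (map Var [0..<q])) [0..<m])"

definition opr_term :: "'o signature \<Rightarrow> 'o \<Rightarrow> nat \<Rightarrow> 'o trm" where
  "opr_term S f p = Op f (zip (arity S f) (gens (map ((+) p) (arity S f))))"

lemma wf_plug_term: "wf_trm S (m # replicate m q) q (plug_term m q)"
  by (auto simp: plug_term_def intro!: wf_trm.intros)

lemma wf_opr_term: "f \<in> operators S \<Longrightarrow> wf_trm S (map ((+) p) (arity S f)) p (opr_term S f p)"
  unfolding opr_term_def using wf_gens[of _ "map ((+) p) (arity S f)"] by (intro wf_Op_zip) simp_all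

lemma Cons_in_metas:
  assumes "x \<in> elts A (length ys)" "set ys \<subseteq> elts A q"
  shows "x # ys \<in> metas A 0 (length ys # replicate (length ys) q)"
proof -
  have "ys ! i \<in> elts A q" if "i < length ys" for i
    using assms(2) nth_mem[OF that] by auto
  then show ?thesis
    using assms(1) by (auto simp: in_metas nth_Cons split: nat.splits)
qed

text \<open>Trades the stage for larger arities, so that operators at stage \<open>p\<close> become
  terms over a metavariable context at stage 0, the stage of the classifying category.\<close>

lemma metas_shift: "metas A 0 (map ((+) p) \<Theta>) = metas A p \<Theta>"
  by (simp add: metas_def comp_def)

lemma map2_replicate: "map2 h (replicate (length ys) q) ys = map (h q) ys"
  by (rule nth_equalityI) simp_all

context clone
begin

lemma denote_plug_term:
  assumes x: "x \<in> elts A (length ys)" and ys: "set ys \<subseteq> elts A q"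
  shows "denote A 0 (x # ys) q (plug_term (length ys) q) = plug A q x ys"
proof -
  have ysi: "ys ! i \<in> elts A q" if "i < length ys" for i
    using ys nth_mem[OF that] by auto
  have "map (ev A q (x # ys) [] (vbls A q 0 q)) (map Var [0..<q]) = vbls A q 0 q"
    by (rule nth_equalityI) simp_all
  then have "ev A q (x # ys) [] (vbls A q 0 q) (MVar (Suc i) (map Var [0..<q])) = ys ! i"
    if "i < length ys" for i
    using that plug_vbls[OF ysi[OF that]] by (simp del: map_map)
  then have "map (ev A q (x # ys) [] (vbls A q 0 q))
      (map (\<lambda>i. MVar (Suc i) (map Var [0..<q])) [0..<length ys]) = ys"
    by (intro nth_equalityI) simp_all
  then show ?thesis
    by (simp add: denote_def plug_term_def del: map_map)
qed

lemma denote_opr_term: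
  assumes xs: "xs \<in> metas A p (arity S f)"
  shows "denote A 0 xs p (opr_term S f p) = opr A f p xs"
proof -
  let ?ms = "map ((+) p) (arity S f)"
  have xs': "xs \<in> metas A 0 ?ms"
    using xs by (simp add: metas_shift)
  have "lift A p k (vbls A p 0 p) = vbls A (p + k) 0 (p + k)" for k
    by (simp add: lift_def map_wk_vbls vbls_append)
  then have "ev A (p + arity S f ! i) xs [] (lift A p (arity S f ! i) (vbls A p 0 p)) (gens ?ms ! i) = xs ! i"
    if "i < length (arity S f)" for i
    using denote_gen[OF xs', of i] that by (simp add: denote_def)
  then have "map (\<lambda>(k, t). ev A (p + k) xs [] (lift A p k (vbls A p 0 p)) t) (zip (arity S f) (gens ?ms)) = xs"
    using xs by (intro nth_equalityI) (simp_all add: in_metas)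
  then show ?thesis
    by (simp add: denote_def opr_term_def)
qed

text \<open>Variables, \<open>plug\<close> and the operators are themselves denotations, of
  \<open>Var j\<close>, \<open>plug_term\<close> and \<open>opr_term\<close>. Composites, inverses
  and natural transformations can thus be recognised as homomorphisms through \<open>denote\<close>
  alone.\<close>

lemma clone_homI:
  assumes B: "clone S B" and h: "\<And>n x. x \<in> elts A n \<Longrightarrow> h n x \<in> elts B n"
    and denote: "\<And>\<Theta> n t \<phi>. wf_trm S \<Theta> n t \<Longrightarrow> \<phi> \<in> metas A 0 \<Theta> \<Longrightarrow>
      h n (denote A 0 \<phi> n t) = denote B 0 (map2 h \<Theta> \<phi>) n t"
  shows "is_clone_hom S A B h"
  unfolding is_clone_hom_def
proof (intro conjI allI ballI impI)
  fix n j :: nat assume "j < n"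
  then show "h n (vbl A n j) = vbl B n j"
    using denote[of "[]" n "Var j" "[]"] by (simp add: wf_Var in_metas denote_def)
next
  fix q x ys assume x: "x \<in> elts A (length ys)" and ys: "set ys \<subseteq> elts A q"
  have "set (map (h q) ys) \<subseteq> elts B q"
    using h ys by auto
  then show "h q (plug A q x ys) = plug B q (h (length ys) x) (map (h q) ys)"
    using denote[OF wf_plug_term Cons_in_metas[OF x ys]] denote_plug_term[OF x ys] h[OF x]
      clone.denote_plug_term[OF B, of "h (length ys) x" "map (h q) ys" q]
    by (simp add: map2_replicate)
next
  fix f p xs assume f: "f \<in> operators S" and xs: "xs \<in> metas A p (arity S f)"
  have "map2 h (map ((+) p) (arity S f)) xs = map2 (\<lambda>k x. h (p + k) x) (arity S f) xs"
    using xs by (intro nth_equalityI) (simp_all add: in_metas)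
  moreover have "map2 (\<lambda>k x. h (p + k) x) (arity S f) xs \<in> metas B p (arity S f)"
    using xs h by (simp add: in_metas)
  ultimately show "h p (opr A f p xs) = opr B f p (map2 (\<lambda>k x. h (p + k) x) (arity S f) xs)"
    using denote[OF wf_opr_term[OF f], of xs p] denote_opr_term[OF xs] xs
      clone.denote_opr_term[OF B, of _ p f]
    by (simp add: metas_shift)
qed (rule h)

end

text \<open>Evaluation at \<open>gens \<Theta>\<close> is the identity on terms, and
  \<open>denote_msubst\<close> computes it on the left side. Composition in the classifying category
  thereby becomes evaluation in the term clone.\<close>

lemma msubst_conv_denote:
  assumes "wf_trm S ms n t" "ss \<in> metas (term_clone S \<Theta>) 0 ms"
  shows "msubst n (abstrs n 0 ms ss) t = denote (term_clone S \<Theta>) 0 ss n t"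
proof -
  interpret T: clone S "term_clone S \<Theta>" by (rule clone_term_clone)
  have "wf_trm S \<Theta> n (msubst n (abstrs n 0 ms ss) t)"
    using wf_abstrs[of S ms n t ss \<Theta> 0] assms by (simp add: in_metas_term_clone ren_id)
  then have "msubst n (abstrs n 0 ms ss) t =
      denote (term_clone S \<Theta>) 0 (gens \<Theta>) n (msubst n (abstrs n 0 ms ss) t)"
    by (simp add: denote_gens)
  also have "\<dots> = denote (term_clone S \<Theta>) 0 (map2 (denote (term_clone S \<Theta>) 0 (gens \<Theta>)) ms ss) n t"
    using assms gens_in_metas_0 by (rule T.denote_msubst)
  also have "map2 (denote (term_clone S \<Theta>) 0 (gens \<Theta>)) ms ss = ss"
    using assms(2) by (auto simp: in_metas_term_clone denote_gens intro!: nth_equalityI)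
  finally show ?thesis .
qed

text \<open>For \<open>A\<close> a term clone this is associativity of composition in the
  classifying category; for the clone of a model it is functoriality of the functor built from
  it.\<close>

lemma (in clone) denote_denote:
  assumes "wf_trm S ms n t" "ss \<in> metas (term_clone S \<Theta>) 0 ms" "\<phi> \<in> metas A 0 \<Theta>"
  shows "denote A 0 \<phi> n (denote (term_clone S \<Theta>) 0 ss n t) = denote A 0 (map2 (denote A 0 \<phi>) ms ss) n t"
  using denote_msubst[OF assms] msubst_conv_denote[OF assms(1,2)] by simp

locale presentation =
  fixes S :: "'o signature" and E :: "'o equation set"
  assumes presentation: "is_presentation S E"
begin

abbreviation T :: "nat list \<Rightarrow> ('o, 'o trm) clone_ops" where
  "T \<equiv> term_clone S"

abbreviation M :: "(nat list, 'o trm set list) cat" where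
  "M \<equiv> classifying_cat S E"

abbreviation cls :: "nat list \<Rightarrow> nat \<Rightarrow> 'o trm \<Rightarrow> 'o trm set" where
  "cls \<equiv> eq_class S E"

abbreviation classes :: "nat list \<Rightarrow> nat list \<Rightarrow> 'o trm list \<Rightarrow> 'o trm set list" where
  "classes \<Theta> \<equiv> map2 (cls \<Theta>)"

lemmas wf = derivable_wf[OF presentation]

lemma denote_in_T: "wf_trm S ms n t \<Longrightarrow> ss \<in> metas (T \<Theta>) 0 ms \<Longrightarrow> wf_trm S \<Theta> n (denote (T \<Theta>) 0 ss n t)"
  using clone.denote_in[OF clone_term_clone, of S ms n t ss \<Theta> 0] by simp

text \<open>The metasubstitution rule with \<open>\<Delta>\<close> empty, that is
  \<open>d = 0\<close>, where the renaming of \<open>s\<close> and \<open>t\<close> is the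
  identity.\<close>

lemma derivable_denote:
  assumes st: "derivable S E ms n s t" and ss: "length ss = length ms" "length ts = length ms"
    and sts: "\<And>i. i < length ms \<Longrightarrow> derivable S E \<Theta> (ms ! i) (ss ! i) (ts ! i)"
  shows "derivable S E \<Theta> n (denote (T \<Theta>) 0 ss n s) (denote (T \<Theta>) 0 ts n t)"
proof -
  have "ss \<in> metas (T \<Theta>) 0 ms" "ts \<in> metas (T \<Theta>) 0 ms"
    using ss wf[OF sts] by (auto simp: in_metas_term_clone)
  then show ?thesis
    using derivable.msubst[OF st ss, of \<Theta> 0] sts wf[OF st] ren_id[of S ms n]
    by (simp add: msubst_conv_denote[where S = S and \<Theta> = \<Theta>])
qed

text \<open>The metasubstitution rule does not mention variables, but metasubstituting \<open>s\<close> and \<open>t\<close>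
  for \<open>m\<close> in the reflexive equation on \<open>m[x\<^sub>j\<^sub>1, \<dots>, x\<^sub>j\<^sub>n]\<close> renames them.\<close>

lemma derivable_rename:
  assumes st: "derivable S E \<Theta> n s t" and js: "length js = n" "\<And>j. j \<in> set js \<Longrightarrow> j < q"
  shows "derivable S E \<Theta> q (subst q (map Var js) s) (subst q (map Var js) t)"
proof -
  have "wf_trm S [n] q (MVar 0 (map Var js))"
    using js by (auto intro!: wf_trm.intros)
  then have "derivable S E \<Theta> q (denote (T \<Theta>) 0 [s] q (MVar 0 (map Var js)))
      (denote (T \<Theta>) 0 [t] q (MVar 0 (map Var js)))"
    using st by (intro derivable_denote[of "[n]"] derivable.refl) auto
  moreover have "denote (T \<Theta>) 0 [s] q (MVar 0 (map Var js)) = subst q (map Var js) s" for s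
  proof -
    have "map (ev (T \<Theta>) q [s] [] (map Var [0..<q])) (map Var js) = map Var js"
      using js(2) by auto
    then show ?thesis by (simp add: denote_def del: map_map)
  qed
  ultimately show ?thesis by simp
qed

text \<open>The metasubstitution rule puts the \<open>p\<close> new variables after the \<open>n\<close> old ones, whereas the
  interpretation at stage \<open>p\<close> puts them first: hence the renaming by \<open>[p..<p + n] @ [0..<p]\<close>.\<close>

lemma derivable_param:
  fixes p :: nat
  assumes st: "derivable S E \<Theta> n s t"
  defines "\<Theta>' \<equiv> map ((+) p) \<Theta>"
  shows "derivable S E \<Theta>' (p + n) (denote (T \<Theta>') p (gens \<Theta>') n s) (denote (T \<Theta>') p (gens \<Theta>') n t)"
proof -
  interpret T': clone S "T \<Theta>'" by (rule clone_term_clone)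
  let ?u = "\<lambda>s. msubst (n + p) (abstrs n p \<Theta> (gens \<Theta>')) (ren n (n + p) (\<lambda>j. j) s)"
  let ?js = "[p..<p + n] @ [0..<p]"
  have gens: "wf_trm S \<Theta>' (p + \<Theta> ! i) (gens \<Theta>' ! i)" if "i < length \<Theta>" for i
    using wf_gens[of i \<Theta>' S] that by (simp add: \<Theta>'_def)
  have len: "length \<Theta>' = length \<Theta>" by (simp add: \<Theta>'_def)
  have "derivable S E \<Theta>' (n + p) (?u s) (?u t)"
    using gens by (intro derivable.msubst[OF st]) (auto simp: len intro: derivable.refl)
  then have 1: "derivable S E \<Theta>' (p + n) (subst (p + n) (map Var ?js) (?u s)) (subst (p + n) (map Var ?js) (?u t))"
    by (rule derivable_rename) auto
  have 2: "subst (p + n) (map Var ?js) (?u s) = denote (T \<Theta>') p (gens \<Theta>') n s" if s: "wf_trm S \<Theta> n s" for s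
  proof -
    have "wf_trm S \<Theta>' (n + p) (?u s)"
      using wf_abstrs[OF s _ gens] by (simp add: len)
    then have "?u s = ev (T \<Theta>') (n + p) (gens \<Theta>') [] (map Var [0..<n + p]) (?u s)"
      by (simp add: ev_gens)
    also have "\<dots> = ev (T \<Theta>') (n + p) (map2 (\<lambda>m s. denote (T \<Theta>') 0 (gens \<Theta>') (p + m) s) \<Theta> (gens \<Theta>'))
        ([] @ drop n (map Var [0..<n + p])) (take n (map Var [0..<n + p])) s"
      by (rule T'.ev_abstrs[OF s _ gens gens_in_metas_0]) (auto simp: len intro: wf_trm.intros)
    also have "map2 (\<lambda>m s. denote (T \<Theta>') 0 (gens \<Theta>') (p + m) s) \<Theta> (gens \<Theta>') = gens \<Theta>'"
      using gens by (auto simp: len denote_gens intro!: nth_equalityI)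
    also have "[] @ drop n (map Var [0..<n + p]) = vbls (T \<Theta>') (n + p) n (n + p)"
      by (simp add: drop_map)
    also have "take n (map Var [0..<n + p]) = vbls (T \<Theta>') (n + p) 0 n"
      by (simp add: take_map)
    finally have "subst (p + n) (map Var ?js) (?u s) =
        plug (T \<Theta>') (p + n) (ev (T \<Theta>') (n + p) (gens \<Theta>') (vbls (T \<Theta>') (n + p) n (n + p)) (vbls (T \<Theta>') (n + p) 0 n) s) (map Var ?js)"
      by simp
    also have "\<dots> = ev (T \<Theta>') (p + n) (gens \<Theta>')
       (map (\<lambda>x. plug (T \<Theta>') (p + n) x (map Var ?js)) (vbls (T \<Theta>') (n + p) n (n + p)))
       (map (\<lambda>x. plug (T \<Theta>') (p + n) x (map Var ?js)) (vbls (T \<Theta>') (n + p) 0 n)) s"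
      using gens_in_metas[of p \<Theta> S, folded \<Theta>'_def]
      by (rule T'.ev_plug[OF s]) (auto intro: wf_trm.intros)
    also have "map (\<lambda>x. plug (T \<Theta>') (p + n) x (map Var ?js)) (vbls (T \<Theta>') (n + p) n (n + p)) = vbls (T \<Theta>') (p + n) 0 p"
      by (rule nth_equalityI) (auto simp: nth_append)
    also have "map (\<lambda>x. plug (T \<Theta>') (p + n) x (map Var ?js)) (vbls (T \<Theta>') (n + p) 0 n) = vbls (T \<Theta>') (p + n) p (p + n)"
      by (rule nth_equalityI) (auto simp: nth_append)
    finally show ?thesis
      by (simp add: denote_def)
  qed
  show ?thesis
    using 1 wf[OF st] by (simp only: 2)
qed

section \<open>Morphisms as tuples of classes, and the category laws\<close>

lemma cls_eq_iff:
  assumes "wf_trm S \<Theta> n s" "wf_trm S \<Theta> n t"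
  shows "cls \<Theta> n s = cls \<Theta> n t \<longleftrightarrow> derivable S E \<Theta> n s t"
  unfolding eq_class_def using assms derivable.refl derivable.sym derivable.trans by blast

lemma obj_M [simp]: "obj M = UNIV"
  by (simp add: classifying_cat_def)

lemma idt_M: "idt M ms = classes ms ms (gens ms)"
  by (auto simp: classifying_cat_def nth_gens intro!: nth_equalityI)

lemma classes_in_hom: "ts \<in> metas (T ms) 0 ns \<Longrightarrow> classes ms ns ts \<in> hom M ms ns"
  by (auto simp: classifying_cat_def in_listset in_metas_term_clone term_classes_def)

lemma hom_M_E:
  assumes "f \<in> hom M ms ns"
  obtains ts where "ts \<in> metas (T ms) 0 ns" "f = classes ms ns ts"
proof -
  have f: "length f = length ns" "\<forall>i<length ns. f ! i \<in> term_classes S E ms (ns ! i)"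
    using assms by (auto simp: classifying_cat_def in_listset)
  then have "\<forall>i<length ns. \<exists>t. wf_trm S ms (ns ! i) t \<and> f ! i = cls ms (ns ! i) t"
    by (auto simp: term_classes_def)
  then obtain t where t: "\<forall>i<length ns. wf_trm S ms (ns ! i) (t i) \<and> f ! i = cls ms (ns ! i) (t i)"
    by metis
  show ?thesis
    by (rule that[of "map t [0..<length ns]"]) (use f t in \<open>auto simp: in_metas_term_clone intro!: nth_equalityI\<close>)
qed

lemma cmp_classes:
  assumes ts: "ts \<in> metas (T ms) 0 ns" and ss: "ss \<in> metas (T ls) 0 ms"
  shows "cmp M ls ms ns (classes ms ns ts) (classes ls ms ss) = classes ls ns (map2 (denote (T ls) 0 ss) ns ts)"
proof (rule nth_equalityI)
  fix i assume "i < length (cmp M ls ms ns (classes ms ns ts) (classes ls ms ss))"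
  then have i: "i < length ns" by (simp add: classifying_cat_def)
  let ?n = "ns ! i" and ?t = "ts ! i"
  have t: "wf_trm S ms ?n ?t" using ts i by (simp add: in_metas_term_clone)
  have ss': "ss \<in> listset (classes ls ms ss)"
    using ss by (auto simp: in_listset in_metas_term_clone eq_class_def intro: derivable.refl)
  have t': "?t \<in> cls ms ?n ?t"
    using t by (simp add: eq_class_def derivable.refl)
  \<comment> \<open>By \<open>derivable_denote\<close> all choices of representatives give the same
    class, and \<open>ss'\<close> and \<open>t'\<close> provide one choice, so the union collapses
    to that class.\<close>
  have eq: "cls ls ?n (msubst ?n (abstrs ?n 0 ms us) u) = cls ls ?n (denote (T ls) 0 ss ?n ?t)"
    if u: "u \<in> cls ms ?n ?t" and us: "us \<in> listset (classes ls ms ss)" for u us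
  proof -
    have d: "derivable S E ms ?n ?t u"
      using u by (simp add: eq_class_def)
    have ds: "derivable S E ls (ms ! j) (ss ! j) (us ! j)" if "j < length ms" for j
      using us ss that by (auto simp: in_listset in_metas_term_clone eq_class_def)
    have len: "length us = length ms" "length ss = length ms"
      using us ss by (auto simp: in_listset in_metas_term_clone)
    have us': "us \<in> metas (T ls) 0 ms"
      using wf[OF ds] len by (auto simp: in_metas_term_clone)
    have d': "derivable S E ls ?n (denote (T ls) 0 ss ?n ?t) (denote (T ls) 0 us ?n u)"
      using d len(2,1) ds by (rule derivable_denote)
    then show ?thesis
      using wf[OF d'] wf[OF d] us'
      by (simp add: msubst_conv_denote[where S = S and \<Theta> = ls] cls_eq_iff derivable.sym)
  qed
  have "(\<Union>u\<in>cls ms ?n ?t. \<Union>us\<in>listset (classes ls ms ss). cls ls ?n (msubst ?n (abstrs ?n 0 ms us) u)) =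
      cls ls ?n (denote (T ls) 0 ss ?n ?t)"
    using eq ss' t' by blast
  then show "cmp M ls ms ns (classes ms ns ts) (classes ls ms ss) ! i = classes ls ns (map2 (denote (T ls) 0 ss) ns ts) ! i"
    using i ts by (simp add: classifying_cat_def in_metas_term_clone)
qed (use ts in \<open>simp add: classifying_cat_def in_metas_term_clone\<close>)

lemma map2_denote_in:
  assumes "ts \<in> metas (T ms) 0 ns" "ss \<in> metas (T ls) 0 ms"
  shows "map2 (denote (T ls) 0 ss) ns ts \<in> metas (T ls) 0 ns"
  using assms denote_in_T[OF _ assms(2)] by (auto simp: in_metas_term_clone)

lemma category_M: "is_category M"
  unfolding is_category_def obj_M
proof (intro conjI ballI)
  fix a show "idt M a \<in> hom M a a"
    unfolding idt_M by (rule classes_in_hom[OF gens_in_metas_0])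
next
  fix a b c f g assume "f \<in> hom M a b" "g \<in> hom M b c"
  then show "cmp M a b c g f \<in> hom M a c"
    by (elim hom_M_E) (simp add: cmp_classes classes_in_hom map2_denote_in)
next
  fix a b f assume "f \<in> hom M a b"
  then obtain ts where ts: "ts \<in> metas (T a) 0 b" and f: "f = classes a b ts" by (rule hom_M_E)
  show "cmp M a b b (idt M b) f = f"
    unfolding idt_M f cmp_classes[OF gens_in_metas_0 ts] clone.map2_denote_gens[OF clone_term_clone ts] ..
  have "map2 (denote (T a) 0 (gens a)) b ts = ts"
    using ts by (auto simp: in_metas_term_clone denote_gens intro!: nth_equalityI)
  then show "cmp M a a b f (idt M a) = f"
    unfolding idt_M f cmp_classes[OF ts gens_in_metas_0] by (simp only:)
next
  fix a b c d f g h assume "f \<in> hom M a b" "g \<in> hom M b c" "h \<in> hom M c d"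
  then obtain ts ss us where ts: "ts \<in> metas (T a) 0 b" and ss: "ss \<in> metas (T b) 0 c" and us: "us \<in> metas (T c) 0 d"
    and f: "f = classes a b ts" and g: "g = classes b c ss" and h: "h = classes c d us"
    by (elim hom_M_E)
  have "map2 (denote (T a) 0 (map2 (denote (T a) 0 ts) c ss)) d us =
      map2 (denote (T a) 0 ts) d (map2 (denote (T b) 0 ss) d us)"
    using clone.denote_denote[OF clone_term_clone _ ss ts] us
    by (auto simp: in_metas_term_clone intro!: nth_equalityI)
  then show "cmp M a c d h (cmp M a b c g f) = cmp M a b d (cmp M b c d h g) f"
    unfolding f g h using ts ss us by (simp add: cmp_classes map2_denote_in)
qed

end

section \<open>Products in Set, and clones from functorial models\<close>

text \<open>Maps out of the singleton \<open>{u}\<close> are elements, so the universal property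
  tested there says that each tuple in \<open>listset As\<close> has exactly one preimage in
  \<open>P\<close>. Conversely, mediating maps come from inverting the tupling.\<close>

lemma is_product_Set_cat_iff:
  assumes u: "{u} \<in> U"
  shows "is_product (Set_cat U) As P ps \<longleftrightarrow>
    P \<in> U \<and> set As \<subseteq> U \<and> length ps = length As \<and> (\<forall>i<length As. ps ! i \<in> P \<rightarrow>\<^sub>E As ! i) \<and>
    bij_betw (\<lambda>x. map (\<lambda>p. p x) ps) P (listset As)"
    (is "_ \<longleftrightarrow> ?rhs")
proof
  assume prod: "is_product (Set_cat U) As P ps"
  then have len: "length ps = length As" and ps: "\<forall>i<length As. ps ! i \<in> P \<rightarrow>\<^sub>E As ! i"
    by (simp_all add: is_product_def)
  have ps_in: "(ps ! i) x \<in> As ! i" if "i < length As" "x \<in> P" for i x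
    using PiE_mem[of "ps ! i" P "\<lambda>_. As ! i" x] ps that by simp
  have univ: "\<exists>!h. h \<in> {u} \<rightarrow>\<^sub>E P \<and> (\<forall>i<length As. compose {u} (ps ! i) h = fs ! i)"
    if "length fs = length As" "\<forall>i<length As. fs ! i \<in> {u} \<rightarrow>\<^sub>E As ! i" for fs
  proof -
    have "\<forall>Q\<in>U. \<forall>fs. length fs = length As \<and> (\<forall>i<length As. fs ! i \<in> Q \<rightarrow>\<^sub>E As ! i) \<longrightarrow>
        (\<exists>!h. h \<in> Q \<rightarrow>\<^sub>E P \<and> (\<forall>i<length As. compose Q (ps ! i) h = fs ! i))"
      using prod unfolding is_product_def Set_cat_sel by (elim conjE)
    from this[THEN bspec, OF u, THEN spec, of fs] that show ?thesis by (simp only: simp_thms)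
  qed
  have "inj_on (\<lambda>x. map (\<lambda>p. p x) ps) P"
  proof (rule inj_onI)
    fix x y assume x: "x \<in> P" and y: "y \<in> P" and eq: "map (\<lambda>p. p x) ps = map (\<lambda>p. p y) ps"
    have eq': "(ps ! i) x = (ps ! i) y" if "i < length As" for i
      using arg_cong[OF eq, of "\<lambda>zs. zs ! i"] that len by simp
    let ?fs = "map (\<lambda>p. \<lambda>_\<in>{u}. p x) ps"
    have "\<forall>i<length As. ?fs ! i \<in> {u} \<rightarrow>\<^sub>E As ! i"
      using x ps_in len by auto
    then have ex: "\<exists>!h. h \<in> {u} \<rightarrow>\<^sub>E P \<and> (\<forall>i<length As. compose {u} (ps ! i) h = ?fs ! i)"
      using len by (intro univ) simp_all
    have hx: "(\<lambda>_\<in>{u}. x) \<in> {u} \<rightarrow>\<^sub>E P \<and> (\<forall>i<length As. compose {u} (ps ! i) (\<lambda>_\<in>{u}. x) = ?fs ! i)"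
      using x len by (auto simp: compose_def)
    have hy: "(\<lambda>_\<in>{u}. y) \<in> {u} \<rightarrow>\<^sub>E P \<and> (\<forall>i<length As. compose {u} (ps ! i) (\<lambda>_\<in>{u}. y) = ?fs ! i)"
      using y len eq' by (auto simp: compose_def)
    have "(\<lambda>_\<in>{u}. x) = (\<lambda>_\<in>{u}. y)"
      by (rule HOL.trans[OF the1_equality[OF ex, OF hx, symmetric] the1_equality[OF ex, OF hy]])
    then show "x = y"
      by (metis restrict_apply' singletonI)
  qed
  moreover have "(\<lambda>x. map (\<lambda>p. p x) ps) ` P = listset As"
  proof (intro equalityI subsetI)
    fix xs assume "xs \<in> (\<lambda>x. map (\<lambda>p. p x) ps) ` P"
    then show "xs \<in> listset As"
      using ps_in len by (auto simp: in_listset)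
  next
    fix xs assume xs: "xs \<in> listset As"
    let ?fs = "map (\<lambda>x. \<lambda>_\<in>{u}. x) xs"
    have "\<forall>i<length As. ?fs ! i \<in> {u} \<rightarrow>\<^sub>E As ! i" "length ?fs = length As"
      using xs by (auto simp: in_listset)
    then obtain h where h: "h \<in> {u} \<rightarrow>\<^sub>E P" "\<forall>i<length As. compose {u} (ps ! i) h = ?fs ! i"
      using univ[of ?fs] by blast
    have "map (\<lambda>p. p (h u)) ps = xs"
    proof (rule nth_equalityI)
      fix i assume "i < length (map (\<lambda>p. p (h u)) ps)"
      then have i: "i < length As" by (simp add: len)
      then have "compose {u} (ps ! i) h u = (?fs ! i) u"
        using h(2) by simp
      then show "map (\<lambda>p. p (h u)) ps ! i = xs ! i"
        using i xs len by (simp add: compose_eq in_listset)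
    qed (use xs len in \<open>simp add: in_listset\<close>)
    moreover have "h u \<in> P" using h(1) by blast
    ultimately show "xs \<in> (\<lambda>x. map (\<lambda>p. p x) ps) ` P" by blast
  qed
  ultimately show ?rhs
    using prod by (simp add: bij_betw_def is_product_def)
next
  assume rhs: ?rhs
  then have len: "length ps = length As" and ps: "\<forall>i<length As. ps ! i \<in> P \<rightarrow>\<^sub>E As ! i"
    and bij: "bij_betw (\<lambda>x. map (\<lambda>p. p x) ps) P (listset As)" by simp_all
  let ?inv = "inv_into P (\<lambda>x. map (\<lambda>p. p x) ps)"
  have "\<exists>!h. h \<in> Q \<rightarrow>\<^sub>E P \<and> (\<forall>i<length As. compose Q (ps ! i) h = fs ! i)"
    if fs: "length fs = length As" "\<forall>i<length As. fs ! i \<in> Q \<rightarrow>\<^sub>E As ! i" for Q fs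
  proof (rule ex1I)
    let ?h = "\<lambda>q\<in>Q. ?inv (map (\<lambda>f. f q) fs)"
    have fq: "map (\<lambda>f. f q) fs \<in> listset As" if "q \<in> Q" for q
      using fs that by (auto simp: in_listset)
    have h: "?h q \<in> P" "map (\<lambda>p. p (?h q)) ps = map (\<lambda>f. f q) fs" if "q \<in> Q" for q
    proof -
      have hq: "?h q = ?inv (map (\<lambda>f. f q) fs)" using that by simp
      show "?h q \<in> P"
        unfolding hq by (rule bij_betw_apply[OF bij_betw_inv_into[OF bij] fq[OF that]])
      show "map (\<lambda>p. p (?h q)) ps = map (\<lambda>f. f q) fs"
        unfolding hq by (rule bij_betw_inv_into_right[OF bij fq[OF that]])
    qed
    have "compose Q (ps ! i) ?h = fs ! i" if i: "i < length As" for i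
    proof (rule extensionalityI[of _ Q])
      show "fs ! i \<in> extensional Q" using fs(2) i by (simp add: PiE_iff)
      fix q assume q: "q \<in> Q"
      have "(ps ! i) (?h q) = (fs ! i) q"
        using arg_cong[OF h(2)[OF q], of "\<lambda>zs. zs ! i"] i fs(1) len by (simp del: restrict_apply)
      then show "compose Q (ps ! i) ?h q = (fs ! i) q"
        using q by (simp add: compose_eq)
    qed (simp add: compose_def)
    moreover have "?h \<in> Q \<rightarrow>\<^sub>E P" using h(1) by auto
    ultimately show "?h \<in> Q \<rightarrow>\<^sub>E P \<and> (\<forall>i<length As. compose Q (ps ! i) ?h = fs ! i)"
      by blast
    fix g assume g: "g \<in> Q \<rightarrow>\<^sub>E P \<and> (\<forall>i<length As. compose Q (ps ! i) g = fs ! i)"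
    show "g = ?h"
    proof (rule extensionalityI[of _ Q])
      show "g \<in> extensional Q" using g by (simp add: PiE_iff)
      fix q assume q: "q \<in> Q"
      have "map (\<lambda>p. p (g q)) ps = map (\<lambda>f. f q) fs"
      proof (rule nth_equalityI)
        fix i assume "i < length (map (\<lambda>p. p (g q)) ps)"
        then have i: "i < length As" by (simp add: len)
        then have "compose Q (ps ! i) g q = (fs ! i) q"
          using g by (elim conjE allE[of _ i]) simp
        then show "map (\<lambda>p. p (g q)) ps ! i = map (\<lambda>f. f q) fs ! i"
          using i q fs(1) len by (simp add: compose_eq)
      qed (simp add: fs(1) len)
      moreover have "?inv (map (\<lambda>p. p (g q)) ps) = g q"
        using q g by (intro bij_betw_inv_into_left[OF bij]) (simp add: PiE_iff)
      ultimately show "g q = ?h q"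
        using q by simp
    qed simp
  qed
  note univ = this
  have "\<forall>Q\<in>U. \<forall>fs. length fs = length As \<and> (\<forall>i<length As. fs ! i \<in> Q \<rightarrow>\<^sub>E As ! i) \<longrightarrow>
      (\<exists>!h. h \<in> Q \<rightarrow>\<^sub>E P \<and> (\<forall>i<length As. compose Q (ps ! i) h = fs ! i))"
    by (intro ballI allI impI, elim conjE) (rule univ)
  with rhs show "is_product (Set_cat U) As P ps"
    unfolding is_product_def Set_cat_sel by (elim conjE) (intro conjI)
qed

lemma universe_singleton: "universe_of_sets U \<Longrightarrow> \<exists>u. {u} \<in> U"
  by (simp add: universe_of_sets_def)

text \<open>The axioms of a clone involve finitely many elements at a time. Hence they hold in \<open>B\<close> as
  soon as finitely many elements of \<open>B\<close> always lie in the image of some clone.\<close>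

lemma clone_transfer:
  assumes cover: "\<And>p ks xs q ys r zs. xs \<in> metas B p ks \<Longrightarrow> set ys \<subseteq> elts B q \<Longrightarrow> set zs \<subseteq> elts B r \<Longrightarrow>
    \<exists>(A :: ('o, 'a) clone_ops) h xs' ys' zs'. clone S A \<and> is_clone_hom S A B h \<and>
      xs' \<in> metas A p ks \<and> set ys' \<subseteq> elts A q \<and> set zs' \<subseteq> elts A r \<and>
      xs = map2 (\<lambda>k x. h (p + k) x) ks xs' \<and> ys = map (h q) ys' \<and> zs = map (h r) zs'"
  shows "clone S B"
proof
  \<comment> \<open>\<open>nil\<close> fills the lists that a law does not mention;
    \<open>single\<close> passes an element whose stage may differ from those of the other
    lists.\<close>
  have nil: "[] \<in> metas B 0 []" "set [] \<subseteq> elts B 0"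
    by (simp_all add: in_metas)
  have single: "[x] \<in> metas B 0 [m]" if "x \<in> elts B m" for x m
    using that by (simp add: in_metas)
  {
  fix j q :: nat assume j: "j < q"
  from cover[OF nil(1) nil(2) nil(2)] obtain A :: "('o, 'a) clone_ops" and h
    where A: "clone S A" and h: "is_clone_hom S A B h" by (elim exE conjE) (rule that)
  then show "vbl B q j \<in> elts B q"
    using clone.vbl_in[OF A j] j by (metis is_clone_hom_def)
  }
  {
  fix x ys q assume "x \<in> elts B (length ys)" "set ys \<subseteq> elts B q"
  from cover[OF single[OF this(1)] this(2) nil(2)] obtain A :: "('o, 'a) clone_ops" and h xs' ys'
    where A: "clone S A" and h: "is_clone_hom S A B h" and xs': "xs' \<in> metas A 0 [length ys]"
      "set ys' \<subseteq> elts A q" "[x] = map2 (\<lambda>k x. h (0 + k) x) [length ys] xs'" "ys = map (h q) ys'"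
    by (elim exE conjE) (rule that)
  then obtain x' where x': "x' \<in> elts A (length ys')" "x = h (length ys') x'"
    by (cases xs') (auto simp: in_metas)
  have "h q (plug A q x' ys') = plug B q x ys"
    using h x' xs' by (simp add: is_clone_hom_def)
  then show "plug B q x ys \<in> elts B q"
    using clone.plug_in[OF A x'(1) xs'(2)] h by (metis is_clone_hom_def)
  }
  {
  fix f xs p assume f: "f \<in> operators S" and "xs \<in> metas B p (arity S f)"
  from cover[OF this(2) nil(2) nil(2)] obtain A :: "('o, 'a) clone_ops" and h xs'
    where A: "clone S A" and h: "is_clone_hom S A B h" and xs': "xs' \<in> metas A p (arity S f)"
      "xs = map2 (\<lambda>k x. h (p + k) x) (arity S f) xs'"
    by (elim exE conjE) (rule that)
  have "h p (opr A f p xs') = opr B f p xs"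
    using h f xs' by (simp add: is_clone_hom_def)
  then show "opr B f p xs \<in> elts B p"
    using clone.opr_in[OF A f xs'(1)] h by (metis is_clone_hom_def)
  }
  {
  fix j q and ys :: "'b list" assume j: "j < length ys" and "set ys \<subseteq> elts B q"
  from cover[OF nil(1) this(2) nil(2)] obtain A :: "('o, 'a) clone_ops" and h ys'
    where A: "clone S A" and h: "is_clone_hom S A B h"
      and ys': "set ys' \<subseteq> elts A q" "ys = map (h q) ys'"
    by (elim exE conjE) (rule that)
  have "h q (plug A q (vbl A (length ys') j) ys') = plug B q (vbl B (length ys) j) ys"
    using h ys' j clone.vbl_in[OF A, of j "length ys'"] by (simp add: is_clone_hom_def)
  then show "plug B q (vbl B (length ys) j) ys = ys ! j"
    using clone.plug_vbl[OF A, of j ys' q] ys' j by simp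
  }
  {
  fix x q assume "x \<in> elts B q"
  then have "set [x] \<subseteq> elts B q" by simp
  from cover[OF nil(1) this nil(2)] obtain A :: "('o, 'a) clone_ops" and h ys'
    where A: "clone S A" and h: "is_clone_hom S A B h"
      and ys': "set ys' \<subseteq> elts A q" "[x] = map (h q) ys'"
    by (elim exE conjE) (rule that)
  then obtain x' where x': "x' \<in> elts A q" "x = h q x'"
    by (cases ys') auto
  have "h q (plug A q x' (vbls A q 0 q)) = plug B q x (vbls B q 0 q)"
    using h x' clone.vbls_in[OF A, of q q 0] clone.hom_vbls[OF A h, of q q 0] by (simp add: is_clone_hom_def)
  then show "plug B q x (vbls B q 0 q) = x"
    using clone.plug_vbls[OF A x'(1)] x' by simp
  }
  {
  fix x ys zs r
  assume "x \<in> elts B (length ys)" "set ys \<subseteq> elts B (length zs)" "set zs \<subseteq> elts B r"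
  from cover[OF single[OF this(1)] this(2,3)] obtain A :: "('o, 'a) clone_ops" and h xs' ys' zs'
    where A: "clone S A" and h: "is_clone_hom S A B h" and xs': "xs' \<in> metas A 0 [length ys]"
      "set ys' \<subseteq> elts A (length zs)" "set zs' \<subseteq> elts A r"
      "[x] = map2 (\<lambda>k x. h (0 + k) x) [length ys] xs'" "ys = map (h (length zs)) ys'" "zs = map (h r) zs'"
    by (elim exE conjE) (rule that)
  then obtain x' where x': "x' \<in> elts A (length ys')" "x = h (length ys') x'"
    by (cases xs') (auto simp: in_metas)
  have in1: "plug A (length zs') x' ys' \<in> elts A (length zs')"
    using clone.plug_in[OF A x'(1), of "length zs'"] xs' by simp
  have in2: "set (map (\<lambda>y. plug A r y zs') ys') \<subseteq> elts A r"
    using clone.plug_in[OF A _ xs'(3)] xs' by auto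
  have 1: "h r (plug A r (plug A (length zs') x' ys') zs') = plug B r (plug B (length zs) x ys) zs"
    using h x' xs' in1 by (simp add: is_clone_hom_def)
  have 2: "h r (plug A r x' (map (\<lambda>y. plug A r y zs') ys')) = plug B r x (map (h r) (map (\<lambda>y. plug A r y zs') ys'))"
    using h x' xs' in2 by (simp add: is_clone_hom_def)
  have 3: "map (h r) (map (\<lambda>y. plug A r y zs') ys') = map (\<lambda>y. plug B r y zs) ys"
    using h xs' by (auto simp: is_clone_hom_def)
  show "plug B r (plug B (length zs) x ys) zs = plug B r x (map (\<lambda>y. plug B r y zs) ys)"
    unfolding 1[symmetric] 3[symmetric] 2[symmetric] using clone.plug_plug[OF A x'(1) _ xs'(3)] xs' by simp
  }
  {
  fix f xs ys p
  assume f: "f \<in> operators S" and "xs \<in> metas B (length ys) (arity S f)" "set ys \<subseteq> elts B p"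
  from cover[OF this(2,3) nil(2)] obtain A :: "('o, 'a) clone_ops" and h xs' ys'
    where A: "clone S A" and h: "is_clone_hom S A B h" and xs': "xs' \<in> metas A (length ys) (arity S f)"
      "set ys' \<subseteq> elts A p" "xs = map2 (\<lambda>k x. h (length ys + k) x) (arity S f) xs'" "ys = map (h p) ys'"
    by (elim exE conjE) (rule that)
  let ?zs = "map2 (\<lambda>k x. plug A (p + k) x (lift A p k ys')) (arity S f) xs'"
  have lift: "set (lift A p k ys') \<subseteq> elts A (p + k)" for k
    by (rule clone.lift_in[OF A xs'(2)])
  have zs: "?zs \<in> metas A p (arity S f)"
    using xs' lift by (auto simp: in_metas intro!: clone.plug_in[OF A])
  have "h p (plug A p (opr A f (length ys') xs') ys') = plug B p (opr B f (length ys) xs) ys"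
    using h f xs' clone.opr_in[OF A f, of xs' "length ys'"] by (simp add: is_clone_hom_def)
  moreover have "h p (opr A f p ?zs) = opr B f p (map2 (\<lambda>k x. h (p + k) x) (arity S f) ?zs)"
    using h f zs by (simp add: is_clone_hom_def)
  moreover have "map2 (\<lambda>k x. h (p + k) x) (arity S f) ?zs =
      map2 (\<lambda>k x. plug B (p + k) x (lift B p k ys)) (arity S f) xs"
  proof (rule nth_equalityI)
    fix i assume "i < length (map2 (\<lambda>k x. h (p + k) x) (arity S f) ?zs)"
    then have i: "i < length (arity S f)" "i < length xs'" by simp_all
    then have "xs' ! i \<in> elts A (length ys + arity S f ! i)"
      using xs'(1) by (simp add: in_metas)
    then have "h (p + arity S f ! i) (plug A (p + arity S f ! i) (xs' ! i) (lift A p (arity S f ! i) ys')) =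
        plug B (p + arity S f ! i) (h (length ys + arity S f ! i) (xs' ! i)) (lift B p (arity S f ! i) ys)"
      using h lift xs' clone.hom_lift[OF A h xs'(2)] by (simp add: is_clone_hom_def)
    then show "map2 (\<lambda>k x. h (p + k) x) (arity S f) ?zs ! i =
        map2 (\<lambda>k x. plug B (p + k) x (lift B p k ys)) (arity S f) xs ! i"
      using i xs'(3) by simp
  qed (simp add: xs'(3))
  ultimately show "plug B p (opr B f (length ys) xs) ys =
      opr B f p (map2 (\<lambda>k x. plug B (p + k) x (lift B p k ys)) (arity S f) xs)"
    using clone.plug_opr[OF A f, of xs' ys' p] xs' by simp
  }
qed

section \<open>The clone of a cartesian functor\<close>

context presentation
begin

text \<open>\<open>tup F ms\<close> is the comparison of \<open>F ms\<close> with the product of the sets \<open>F [m]\<close>; \<open>untup\<close> is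
  its inverse (only for cartesian \<open>F\<close>).\<close>

definition tup :: "(nat list, 'o trm set list, 'u set, 'u \<Rightarrow> 'u) ftor \<Rightarrow> nat list \<Rightarrow> 'u \<Rightarrow> 'u list" where
  "tup F ms x = map (\<lambda>i. fmap F ms [ms ! i] [cls ms (ms ! i) (gens ms ! i)] x) [0..<length ms]"

definition untup :: "(nat list, 'o trm set list, 'u set, 'u \<Rightarrow> 'u) ftor \<Rightarrow> nat list \<Rightarrow> 'u list \<Rightarrow> 'u" where
  "untup F ms = inv_into (fobj F ms) (tup F ms)"

text \<open>The action of the class of \<open>t\<close> on tuples from the sets
  \<open>F [m]\<close>. By \<open>denote_C\<close> it turns out to be the denotation of
  \<open>t\<close> in \<open>ftor_clone F\<close>.\<close>

definition sem ::
  "(nat list, 'o trm set list, 'u set, 'u \<Rightarrow> 'u) ftor \<Rightarrow> nat list \<Rightarrow> nat \<Rightarrow> 'o trm \<Rightarrow> 'u list \<Rightarrow> 'u" where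
  "sem F \<Theta> n t \<xi> = fmap F \<Theta> [n] [cls \<Theta> n t] (untup F \<Theta> \<xi>)"

definition ftor_clone :: "(nat list, 'o trm set list, 'u set, 'u \<Rightarrow> 'u) ftor \<Rightarrow> ('o, 'u) clone_ops" where
  "ftor_clone F = \<lparr>elts = (\<lambda>n. fobj F [n]),
     vbl = (\<lambda>n j. sem F [] n (Var j) []),
     plug = (\<lambda>q x ys. sem F (length ys # replicate (length ys) q) q (plug_term (length ys) q) (x # ys)),
     opr = (\<lambda>f p xs. sem F (map ((+) p) (arity S f)) p (opr_term S f p) xs)\<rparr>"

lemma elts_ftor_clone [simp]: "elts (ftor_clone F) n = fobj F [n]"
  by (simp add: ftor_clone_def)

abbreviation proj :: "nat list \<Rightarrow> nat \<Rightarrow> 'o trm set list" where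
  "proj ms i \<equiv> [cls ms (ms ! i) (gens ms ! i)]"

lemma cls_in_hom: "wf_trm S \<Theta> n t \<Longrightarrow> [cls \<Theta> n t] \<in> hom M \<Theta> [n]"
  using classes_in_hom[of "[t]" \<Theta> "[n]"] by (simp add: in_metas_term_clone)

lemma hom_M_single_E:
  assumes "f \<in> hom M \<Theta> [n]"
  obtains t where "wf_trm S \<Theta> n t" "f = [cls \<Theta> n t]"
proof -
  from assms obtain ts where "ts \<in> metas (T \<Theta>) 0 [n]" "f = classes \<Theta> [n] ts"
    by (rule hom_M_E)
  then show ?thesis
    using that by (cases ts) (auto simp: in_metas_term_clone)
qed

lemma cmp_cls_classes:
  "wf_trm S ms n t \<Longrightarrow> ss \<in> metas (T ls) 0 ms \<Longrightarrow>
   cmp M ls ms [n] [cls ms n t] (classes ls ms ss) = [cls ls n (denote (T ls) 0 ss n t)]"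
  using cmp_classes[of "[t]" ms "[n]" ss ls] by (simp add: in_metas_term_clone)

lemma cmp_proj:
  "i < length ms \<Longrightarrow> ss \<in> metas (T ls) 0 ms \<Longrightarrow>
   cmp M ls ms [ms ! i] (proj ms i) (classes ls ms ss) = [cls ls (ms ! i) (ss ! i)]"
  by (simp add: cmp_cls_classes wf_gens clone.denote_gen[OF clone_term_clone])

text \<open>A morphism into \<open>ms\<close> is a tuple of classes, and composing with the
  \<open>i\<close>-th component of the identity extracts its \<open>i\<close>-th entry. Preservation
  of this product is what makes \<open>tup\<close> bijective.\<close>

lemma is_product_M:
  "is_product M (map (\<lambda>m. [m]) ms) ms (map (\<lambda>i. proj ms i) [0..<length ms])"
proof -
  have "\<exists>!h. h \<in> hom M ls ms \<and> (\<forall>i<length ms. cmp M ls ms [ms ! i] (proj ms i) h = fs ! i)"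
    if fs: "\<forall>i<length ms. fs ! i \<in> hom M ls [ms ! i]" for ls fs
  proof -
    have "\<forall>i<length ms. \<exists>t. wf_trm S ls (ms ! i) t \<and> fs ! i = [cls ls (ms ! i) t]"
      using fs by (blast elim: hom_M_single_E)
    then obtain t where t: "\<forall>i<length ms. wf_trm S ls (ms ! i) (t i) \<and> fs ! i = [cls ls (ms ! i) (t i)]"
      by metis
    let ?ts = "map t [0..<length ms]"
    have ts: "?ts \<in> metas (T ls) 0 ms"
      using t by (simp add: in_metas_term_clone)
    show ?thesis
    proof (rule ex1I)
      show "classes ls ms ?ts \<in> hom M ls ms \<and>
          (\<forall>i<length ms. cmp M ls ms [ms ! i] (proj ms i) (classes ls ms ?ts) = fs ! i)"
        using t ts by (simp add: classes_in_hom cmp_proj)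
      fix h assume h: "h \<in> hom M ls ms \<and>
          (\<forall>i<length ms. cmp M ls ms [ms ! i] (proj ms i) h = fs ! i)"
      then obtain ss where ss: "ss \<in> metas (T ls) 0 ms" "h = classes ls ms ss"
        by (auto elim: hom_M_E)
      then show "h = classes ls ms ?ts"
        using h t by (auto simp: cmp_proj in_metas_term_clone intro!: nth_equalityI)
    qed
  qed
  moreover have "proj ms i \<in> hom M ms [ms ! i]" if "i < length ms" for i
    by (rule cls_in_hom[OF wf_gens[OF that]])
  ultimately show ?thesis
    by (simp add: is_product_def)
qed

end

locale functorial_model = presentation S E for S :: "'o signature" and E +
  fixes U :: "'u set set" and F :: "(nat list, 'o trm set list, 'u set, 'u \<Rightarrow> 'u) ftor"
  assumes universe: "universe_of_sets U"
    and is_functor: "is_functor M (Set_cat U) F"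
    and cartesian: "preserves_finite_products M (Set_cat U) F"
begin

lemma fmap_in: "f \<in> hom M ms ns \<Longrightarrow> x \<in> fobj F ms \<Longrightarrow> fmap F ms ns f x \<in> fobj F ns"
  using functor_fmap[OF is_functor, of ms ns] by (auto dest!: PiE_mem)

lemma fmap_cmp:
  "f \<in> hom M ls ms \<Longrightarrow> g \<in> hom M ms ns \<Longrightarrow> x \<in> fobj F ls \<Longrightarrow>
   fmap F ls ns (cmp M ls ms ns g f) x = fmap F ms ns g (fmap F ls ms f x)"
  using functor_cmp[OF is_functor, of ls ms ns f g] by (simp add: compose_eq)

text \<open>Cartesianness applied to the cone of \<open>is_product_M\<close> and read in sets
  through \<open>is_product_Set_cat_iff\<close>.\<close>

lemma bij_tup: "bij_betw (tup F ms) (fobj F ms) (metas (ftor_clone F) 0 ms)"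
proof -
  obtain u where u: "{u} \<in> U" using universe_singleton[OF universe] by blast
  let ?ps = "map (\<lambda>i. fmap F ms [ms ! i] (proj ms i)) [0..<length ms]"
  have ps: "map2 (fmap F ms) (map (\<lambda>m. [m]) ms) (map (\<lambda>i. proj ms i) [0..<length ms]) = ?ps"
    by (rule nth_equalityI) simp_all
  have "is_product (Set_cat U) (map (fobj F) (map (\<lambda>m. [m]) ms)) (fobj F ms) ?ps"
    unfolding ps[symmetric]
    by (rule cartesian[unfolded preserves_finite_products_def, rule_format, OF is_product_M])
  moreover have "(\<lambda>x. map (\<lambda>p. p x) ?ps) = tup F ms"
    by (simp add: fun_eq_iff tup_def)
  ultimately show ?thesis
    unfolding is_product_Set_cat_iff[OF u] by (simp add: metas_def comp_def)
qed

lemma untup_in: "\<xi> \<in> metas (ftor_clone F) 0 ms \<Longrightarrow> untup F ms \<xi> \<in> fobj F ms"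
  unfolding untup_def by (rule bij_betw_apply[OF bij_betw_inv_into[OF bij_tup]])

lemma tup_untup: "\<xi> \<in> metas (ftor_clone F) 0 ms \<Longrightarrow> tup F ms (untup F ms \<xi>) = \<xi>"
  unfolding untup_def by (rule bij_betw_inv_into_right[OF bij_tup])

lemma untup_tup: "x \<in> fobj F ms \<Longrightarrow> untup F ms (tup F ms x) = x"
  unfolding untup_def by (rule bij_betw_inv_into_left[OF bij_tup])

lemma sem_in: "wf_trm S \<Theta> n t \<Longrightarrow> \<xi> \<in> metas (ftor_clone F) 0 \<Theta> \<Longrightarrow> sem F \<Theta> n t \<xi> \<in> fobj F [n]"
  unfolding sem_def by (intro fmap_in cls_in_hom untup_in)

lemma sem_gen: "\<xi> \<in> metas (ftor_clone F) 0 \<Theta> \<Longrightarrow> i < length \<Theta> \<Longrightarrow> sem F \<Theta> (\<Theta> ! i) (gens \<Theta> ! i) \<xi> = \<xi> ! i"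
  using arg_cong[OF tup_untup, of \<xi> \<Theta> "\<lambda>xs. xs ! i"] by (simp add: sem_def tup_def)

lemma fmap_untup:
  assumes ts: "ts \<in> metas (T \<Theta>) 0 ns" and \<xi>: "\<xi> \<in> metas (ftor_clone F) 0 \<Theta>"
  shows "fmap F \<Theta> ns (classes \<Theta> ns ts) (untup F \<Theta> \<xi>) = untup F ns (map2 (\<lambda>n t. sem F \<Theta> n t \<xi>) ns ts)"
proof -
  let ?y = "fmap F \<Theta> ns (classes \<Theta> ns ts) (untup F \<Theta> \<xi>)"
  have hom: "classes \<Theta> ns ts \<in> hom M \<Theta> ns" by (rule classes_in_hom[OF ts])
  have y: "?y \<in> fobj F ns" by (rule fmap_in[OF hom untup_in[OF \<xi>]])
  have "tup F ns ?y = map2 (\<lambda>n t. sem F \<Theta> n t \<xi>) ns ts"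
  proof (rule nth_equalityI)
    fix i assume "i < length (tup F ns ?y)"
    then have i: "i < length ns" by (simp add: tup_def)
    have "tup F ns ?y ! i = fmap F ns [ns ! i] (proj ns i) ?y"
      using i by (simp add: tup_def)
    also have "\<dots> = fmap F \<Theta> [ns ! i] [cls \<Theta> (ns ! i) (ts ! i)] (untup F \<Theta> \<xi>)"
      using fmap_cmp[OF hom cls_in_hom[OF wf_gens[OF i]] untup_in[OF \<xi>]] cmp_proj[OF i ts] by simp
    finally show "tup F ns ?y ! i = map2 (\<lambda>n t. sem F \<Theta> n t \<xi>) ns ts ! i"
      using i ts by (simp add: sem_def in_metas_term_clone)
  qed (use ts in \<open>simp add: tup_def in_metas_term_clone\<close>)
  then show ?thesis using untup_tup[OF y] by simp
qed

text \<open>The class of the denotation is a composite in the classifying category, so this is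
  functoriality of \<open>F\<close> transported along \<open>untup\<close>.\<close>

lemma sem_denote:
  assumes t: "wf_trm S ms n t" and ss: "ss \<in> metas (T \<Theta>) 0 ms" and \<xi>: "\<xi> \<in> metas (ftor_clone F) 0 \<Theta>"
  shows "sem F \<Theta> n (denote (T \<Theta>) 0 ss n t) \<xi> = sem F ms n t (map2 (\<lambda>m s. sem F \<Theta> m s \<xi>) ms ss)"
proof -
  have "sem F \<Theta> n (denote (T \<Theta>) 0 ss n t) \<xi> =
      fmap F ms [n] [cls ms n t] (fmap F \<Theta> ms (classes \<Theta> ms ss) (untup F \<Theta> \<xi>))"
    unfolding sem_def cmp_cls_classes[OF t ss, symmetric]
    by (rule fmap_cmp[OF classes_in_hom[OF ss] cls_in_hom[OF t] untup_in[OF \<xi>]])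
  then show ?thesis
    by (simp add: sem_def[of F ms] fmap_untup[OF ss \<xi>])
qed

end

context functorial_model
begin

abbreviation C :: "('o, 'u) clone_ops" where
  "C \<equiv> ftor_clone F"

text \<open>The operations of \<open>ftor_clone F\<close> are \<open>sem\<close> of the terms that
  denote them, so the clauses for the operations are \<open>sem_denote\<close> at these
  terms.\<close>

lemma hom_sem:
  assumes \<xi>: "\<xi> \<in> metas C 0 \<Theta>"
  shows "is_clone_hom S (T \<Theta>) C (\<lambda>n t. sem F \<Theta> n t \<xi>)"
  unfolding is_clone_hom_def
proof (intro conjI allI ballI impI)
  fix n x assume "x \<in> elts (T \<Theta>) n"
  then show "sem F \<Theta> n x \<xi> \<in> elts C n"
    using \<xi> by (simp add: sem_in)
next
  fix n j :: nat assume "j < n"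
  then show "sem F \<Theta> n (vbl (T \<Theta>) n j) \<xi> = vbl C n j"
    using sem_denote[of "[]" n "Var j" "[]" \<Theta> \<xi>] \<xi>
    by (simp add: wf_Var in_metas_term_clone denote_def ftor_clone_def)
next
  fix q x ys assume x: "x \<in> elts (T \<Theta>) (length ys)" and ys: "set ys \<subseteq> elts (T \<Theta>) q"
  show "sem F \<Theta> q (plug (T \<Theta>) q x ys) \<xi> =
      plug C q (sem F \<Theta> (length ys) x \<xi>) (map (\<lambda>t. sem F \<Theta> q t \<xi>) ys)"
    using sem_denote[OF wf_plug_term Cons_in_metas[OF x ys] \<xi>] clone.denote_plug_term[OF clone_term_clone x ys]
    by (simp add: ftor_clone_def map2_replicate)
next
  fix f p xs assume f: "f \<in> operators S" and xs: "xs \<in> metas (T \<Theta>) p (arity S f)"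
  have "map2 (\<lambda>m s. sem F \<Theta> m s \<xi>) (map ((+) p) (arity S f)) xs =
      map2 (\<lambda>k t. sem F \<Theta> (p + k) t \<xi>) (arity S f) xs"
    using xs by (intro nth_equalityI) (simp_all add: in_metas_term_clone)
  then show "sem F \<Theta> p (opr (T \<Theta>) f p xs) \<xi> =
      opr C f p (map2 (\<lambda>k t. sem F \<Theta> (p + k) t \<xi>) (arity S f) xs)"
    using sem_denote[OF wf_opr_term[OF f] _ \<xi>, of xs p] clone.denote_opr_term[OF clone_term_clone xs] xs
    unfolding metas_shift by (simp add: ftor_clone_def)
qed

lemma clone_C: "clone S C"
proof (rule clone_transfer)
  fix p ks xs q ys r zs
  assume xs: "xs \<in> metas C p ks" and ys: "set ys \<subseteq> elts C q" and zs: "set zs \<subseteq> elts C r"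
  \<comment> \<open>One metavariable for each given element: arity \<open>p + k\<close> for the
    entries of \<open>xs\<close>, \<open>q\<close> for those of \<open>ys\<close> and
    \<open>r\<close> for those of \<open>zs\<close>. The generic terms over \<open>?\<Theta>\<close>
    are the required preimages under evaluation at \<open>?\<xi>\<close>.\<close>
  let ?\<Theta> = "map ((+) p) ks @ replicate (length ys) q @ replicate (length zs) r"
  let ?\<xi> = "xs @ ys @ zs"
  let ?l = "length ks" and ?m = "length ys"
  have len: "length xs = ?l" using xs by (simp add: in_metas)
  have \<xi>: "?\<xi> \<in> metas C 0 ?\<Theta>"
    using xs ys zs nth_mem[of _ ys] nth_mem[of _ zs]
    by (auto simp: in_metas nth_append subset_eq simp del: nth_mem)
  let ?g = "\<lambda>i. gens ?\<Theta> ! i"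
  have sem: "sem F ?\<Theta> (?\<Theta> ! i) (?g i) ?\<xi> = ?\<xi> ! i" "wf_trm S ?\<Theta> (?\<Theta> ! i) (?g i)" if "i < length ?\<Theta>" for i
    using sem_gen[OF \<xi> that] wf_gens[OF that] by blast+
  have 1: "sem F ?\<Theta> (p + ks ! i) (?g i) ?\<xi> = xs ! i" "wf_trm S ?\<Theta> (p + ks ! i) (?g i)" if "i < ?l" for i
    using sem[of i] that len by (simp_all add: nth_append)
  have 2: "sem F ?\<Theta> q (?g (?l + i)) ?\<xi> = ys ! i" "wf_trm S ?\<Theta> q (?g (?l + i))" if "i < ?m" for i
    using sem[of "?l + i"] that len by (simp_all add: nth_append)
  have 3: "sem F ?\<Theta> r (?g (?l + ?m + i)) ?\<xi> = zs ! i" "wf_trm S ?\<Theta> r (?g (?l + ?m + i))" if "i < length zs" for i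
    using sem[of "?l + ?m + i"] that len by (simp_all add: nth_append)
  have 4: "map ?g [0..<?l] \<in> metas (T ?\<Theta>) p ks"
    using 1(2) by (simp add: in_metas_term_clone)
  have 5: "set (map (\<lambda>i. ?g (?l + i)) [0..<?m]) \<subseteq> elts (T ?\<Theta>) q"
    using 2(2) by auto
  have 6: "set (map (\<lambda>i. ?g (?l + ?m + i)) [0..<length zs]) \<subseteq> elts (T ?\<Theta>) r"
    using 3(2) by auto
  have 7: "xs = map2 (\<lambda>k t. sem F ?\<Theta> (p + k) t ?\<xi>) ks (map ?g [0..<?l])"
    using 1(1) len by (intro nth_equalityI) simp_all
  have 8: "ys = map (\<lambda>t. sem F ?\<Theta> q t ?\<xi>) (map (\<lambda>i. ?g (?l + i)) [0..<?m])"
    using 2(1) by (intro nth_equalityI) simp_all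
  have 9: "zs = map (\<lambda>t. sem F ?\<Theta> r t ?\<xi>) (map (\<lambda>i. ?g (?l + ?m + i)) [0..<length zs])"
    using 3(1) by (intro nth_equalityI) simp_all
  show "\<exists>(A :: ('o, 'o trm) clone_ops) h xs' ys' zs'. clone S A \<and> is_clone_hom S A C h \<and>
      xs' \<in> metas A p ks \<and> set ys' \<subseteq> elts A q \<and> set zs' \<subseteq> elts A r \<and>
      xs = map2 (\<lambda>k x. h (p + k) x) ks xs' \<and> ys = map (h q) ys' \<and> zs = map (h r) zs'"
    by (rule exI[of _ "T ?\<Theta>"], rule exI[of _ "\<lambda>n t. sem F ?\<Theta> n t ?\<xi>"],
        rule exI[of _ "map ?g [0..<?l]"], rule exI[of _ "map (\<lambda>i. ?g (?l + i)) [0..<?m]"],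
        rule exI[of _ "map (\<lambda>i. ?g (?l + ?m + i)) [0..<length zs]"])
      (intro conjI clone_term_clone hom_sem[OF \<xi>] 4 5 6 7 8 9)
qed

sublocale C: clone S C
  by (rule clone_C)

text \<open>The homomorphism of \<open>hom_sem\<close> sends the generic valuation to
  \<open>\<xi>\<close>, and \<open>t\<close> is its own denotation at the generic valuation.\<close>

lemma denote_C:
  assumes t: "wf_trm S \<Theta> n t" and \<xi>: "\<xi> \<in> metas C 0 \<Theta>"
  shows "denote C 0 \<xi> n t = sem F \<Theta> n t \<xi>"
proof -
  have "sem F \<Theta> n (denote (T \<Theta>) 0 (gens \<Theta>) n t) \<xi> =
      denote C 0 (map2 (\<lambda>m s. sem F \<Theta> m s \<xi>) \<Theta> (gens \<Theta>)) n t"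
    using clone.denote_hom[OF clone_term_clone hom_sem[OF \<xi>] t gens_in_metas_0] by simp
  also have "map2 (\<lambda>m s. sem F \<Theta> m s \<xi>) \<Theta> (gens \<Theta>) = \<xi>"
    using \<xi> by (intro nth_equalityI) (simp_all add: in_metas sem_gen)
  finally show ?thesis by (simp add: denote_gens[OF t])
qed

text \<open>Equal classes have equal \<open>sem\<close>, which settles stage 0. Stage
  \<open>p\<close> is reached over the arities \<open>p + m\<close>, where
  \<open>derivable_param\<close> supplies the shifted equation.\<close>

lemma clone_satisfies_C:
  assumes "(\<Theta>, n, s, t) \<in> E"
  shows "clone_satisfies C (\<Theta>, n, s, t)"
  unfolding clone_satisfies_def prod.case
proof (intro allI ballI)
  fix p \<phi> assume \<phi>: "\<phi> \<in> metas C p \<Theta>"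
  let ?\<Theta> = "map ((+) p) \<Theta>"
  have \<phi>': "\<phi> \<in> metas C 0 ?\<Theta>"
    using \<phi> by (simp add: in_metas)
  have d: "derivable S E \<Theta> n s t"
    using assms by (rule derivable.axiom)
  have "map2 (\<lambda>m s. sem F ?\<Theta> (p + m) s \<phi>) \<Theta> (gens ?\<Theta>) = \<phi>"
    using \<phi> sem_gen[OF \<phi>'] by (intro nth_equalityI) (simp_all add: in_metas)
  then have *: "denote C p \<phi> n u = sem F ?\<Theta> (p + n) (denote (T ?\<Theta>) p (gens ?\<Theta>) n u) \<phi>"
    if "wf_trm S \<Theta> n u" for u
    using clone.denote_hom[OF clone_term_clone hom_sem[OF \<phi>'] that gens_in_metas] by simp
  have "cls ?\<Theta> (p + n) (denote (T ?\<Theta>) p (gens ?\<Theta>) n s) = cls ?\<Theta> (p + n) (denote (T ?\<Theta>) p (gens ?\<Theta>) n t)"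
    using derivable_param[OF d, of p] wf[OF derivable_param[OF d, of p]] by (simp add: cls_eq_iff)
  then show "denote C p \<phi> n s = denote C p \<phi> n t"
    using wf[OF d] by (simp add: * sem_def)
qed

end

section \<open>Natural transformations as clone homomorphisms\<close>

lemma nat_trans_in: "is_nat_trans A (Set_cat U) F G \<tau> \<Longrightarrow> a \<in> obj A \<Longrightarrow> x \<in> fobj F a \<Longrightarrow> \<tau> a x \<in> fobj G a"
  by (auto simp: is_nat_trans_def PiE_iff Pi_iff)

lemma nat_trans_fmap:
  assumes \<tau>: "is_nat_trans A (Set_cat U) F G \<tau>" and "a \<in> obj A" "b \<in> obj A" "f \<in> hom A a b" "x \<in> fobj F a"
  shows "\<tau> b (fmap F a b f x) = fmap G a b f (\<tau> a x)"
proof -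
  have "compose (fobj F a) (\<tau> b) (fmap F a b f) = compose (fobj F a) (fmap G a b f) (\<tau> a)"
    using assms by (simp add: is_nat_trans_def)
  then show ?thesis
    using assms(5) by (metis compose_eq)
qed

locale functorial_model_hom = F: functorial_model S E U F + G: functorial_model S E U G
  for S :: "'o signature" and E and U :: "'u set set" and F G +
  fixes \<tau> :: "nat list \<Rightarrow> 'u \<Rightarrow> 'u"
  assumes nat: "is_nat_trans (classifying_cat S E) (Set_cat U) F G \<tau>"
begin

lemma \<tau>_in: "x \<in> fobj F ms \<Longrightarrow> \<tau> ms x \<in> fobj G ms"
  using nat_trans_in[OF nat] by simp

lemma tup_\<tau>:
  assumes "x \<in> fobj F ms"
  shows "F.tup G ms (\<tau> ms x) = map2 (\<lambda>m. \<tau> [m]) ms (F.tup F ms x)"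
  using nat_trans_fmap[OF nat _ _ F.cls_in_hom[OF wf_gens] assms]
  by (intro nth_equalityI) (simp_all add: F.tup_def)

lemma map2_\<tau>_in: "\<xi> \<in> metas F.C 0 \<Theta> \<Longrightarrow> map2 (\<lambda>m. \<tau> [m]) \<Theta> \<xi> \<in> metas G.C 0 \<Theta>"
  by (simp add: in_metas \<tau>_in)

lemma \<tau>_untup:
  assumes \<xi>: "\<xi> \<in> metas F.C 0 \<Theta>"
  shows "\<tau> \<Theta> (F.untup F \<Theta> \<xi>) = F.untup G \<Theta> (map2 (\<lambda>m. \<tau> [m]) \<Theta> \<xi>)"
  using tup_\<tau>[OF F.untup_in[OF \<xi>]] G.untup_tup[OF \<tau>_in[OF F.untup_in[OF \<xi>]]] F.tup_untup[OF \<xi>] by simp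

lemma \<tau>_sem:
  assumes t: "wf_trm S \<Theta> n t" and \<xi>: "\<xi> \<in> metas F.C 0 \<Theta>"
  shows "\<tau> [n] (F.sem F \<Theta> n t \<xi>) = F.sem G \<Theta> n t (map2 (\<lambda>m. \<tau> [m]) \<Theta> \<xi>)"
  using nat_trans_fmap[OF nat _ _ F.cls_in_hom[OF t] F.untup_in[OF \<xi>]]
  by (simp add: F.sem_def \<tau>_untup[OF \<xi>])

lemma clone_hom_\<tau>: "is_clone_hom S F.C G.C (\<lambda>n. \<tau> [n])"
  by (rule F.C.clone_homI[OF G.clone_C])
    (simp_all add: \<tau>_in \<tau>_sem F.denote_C G.denote_C map2_\<tau>_in)

end

section \<open>Functorial models from algebraic models\<close>

text \<open>Products in the classifying category are concatenations, so a tuple over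
  \<open>concat mss\<close> has to be cut into blocks with the lengths of the lists in
  \<open>mss\<close>.\<close>

fun split_lists :: "'a list list \<Rightarrow> 'b list \<Rightarrow> 'b list list" where
  "split_lists [] ys = []"
| "split_lists (as # ass) ys = take (length as) ys # split_lists ass (drop (length as) ys)"

lemma length_split_lists [simp]: "length (split_lists ass ys) = length ass"
  by (induction ass arbitrary: ys) simp_all

lemma split_lists_concat: "map length yss = map length ass \<Longrightarrow> split_lists ass (concat yss) = yss"
  by (induction ass arbitrary: yss) (auto simp: map_eq_Cons_conv)

lemma map2_take: "map2 h (take n xs) (take n ys) = take n (map2 h xs ys)"
  by (simp add: take_map take_zip)

lemma map2_drop: "map2 h (drop n xs) (drop n ys) = drop n (map2 h xs ys)"
  by (simp add: drop_map drop_zip)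

lemma split_lists_map2:
  "map2 (map2 h) ass (split_lists ass ys) = split_lists ass (map2 h (concat ass) ys)"
  using map2_take[of h _ _ ys] map2_drop[of h _ _ ys]
proof (induction ass arbitrary: ys)
  case (Cons as ass)
  have "map2 h as (take (length as) ys) = take (length as) (map2 h (concat (as # ass)) ys)"
    using map2_take[of h "length as" "as @ concat ass" ys] by simp
  moreover have "map2 h (concat ass) (drop (length as) ys) = drop (length as) (map2 h (concat (as # ass)) ys)"
    using map2_drop[of h "length as" "as @ concat ass" ys] by simp
  moreover have "map2 (map2 h) ass (split_lists ass (drop (length as) ys)) =
      split_lists ass (map2 h (concat ass) (drop (length as) ys))"
    by (rule Cons.IH) (rule map2_take map2_drop)+
  ultimately show ?case by simp
qed simp

lemma map2_concat:
  "map length yss = map length ass \<Longrightarrow> map2 h (concat ass) (concat yss) = concat (map2 (map2 h) ass yss)"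
  by (induction ass arbitrary: yss) (auto simp: map_eq_Cons_conv)

text \<open>The position \<open>k\<close> stays existential, which avoids partial sums of block
  lengths; membership in \<open>metas\<close> asks only that entry and arity come from the same
  position.\<close>

lemma split_lists_nth:
  "length ys = length (concat ass) \<Longrightarrow> j < length ass \<Longrightarrow> i < length (ass ! j) \<Longrightarrow>
   \<exists>k<length (concat ass). concat ass ! k = ass ! j ! i \<and> split_lists ass ys ! j ! i = ys ! k"
proof (induction ass arbitrary: j ys)
  case (Cons as ass)
  show ?case
  proof (cases j)
    case 0
    then show ?thesis
      using Cons.prems by (intro exI[of _ i]) (auto simp: nth_append)
  next
    case (Suc j')
    have "\<exists>k<length (concat ass). concat ass ! k = ass ! j' ! i \<and>
        split_lists ass (drop (length as) ys) ! j' ! i = drop (length as) ys ! k"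
      using Cons.prems Suc by (intro Cons.IH) auto
    then obtain k where "k < length (concat ass)" "concat ass ! k = ass ! j' ! i"
      "split_lists ass (drop (length as) ys) ! j' ! i = drop (length as) ys ! k" by blast
    then show ?thesis
      using Cons.prems Suc by (intro exI[of _ "length as + k"]) (auto simp: nth_append)
  qed
qed simp

lemma length_nth_split_lists:
  "length ys = length (concat ass) \<Longrightarrow> j < length ass \<Longrightarrow> length (split_lists ass ys ! j) = length (ass ! j)"
  by (induction ass arbitrary: j ys) (auto simp: nth_Cons split: nat.splits)

section \<open>Codes for finite products inside the universe\<close>

lemma finite_product_in_universe:
  assumes U: "universe_of_sets U"
  shows "set As \<subseteq> U \<Longrightarrow> \<exists>P\<in>U. \<exists>f. bij_betw f P (listset As)"
proof (induction As)
  case Nil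
  obtain u where "{u} \<in> U" using universe_singleton[OF U] by blast
  moreover have "bij_betw (\<lambda>_. []) {u} (listset [])" by (simp add: bij_betw_def)
  ultimately show ?case by blast
next
  case (Cons A As)
  then obtain P f where P: "P \<in> U" and f: "bij_betw f P (listset As)" by auto
  have "A \<in> U" using Cons.prems by simp
  then obtain Q g where Q: "Q \<in> U" and g: "bij_betw g (A \<times> P) Q"
    using U P unfolding universe_of_sets_def by blast
  have "bij_betw (\<lambda>(a, p). a # f p) (A \<times> P) (listset (A # As))"
  proof (rule bij_betwI')
    fix x y assume "x \<in> A \<times> P" "y \<in> A \<times> P"
    then show "((case x of (a, p) \<Rightarrow> a # f p) = (case y of (a, p) \<Rightarrow> a # f p)) = (x = y)"
      using bij_betw_imp_inj_on[OF f] by (auto simp: inj_on_def)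
  next
    fix x assume "x \<in> A \<times> P"
    then show "(case x of (a, p) \<Rightarrow> a # f p) \<in> listset (A # As)"
      using bij_betw_apply[OF f] by (auto simp: set_Cons_def)
  next
    fix ys assume "ys \<in> listset (A # As)"
    then obtain a as where "ys = a # as" "a \<in> A" "as \<in> listset As" by (auto simp: set_Cons_def)
    then show "\<exists>x\<in>A \<times> P. ys = (case x of (a, p) \<Rightarrow> a # f p)"
      using bij_betw_imp_surj_on[OF f] by auto
  qed
  then have "bij_betw ((\<lambda>(a, p). a # f p) \<circ> inv_into (A \<times> P) g) Q (listset (A # As))"
    using bij_betw_inv_into[OF g] by (intro bij_betw_trans)
  then show ?case using Q by blast
qed

text \<open>Lists over \<open>'u\<close> are not elements of \<open>'u\<close>, so a product is
  represented by some member of \<open>U\<close> in bijection with the lists; \<open>dec\<close>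
  fixes one such bijection.\<close>

definition prodset :: "'u set set \<Rightarrow> 'u set list \<Rightarrow> 'u set" where
  "prodset U As = (SOME P. P \<in> U \<and> (\<exists>f. bij_betw f P (listset As)))"

definition dec :: "'u set set \<Rightarrow> 'u set list \<Rightarrow> 'u \<Rightarrow> 'u list" where
  "dec U As = (SOME f. bij_betw f (prodset U As) (listset As))"

lemma
  assumes "universe_of_sets U" "set As \<subseteq> U"
  shows prodset_in_universe: "prodset U As \<in> U"
    and bij_dec: "bij_betw (dec U As) (prodset U As) (listset As)"
proof -
  have "\<exists>P. P \<in> U \<and> (\<exists>f. bij_betw f P (listset As))"
    using finite_product_in_universe[OF assms] by blast
  from someI_ex[OF this] have *: "prodset U As \<in> U" "\<exists>f. bij_betw f (prodset U As) (listset As)"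
    by (simp_all add: prodset_def)
  show "prodset U As \<in> U" by (rule *(1))
  show "bij_betw (dec U As) (prodset U As) (listset As)"
    unfolding dec_def using *(2) by (rule someI_ex)
qed

section \<open>The functor of a clone that satisfies the axioms\<close>

locale clone_model = presentation S E + clone S B
  for S :: "'o signature" and E and B :: "('o, 'u) clone_ops" +
  fixes U :: "'u set set"
  assumes universe: "universe_of_sets U"
    and elts_in_universe: "elts B n \<in> U"
    and satisfies: "\<forall>eq\<in>E. clone_satisfies B eq"
begin

definition prodB :: "nat list \<Rightarrow> 'u set" where
  "prodB ms = prodset U (map (elts B) ms)"

definition decB :: "nat list \<Rightarrow> 'u \<Rightarrow> 'u list" where
  "decB ms = dec U (map (elts B) ms)"

definition encB :: "nat list \<Rightarrow> 'u list \<Rightarrow> 'u" where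
  "encB ms = inv_into (prodB ms) (decB ms)"

definition functor_of :: "(nat list, 'o trm set list, 'u set, 'u \<Rightarrow> 'u) ftor" where
  "functor_of = \<lparr>fobj = prodB,
     fmap = (\<lambda>ms ns. \<lambda>f\<in>hom M ms ns. \<lambda>x\<in>prodB ms.
       encB ns (map2 (\<lambda>n c. denote B 0 (decB ms x) n (SOME t. t \<in> c)) ns f))\<rparr>"

lemma fobj_functor_of [simp]: "fobj functor_of = prodB"
  by (simp add: functor_of_def)

lemma prodB_in_universe: "prodB ms \<in> U"
  unfolding prodB_def using universe by (rule prodset_in_universe) (auto simp: elts_in_universe)

lemma bij_decB: "bij_betw (decB ms) (prodB ms) (metas B 0 ms)"
  using bij_dec[OF universe, of "map (elts B) ms"] elts_in_universe
  by (auto simp: metas_def prodB_def decB_def)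

lemma decB_in: "x \<in> prodB ms \<Longrightarrow> decB ms x \<in> metas B 0 ms"
  by (rule bij_betw_apply[OF bij_decB])

lemma encB_in: "\<xi> \<in> metas B 0 ms \<Longrightarrow> encB ms \<xi> \<in> prodB ms"
  unfolding encB_def by (rule bij_betw_apply[OF bij_betw_inv_into[OF bij_decB]])

lemma decB_encB: "\<xi> \<in> metas B 0 ms \<Longrightarrow> decB ms (encB ms \<xi>) = \<xi>"
  unfolding encB_def by (rule bij_betw_inv_into_right[OF bij_decB])

lemma encB_decB: "x \<in> prodB ms \<Longrightarrow> encB ms (decB ms x) = x"
  unfolding encB_def by (rule bij_betw_inv_into_left[OF bij_decB])

lemma map2_denote_in_metas:
  assumes "ts \<in> metas (T ms) 0 ns" "\<xi> \<in> metas B 0 ms"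
  shows "map2 (denote B 0 \<xi>) ns ts \<in> metas B 0 ns"
  using assms(1) denote_in[OF _ assms(2)] by (simp add: in_metas)

text \<open>By soundness derivably equal terms have the same denotation, so the value does not
  depend on the representative that \<open>SOME\<close> picks.\<close>

lemma fmap_functor_of:
  assumes ts: "ts \<in> metas (T ms) 0 ns" and x: "x \<in> prodB ms"
  shows "fmap functor_of ms ns (classes ms ns ts) x = encB ns (map2 (denote B 0 (decB ms x)) ns ts)"
proof -
  have "denote B 0 (decB ms x) n (SOME u. u \<in> cls ms n t) = denote B 0 (decB ms x) n t"
    if t: "wf_trm S ms n t" for n t
  proof -
    have "t \<in> cls ms n t"
      using t by (simp add: eq_class_def derivable.refl)
    then have "(SOME u. u \<in> cls ms n t) \<in> cls ms n t"
      by (rule someI)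
    then show ?thesis
      using soundness[OF presentation satisfies _ decB_in[OF x]] by (simp add: eq_class_def)
  qed
  then have "map2 (\<lambda>n c. denote B 0 (decB ms x) n (SOME t. t \<in> c)) ns (classes ms ns ts) =
      map2 (denote B 0 (decB ms x)) ns ts"
    using ts by (intro nth_equalityI) (simp_all add: in_metas_term_clone)
  then show ?thesis
    using x classes_in_hom[OF ts] by (simp add: functor_of_def)
qed

lemma decB_fmap:
  "ts \<in> metas (T ms) 0 ns \<Longrightarrow> x \<in> prodB ms \<Longrightarrow>
   decB ns (fmap functor_of ms ns (classes ms ns ts) x) = map2 (denote B 0 (decB ms x)) ns ts"
  by (simp add: fmap_functor_of decB_encB map2_denote_in_metas decB_in)

lemma fmap_functor_of_in:
  assumes "f \<in> hom M ms ns" "x \<in> prodB ms"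
  shows "fmap functor_of ms ns f x \<in> prodB ns"
  using assms by (auto elim!: hom_M_E simp: fmap_functor_of intro!: encB_in map2_denote_in_metas decB_in)

lemma fmap_functor_of_cmp:
  assumes "f \<in> hom M ls ms" "g \<in> hom M ms ns" and x: "x \<in> prodB ls"
  shows "fmap functor_of ls ns (cmp M ls ms ns g f) x = fmap functor_of ms ns g (fmap functor_of ls ms f x)"
proof -
  from assms obtain ss ts where ss: "ss \<in> metas (T ls) 0 ms" "f = classes ls ms ss"
    and ts: "ts \<in> metas (T ms) 0 ns" "g = classes ms ns ts"
    by (auto elim!: hom_M_E)
  have "map2 (denote B 0 (decB ls x)) ns (map2 (denote (T ls) 0 ss) ns ts) =
     map2 (denote B 0 (map2 (denote B 0 (decB ls x)) ms ss)) ns ts"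
    using denote_denote[OF _ ss(1) decB_in[OF x]] ts(1)
    by (intro nth_equalityI) (simp_all add: in_metas_term_clone)
  then show ?thesis
    using ss ts x fmap_functor_of_in[OF assms(1) x]
    by (simp add: cmp_classes fmap_functor_of map2_denote_in decB_encB map2_denote_in_metas decB_in encB_in)
qed

lemma is_functor_functor_of: "is_functor M (Set_cat U) functor_of"
proof -
  have hom: "fmap functor_of ms ns f \<in> prodB ms \<rightarrow>\<^sub>E prodB ns" if "f \<in> hom M ms ns" for ms ns f
    using fmap_functor_of_in[OF that] that by (auto simp: functor_of_def)
  have ext: "fmap functor_of ms ns \<in> extensional (hom M ms ns)" for ms ns
    by (simp add: functor_of_def)
  have idt: "fmap functor_of ms ms (idt M ms) = (\<lambda>x\<in>prodB ms. x)" for ms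
  proof (rule extensionalityI[of _ "prodB ms"])
    have "idt M ms \<in> hom M ms ms"
      unfolding idt_M by (rule classes_in_hom[OF gens_in_metas_0])
    from hom[OF this] show "fmap functor_of ms ms (idt M ms) \<in> extensional (prodB ms)"
      by (simp add: PiE_iff)
    fix x assume x: "x \<in> prodB ms"
    then show "fmap functor_of ms ms (idt M ms) x = (\<lambda>x\<in>prodB ms. x) x"
      unfolding idt_M fmap_functor_of[OF gens_in_metas_0 x] map2_denote_gens[OF decB_in[OF x]]
      by (simp add: encB_decB)
  qed simp
  have cmp: "fmap functor_of ls ns (cmp M ls ms ns g f) =
      compose (prodB ls) (fmap functor_of ms ns g) (fmap functor_of ls ms f)"
    if f: "f \<in> hom M ls ms" and g: "g \<in> hom M ms ns" for ls ms ns f g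
  proof (rule extensionalityI[of _ "prodB ls"])
    have "cmp M ls ms ns g f \<in> hom M ls ns"
      using category_M f g by (simp add: is_category_def)
    from hom[OF this] show "fmap functor_of ls ns (cmp M ls ms ns g f) \<in> extensional (prodB ls)"
      by (simp add: PiE_iff)
    show "compose (prodB ls) (fmap functor_of ms ns g) (fmap functor_of ls ms f) \<in> extensional (prodB ls)"
      by (simp add: compose_def)
    fix x assume "x \<in> prodB ls"
    then show "fmap functor_of ls ns (cmp M ls ms ns g f) x =
        compose (prodB ls) (fmap functor_of ms ns g) (fmap functor_of ls ms f) x"
      using fmap_functor_of_cmp[OF f g] by (simp add: compose_eq)
  qed
  show ?thesis
    unfolding is_functor_def obj_M Set_cat_sel fobj_functor_of
    using category_M category_Set_cat prodB_in_universe hom ext idt cmp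
    by (auto simp: PiE_iff extensional_def)
qed

end

section \<open>Blocks of valuations and preservation of finite products\<close>

lemma split_lists_in_metas:
  assumes "\<xi> \<in> metas A p (concat mss)" "j < length mss"
  shows "split_lists mss \<xi> ! j \<in> metas A p (mss ! j)"
  using assms split_lists_nth[of \<xi> mss j] length_nth_split_lists[of \<xi> mss j]
  by (fastforce simp: in_metas)

lemma concat_in_metas:
  "list_all2 (\<lambda>ms xs. xs \<in> metas A p ms) mss xss \<Longrightarrow> concat xss \<in> metas A p (concat mss)"
proof (induction rule: list_all2_induct)
  case (Cons ms mss xs xss)
  then show ?case by (auto simp: in_metas nth_append)
qed (simp add: in_metas)

text \<open>The blocks of \<open>gens (concat mss)\<close> act as the projections of the
  concatenation onto its factors: this is \<open>map2_denote_gens\<close> read blockwise, as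
  splitting commutes with \<open>map2\<close>.\<close>

lemma (in clone) map2_denote_split_gens:
  assumes \<phi>: "\<phi> \<in> metas A 0 (concat mss)" and j: "j < length mss"
  shows "map2 (denote A 0 \<phi>) (mss ! j) (split_lists mss (gens (concat mss)) ! j) = split_lists mss \<phi> ! j"
proof -
  have "map2 (map2 (denote A 0 \<phi>)) mss (split_lists mss (gens (concat mss))) = split_lists mss \<phi>"
    unfolding split_lists_map2 map2_denote_gens[OF \<phi>] ..
  then have "map2 (map2 (denote A 0 \<phi>)) mss (split_lists mss (gens (concat mss))) ! j = split_lists mss \<phi> ! j"
    by simp
  then show ?thesis using j by simp
qed

lemma is_product_ex1:
  assumes "is_product C as P ps" "Q \<in> obj C" "length fs = length as"
    "\<forall>i<length as. fs ! i \<in> hom C Q (as ! i)"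
  shows "\<exists>!h. h \<in> hom C Q P \<and> (\<forall>i<length as. cmp C Q P (as ! i) (ps ! i) h = fs ! i)"
  using assms unfolding is_product_def by (elim conjE) (drule (1) bspec, simp)

context clone_model
begin

text \<open>
  The object \<open>?D = concat mss\<close> is a product of \<open>mss\<close> by its projections \<open>?q j\<close>, and \<open>?u\<close>, \<open>v\<close>
  compare it with \<open>P\<close>. A tuple over \<open>mss\<close> decodes to one list over \<open>?D\<close>, which \<open>v\<close> takes to \<open>P\<close>.
\<close>

lemma bij_functor_of_product:
  assumes prod: "is_product M mss P ps"
  shows "bij_betw (\<lambda>x. map (\<lambda>j. fmap functor_of P (mss ! j) (ps ! j) x) [0..<length mss])
    (prodB P) (listset (map prodB mss))"
proof -
  let ?D = "concat mss"
  have ps: "length ps = length mss" "ps ! j \<in> hom M P (mss ! j)" if "j < length mss" for j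
    using prod that by (simp_all add: is_product_def)
  have len_ps: "length ps = length mss"
    using prod by (simp add: is_product_def)
  have "\<forall>j<length mss. \<exists>ts. ts \<in> metas (T P) 0 (mss ! j) \<and> ps ! j = classes P (mss ! j) ts"
    using ps(2) by (blast elim: hom_M_E)
  then obtain ts where ts: "\<And>j. j < length mss \<Longrightarrow> ts j \<in> metas (T P) 0 (mss ! j)"
      "\<And>j. j < length mss \<Longrightarrow> ps ! j = classes P (mss ! j) (ts j)"
    by metis
  let ?tss = "map ts [0..<length mss]"
  have tss_len: "map length ?tss = map length mss"
    using ts(1) by (intro nth_equalityI) (simp_all add: in_metas_term_clone)
  have tss: "concat ?tss \<in> metas (T P) 0 ?D"
    using ts(1) by (intro concat_in_metas) (simp add: list_all2_conv_all_nth)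
  let ?q = "\<lambda>j. split_lists mss (gens ?D) ! j"
  have q: "?q j \<in> metas (T ?D) 0 (mss ! j)" if "j < length mss" for j
    by (rule split_lists_in_metas[OF gens_in_metas_0 that])
  let ?u = "classes P ?D (concat ?tss)"
  have u: "?u \<in> hom M P ?D" by (rule classes_in_hom[OF tss])
  have qu: "cmp M P ?D (mss ! j) (classes ?D (mss ! j) (?q j)) ?u = ps ! j" if "j < length mss" for j
    using cmp_classes[OF q[OF that] tss] clone.map2_denote_split_gens[OF clone_term_clone tss that]
      split_lists_concat[OF tss_len] ts(2)[OF that] that by simp
  let ?qs = "map (\<lambda>j. classes ?D (mss ! j) (?q j)) [0..<length mss]"
  have "\<exists>!v. v \<in> hom M ?D P \<and> (\<forall>j<length mss. cmp M ?D P (mss ! j) (ps ! j) v = ?qs ! j)"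
    using q by (intro is_product_ex1[OF prod]) (simp_all add: classes_in_hom)
  then obtain v where v: "v \<in> hom M ?D P"
      "\<And>j. j < length mss \<Longrightarrow> cmp M ?D P (mss ! j) (ps ! j) v = classes ?D (mss ! j) (?q j)"
    by (auto elim!: ex1E)
  \<comment> \<open>\<open>v\<close> after \<open>?u\<close> and the identity solve the same
    universal problem for the cone \<open>ps\<close>. This gives injectivity below; surjectivity
    comes from the equations \<open>v(2)\<close>.\<close>
  have vu: "cmp M P ?D P v ?u = idt M P"
  proof -
    have ex: "\<exists>!h. h \<in> hom M P P \<and> (\<forall>j<length mss. cmp M P P (mss ! j) (ps ! j) h = ps ! j)"
      using ps len_ps by (intro is_product_ex1[OF prod]) simp_all
    have 1: "cmp M P ?D P v ?u \<in> hom M P P \<and>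
        (\<forall>j<length mss. cmp M P P (mss ! j) (ps ! j) (cmp M P ?D P v ?u) = ps ! j)"
      using category_M u v(1) ps(2) v(2) qu unfolding is_category_def by simp
    have 2: "idt M P \<in> hom M P P \<and> (\<forall>j<length mss. cmp M P P (mss ! j) (ps ! j) (idt M P) = ps ! j)"
      using category_M ps(2) unfolding is_category_def by simp
    show ?thesis
      by (rule HOL.trans[OF the1_equality[OF ex, OF 1, symmetric] the1_equality[OF ex, OF 2]])
  qed
  let ?G = "\<lambda>x. map (\<lambda>j. fmap functor_of P (mss ! j) (ps ! j) x) [0..<length mss]"
  have fps: "fmap functor_of P (mss ! j) (ps ! j) x \<in> prodB (mss ! j)" if "x \<in> prodB P" "j < length mss" for x j
    using fmap_functor_of_in[OF ps(2)] that by blast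
  have inv: "fmap functor_of ?D P v (fmap functor_of P ?D ?u x) = x" if x: "x \<in> prodB P" for x
    using fmap_functor_of_cmp[OF u v(1) x] functor_idt[OF is_functor_functor_of, of P] x by (simp add: vu)
  have "inj_on ?G (prodB P)"
  proof (rule inj_onI)
    fix x y assume x: "x \<in> prodB P" and y: "y \<in> prodB P" and eq: "?G x = ?G y"
    have e: "map2 (denote B 0 (decB P x)) (mss ! j) (ts j) = map2 (denote B 0 (decB P y)) (mss ! j) (ts j)"
      if j: "j < length mss" for j
      using arg_cong[OF eq, of "\<lambda>xs. decB (mss ! j) (xs ! j)"] j ts decB_fmap[OF ts(1)[OF j]] x y by simp
    have "map2 (map2 (denote B 0 (decB P x))) mss ?tss = map2 (map2 (denote B 0 (decB P y))) mss ?tss"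
    proof (rule nth_equalityI)
      fix j assume "j < length (map2 (map2 (denote B 0 (decB P x))) mss ?tss)"
      then show "map2 (map2 (denote B 0 (decB P x))) mss ?tss ! j = map2 (map2 (denote B 0 (decB P y))) mss ?tss ! j"
        using e[of j] by simp
    qed simp
    then have "map2 (denote B 0 (decB P x)) ?D (concat ?tss) = map2 (denote B 0 (decB P y)) ?D (concat ?tss)"
      unfolding map2_concat[OF tss_len] by (rule arg_cong)
    then have "fmap functor_of P ?D ?u x = fmap functor_of P ?D ?u y"
      unfolding fmap_functor_of[OF tss x] fmap_functor_of[OF tss y] by (rule arg_cong)
    then have "fmap functor_of ?D P v (fmap functor_of P ?D ?u x) = fmap functor_of ?D P v (fmap functor_of P ?D ?u y)"
      by (rule arg_cong)
    then show "x = y"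
      unfolding inv[OF x] inv[OF y] .
  qed
  moreover have "?G ` prodB P = listset (map prodB mss)"
  proof (intro equalityI subsetI)
    fix ys assume "ys \<in> ?G ` prodB P"
    then show "ys \<in> listset (map prodB mss)"
      using fps by (auto simp: in_listset)
  next
    fix ys assume ys: "ys \<in> listset (map prodB mss)"
    let ?\<eta>s = "map2 decB mss ys"
    have ysj: "ys ! j \<in> prodB (mss ! j)" if "j < length mss" for j
      using ys that by (simp add: in_listset)
    have len: "length ys = length mss"
      using ys by (simp add: in_listset)
    have \<eta>: "concat ?\<eta>s \<in> metas B 0 ?D"
      using decB_in[OF ysj] len by (intro concat_in_metas) (simp add: list_all2_conv_all_nth)
    have \<eta>_len: "map length ?\<eta>s = map length mss"
      using decB_in[OF ysj] len by (intro nth_equalityI) (simp_all add: in_metas)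
    let ?y = "encB ?D (concat ?\<eta>s)"
    have y: "?y \<in> prodB ?D" by (rule encB_in[OF \<eta>])
    let ?x = "fmap functor_of ?D P v ?y"
    have x: "?x \<in> prodB P" by (rule fmap_functor_of_in[OF v(1) y])
    have "?G ?x = ys"
    proof (rule nth_equalityI)
      fix j assume "j < length (?G ?x)"
      then have j: "j < length mss" by simp
      have "?G ?x ! j = fmap functor_of ?D (mss ! j) (classes ?D (mss ! j) (?q j)) ?y"
        using j fmap_functor_of_cmp[OF v(1) ps(2)[OF j] y] v(2)[OF j] by simp
      also have "\<dots> = encB (mss ! j) (split_lists mss (concat ?\<eta>s) ! j)"
        by (simp add: fmap_functor_of[OF q[OF j] y] decB_encB[OF \<eta>] map2_denote_split_gens[OF \<eta> j])
      also have "\<dots> = ys ! j"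
        using j len encB_decB[OF ysj[OF j]] by (simp add: split_lists_concat[OF \<eta>_len])
      finally show "?G ?x ! j = ys ! j" .
    qed (simp add: len)
    then show "ys \<in> ?G ` prodB P"
      using x by (intro image_eqI[of _ _ ?x]) simp_all
  qed
  ultimately show ?thesis
    by (simp add: bij_betw_def)
qed

lemma preserves_finite_products_functor_of: "preserves_finite_products M (Set_cat U) functor_of"
  unfolding preserves_finite_products_def
proof (intro allI impI)
  fix mss P ps assume prod: "is_product M mss P ps"
  then have ps: "length ps = length mss" "\<forall>j<length mss. ps ! j \<in> hom M P (mss ! j)"
    by (simp_all add: is_product_def)
  obtain u where u: "{u} \<in> U" using universe_singleton[OF universe] by blast
  let ?fs = "map2 (fmap functor_of P) mss ps"
  have "(\<lambda>x. map (\<lambda>p. p x) ?fs) = (\<lambda>x. map (\<lambda>j. fmap functor_of P (mss ! j) (ps ! j) x) [0..<length mss])"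
    using ps(1) by (intro ext nth_equalityI) simp_all
  then have "bij_betw (\<lambda>x. map (\<lambda>p. p x) ?fs) (prodB P) (listset (map prodB mss))"
    using bij_functor_of_product[OF prod] by (simp only:)
  moreover have "?fs ! j \<in> prodB P \<rightarrow>\<^sub>E prodB (mss ! j)" if "j < length mss" for j
    using functor_fmap[OF is_functor_functor_of, of P "mss ! j"] ps that by (auto dest: PiE_mem)
  ultimately show "is_product (Set_cat U) (map (fobj functor_of) mss) (fobj functor_of P) ?fs"
    unfolding is_product_Set_cat_iff[OF u] using ps(1) prodB_in_universe by auto
qed

lemma functorial_model_functor_of: "functorial_model S E U functor_of"
  by unfold_locales (rule universe is_functor_functor_of preserves_finite_products_functor_of)+

section \<open>The unit at a clone\<close>

interpretation ftor: functorial_model S E U functor_of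
  by (rule functorial_model_functor_of)

lemma untup_functor_of:
  assumes \<xi>: "\<xi> \<in> metas B 0 \<Theta>"
  shows "untup functor_of \<Theta> (map2 (\<lambda>m x. encB [m] [x]) \<Theta> \<xi>) = encB \<Theta> \<xi>"
proof -
  have "tup functor_of \<Theta> (encB \<Theta> \<xi>) = map2 (\<lambda>m x. encB [m] [x]) \<Theta> \<xi>"
  proof (rule nth_equalityI)
    fix i assume "i < length (tup functor_of \<Theta> (encB \<Theta> \<xi>))"
    then have i: "i < length \<Theta>" by (simp add: tup_def)
    have "[gens \<Theta> ! i] \<in> metas (T \<Theta>) 0 [\<Theta> ! i]"
      using wf_gens[OF i] by (simp add: in_metas)
    from fmap_functor_of[OF this encB_in[OF \<xi>]]
    show "tup functor_of \<Theta> (encB \<Theta> \<xi>) ! i = map2 (\<lambda>m x. encB [m] [x]) \<Theta> \<xi> ! i"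
      using i \<xi> by (simp add: tup_def decB_encB denote_gen in_metas)
  qed (use \<xi> in \<open>simp add: tup_def in_metas\<close>)
  then show ?thesis
    using ftor.untup_tup[of "encB \<Theta> \<xi>" \<Theta>] encB_in[OF \<xi>] by simp
qed

lemma sem_functor_of:
  assumes t: "wf_trm S \<Theta> n t" and \<xi>: "\<xi> \<in> metas B 0 \<Theta>"
  shows "sem functor_of \<Theta> n t (map2 (\<lambda>m x. encB [m] [x]) \<Theta> \<xi>) = encB [n] [denote B 0 \<xi> n t]"
  using fmap_functor_of[of "[t]" \<Theta> "[n]" "encB \<Theta> \<xi>"] t
  by (simp add: sem_def untup_functor_of[OF \<xi>] in_metas decB_encB[OF \<xi>] encB_in[OF \<xi>])

lemma single_in_metas: "x \<in> elts B n \<Longrightarrow> [x] \<in> metas B 0 [n]"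
  by (simp add: in_metas)

text \<open>\<open>prodB [n]\<close> is a set of codes for one-element lists over
  \<open>elts B n\<close>, so the comparison map encodes singletons. Homomorphy holds because
  \<open>sem\<close> of the functor acts on codes as \<open>denote\<close> does on values.\<close>

lemma clone_hom_unit: "is_clone_hom S B (ftor_clone functor_of) (\<lambda>n x. encB [n] [x])"
proof (rule clone_homI[OF ftor.clone_C])
  fix n x assume "x \<in> elts B n"
  then show "encB [n] [x] \<in> elts (ftor_clone functor_of) n"
    by (simp add: encB_in single_in_metas)
next
  fix \<Theta> n t \<phi> assume t: "wf_trm S \<Theta> n t" and \<phi>: "\<phi> \<in> metas B 0 \<Theta>"
  have "map2 (\<lambda>m x. encB [m] [x]) \<Theta> \<phi> \<in> metas (ftor_clone functor_of) 0 \<Theta>"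
    using \<phi> by (simp add: in_metas encB_in)
  then show "encB [n] [denote B 0 \<phi> n t] =
      denote (ftor_clone functor_of) 0 (map2 (\<lambda>m x. encB [m] [x]) \<Theta> \<phi>) n t"
    using ftor.denote_C[OF t] sem_functor_of[OF t \<phi>] by simp
qed

lemma bij_unit: "bij_betw (\<lambda>x. encB [n] [x]) (elts B n) (prodB [n])"
proof -
  have "bij_betw (\<lambda>x. [x]) (elts B n) (metas B 0 [n])"
    by (rule bij_betwI[of _ _ _ hd]) (auto simp: in_metas length_Suc_conv)
  moreover have "bij_betw (encB [n]) (metas B 0 [n]) (prodB [n])"
    unfolding encB_def by (rule bij_betw_inv_into[OF bij_decB])
  ultimately show ?thesis
    using bij_betw_trans by (fastforce simp: comp_def)
qed

end

section \<open>Categories of models and isomorphisms\<close>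

context clone
begin

lemma map2_hom_in_metas:
  "is_clone_hom S A B h \<Longrightarrow> \<phi> \<in> metas A 0 \<Theta> \<Longrightarrow> map2 h \<Theta> \<phi> \<in> metas B 0 \<Theta>"
  by (simp add: in_metas is_clone_hom_def)

lemma denote_hom_0:
  "is_clone_hom S A B h \<Longrightarrow> wf_trm S \<Theta> n t \<Longrightarrow> \<phi> \<in> metas A 0 \<Theta> \<Longrightarrow>
   h n (denote A 0 \<phi> n t) = denote B 0 (map2 h \<Theta> \<phi>) n t"
  using denote_hom[of B h \<Theta> n t \<phi> 0] by simp

text \<open>Allows passing between a homomorphism and its restriction to the carriers, the form that
  morphisms of models must have.\<close>

lemma clone_hom_cong:
  assumes B: "clone S B" and h: "is_clone_hom S A B h" and eq: "\<And>n x. x \<in> elts A n \<Longrightarrow> h' n x = h n x"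
  shows "is_clone_hom S A B h'"
proof (rule clone_homI[OF B])
  fix n x assume "x \<in> elts A n"
  then show "h' n x \<in> elts B n" using h eq by (simp add: is_clone_hom_def)
next
  fix \<Theta> n t \<phi> assume t: "wf_trm S \<Theta> n t" and \<phi>: "\<phi> \<in> metas A 0 \<Theta>"
  have "map2 h' \<Theta> \<phi> = map2 h \<Theta> \<phi>"
    using \<phi> eq by (intro nth_equalityI) (simp_all add: in_metas)
  moreover have "h' n (denote A 0 \<phi> n t) = h n (denote A 0 \<phi> n t)"
    using eq denote_in[OF t \<phi>] by simp
  ultimately show "h' n (denote A 0 \<phi> n t) = denote B 0 (map2 h' \<Theta> \<phi>) n t"
    using denote_hom_0[OF h t \<phi>] by (simp only:)
qed

lemma clone_hom_id: "is_clone_hom S A A (\<lambda>n x. x)"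
  by (rule clone_homI[OF clone_axioms]) (auto simp: in_metas intro!: arg_cong[of _ _ "\<lambda>\<phi>. denote A 0 \<phi> _ _"] nth_equalityI)

lemma clone_hom_comp:
  assumes B: "clone S B" and C: "clone S C" and h: "is_clone_hom S A B h" and k: "is_clone_hom S B C k"
  shows "is_clone_hom S A C (\<lambda>n x. k n (h n x))"
proof (rule clone_homI[OF C])
  fix n x assume "x \<in> elts A n"
  then show "k n (h n x) \<in> elts C n" using h k by (simp add: is_clone_hom_def)
next
  fix \<Theta> n t \<phi> assume t: "wf_trm S \<Theta> n t" and \<phi>: "\<phi> \<in> metas A 0 \<Theta>"
  have "map2 k \<Theta> (map2 h \<Theta> \<phi>) = map2 (\<lambda>n x. k n (h n x)) \<Theta> \<phi>"
    using \<phi> by (intro nth_equalityI) (simp_all add: in_metas)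
  then show "k n (h n (denote A 0 \<phi> n t)) = denote C 0 (map2 (\<lambda>n x. k n (h n x)) \<Theta> \<phi>) n t"
    using denote_hom_0[OF h t \<phi>] clone.denote_hom_0[OF B k t map2_hom_in_metas[OF h \<phi>]] by (simp only:)
qed

lemma clone_hom_inv:
  assumes B: "clone S B" and h: "is_clone_hom S A B h"
    and bij: "\<And>n. bij_betw (h n) (elts A n) (elts B n)"
  shows "is_clone_hom S B A (\<lambda>n. inv_into (elts A n) (h n))"
proof (rule clone.clone_homI[OF B clone_axioms])
  fix n x assume "x \<in> elts B n"
  then show "inv_into (elts A n) (h n) x \<in> elts A n"
    by (rule bij_betw_apply[OF bij_betw_inv_into[OF bij]])
next
  fix \<Theta> n t \<phi> assume t: "wf_trm S \<Theta> n t" and \<phi>: "\<phi> \<in> metas B 0 \<Theta>"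
  let ?\<psi> = "map2 (\<lambda>n. inv_into (elts A n) (h n)) \<Theta> \<phi>"
  have \<psi>: "?\<psi> \<in> metas A 0 \<Theta>"
    using \<phi> bij_betw_apply[OF bij_betw_inv_into[OF bij]] by (simp add: in_metas)
  have "map2 h \<Theta> ?\<psi> = \<phi>"
    using \<phi> bij_betw_inv_into_right[OF bij] by (intro nth_equalityI) (simp_all add: in_metas)
  then have "h n (denote A 0 ?\<psi> n t) = denote B 0 \<phi> n t"
    using denote_hom_0[OF h t \<psi>] by (simp only:)
  moreover have "denote A 0 ?\<psi> n t \<in> elts A n"
    using denote_in[OF t \<psi>] by simp
  ultimately show "inv_into (elts A n) (h n) (denote B 0 \<phi> n t) = denote A 0 ?\<psi> n t"
    using bij_betw_inv_into_left[OF bij] by metis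
qed

lemma clone_clone_of_model_of: "clone S (clone_of (model_of S A))"
proof -
  \<comment> \<open>The clone laws of a model hold over any collection of sets, so the largest one
    may be taken, where every carrier is admissible.\<close>
  have "is_model S UNIV (model_of S A)" by (rule is_model_model_of) simp
  then show ?thesis by (intro model.clone_clone_of model.intro)
qed

text \<open>The inverse of the bijective homomorphism \<open>clone_hom_model_of\<close>.\<close>

lemma clone_hom_to_model_of: "is_clone_hom S A (clone_of (model_of S A)) (\<lambda>n x. x)"
proof -
  have "is_clone_hom S A (clone_of (model_of S A)) (\<lambda>n. inv_into (elts A n) (\<lambda>x. x))"
    using clone.clone_hom_inv[OF clone_clone_of_model_of clone_axioms clone_hom_model_of]
    by (simp add: bij_betw_def)
  then show ?thesis
    by (rule clone_hom_cong[OF clone_clone_of_model_of]) (metis f_inv_into_f image_ident)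
qed

lemma denote_clone_of_model_of:
  assumes "wf_trm S \<Theta> n t" "\<phi> \<in> metas A p \<Theta>"
  shows "denote (clone_of (model_of S A)) p \<phi> n t = denote A p \<phi> n t"
proof -
  have "map2 (\<lambda>m x. x) \<Theta> \<phi> = \<phi>"
    using assms(2) by (intro nth_equalityI) (simp_all add: in_metas)
  then show ?thesis
    using clone.denote_hom[OF clone_clone_of_model_of clone_hom_model_of assms(1), of \<phi> p] assms(2)
    by (simp add: metas_clone_of_model_of)
qed

end

section \<open>Category laws and isomorphisms for models and for set-valued functors\<close>

lemma category_full_subcat: "is_category C \<Longrightarrow> is_category (full_subcat C P)"
  by (simp add: is_category_def full_subcat_def)

lemma category_model_cat: "is_category (model_cat S U)"
proof -
  have in_PiE: "h n \<in> fobj (carr A) n \<rightarrow>\<^sub>E fobj (carr B) n" if "is_model_hom S A B h" for A B h n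
    using that by (simp add: is_model_hom_def psh_hom_def)
  have id: "is_model_hom S A A (psh_id (carr A))" if A: "is_model S U A" for A
  proof -
    have c: "clone S (clone_of A)" by (rule model.clone_clone_of[OF model.intro[OF A]])
    show ?thesis
      unfolding is_model_hom_iff[OF A A]
      using clone.clone_hom_cong[OF c c clone.clone_hom_id[OF c], of "psh_id (carr A)"]
      by (simp add: psh_id_def)
  qed
  have comp: "is_model_hom S A C (\<lambda>n. compose (fobj (carr A) n) (k n) (h n))"
    if A: "is_model S U A" and B: "is_model S U B" and C: "is_model S U C"
      and h: "is_model_hom S A B h" and k: "is_model_hom S B C k" for A B C h k
  proof -
    have c: "clone S (clone_of A)" "clone S (clone_of B)" "clone S (clone_of C)"
      using A B C by (auto intro: model.clone_clone_of model.intro)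
    have "is_clone_hom S (clone_of A) (clone_of C) (\<lambda>n x. k n (h n x))"
      using h k unfolding is_model_hom_iff[OF A B] is_model_hom_iff[OF B C]
      by (intro clone.clone_hom_comp[OF c]) simp_all
    then have "is_clone_hom S (clone_of A) (clone_of C) (\<lambda>n. compose (fobj (carr A) n) (k n) (h n))"
      by (rule clone.clone_hom_cong[OF c(1,3)]) (simp add: compose_eq)
    then show ?thesis
      unfolding is_model_hom_iff[OF A C] by (simp add: compose_def)
  qed
  have unit: "(\<lambda>n. compose (fobj (carr A) n) (psh_id (carr B) n) (h n)) = h"
      "(\<lambda>n. compose (fobj (carr A) n) (h n) (psh_id (carr A) n)) = h" if "is_model_hom S A B h" for A B h
    unfolding psh_id_def
    by (rule ext, rule compose_restrict_id[OF in_PiE[OF that]], rule ext, rule compose_id_restrict[OF in_PiE[OF that]])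
  have assoc: "(\<lambda>n. compose (fobj (carr A) n) (l n) (compose (fobj (carr A) n) (k n) (h n))) =
      (\<lambda>n. compose (fobj (carr A) n) (compose (fobj (carr B) n) (l n) (k n)) (h n))"
    if "is_model_hom S A B h" for A B h k l
    by (rule ext, rule compose_compose[OF in_PiE[OF that]])
  show ?thesis
    unfolding is_category_def model_cat_def cat.simps
    by (intro conjI ballI; unfold mem_Collect_eq) (rule id comp unit assoc; assumption)+
qed

lemma
  assumes "is_category C"
  shows cat_idt: "a \<in> obj C \<Longrightarrow> idt C a \<in> hom C a a"
    and cat_cmp: "a \<in> obj C \<Longrightarrow> b \<in> obj C \<Longrightarrow> c \<in> obj C \<Longrightarrow> f \<in> hom C a b \<Longrightarrow> g \<in> hom C b c \<Longrightarrow>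
      cmp C a b c g f \<in> hom C a c"
  using assms by (simp_all add: is_category_def)

lemma category_functor_cat_Set:
  assumes C: "is_category C"
  shows "is_category (functor_cat C (Set_cat U))"
proof -
  have fm: "fmap F a b f \<in> fobj F a \<rightarrow>\<^sub>E fobj F b"
    if "is_functor C (Set_cat U) F" "a \<in> obj C" "b \<in> obj C" "f \<in> hom C a b" for F a b f
    using PiE_mem[OF functor_fmap[OF that(1-3)] that(4)] by simp
  have nt: "\<tau> a \<in> fobj F a \<rightarrow>\<^sub>E fobj G a"
    if "is_nat_trans C (Set_cat U) F G \<tau>" "a \<in> obj C" for F G \<tau> a
    using that by (auto simp: is_nat_trans_def)
  have id: "is_nat_trans C (Set_cat U) F F (\<lambda>a\<in>obj C. \<lambda>x\<in>fobj F a. x)"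
    if "is_functor C (Set_cat U) F" for F
    by (simp add: is_nat_trans_def compose_restrict_id[OF fm[OF that]] compose_id_restrict[OF fm[OF that]])
  have comp: "is_nat_trans C (Set_cat U) F H (\<lambda>a\<in>obj C. compose (fobj F a) (\<sigma> a) (\<tau> a))"
    if F: "is_functor C (Set_cat U) F" and \<tau>: "is_nat_trans C (Set_cat U) F G \<tau>"
      and \<sigma>: "is_nat_trans C (Set_cat U) G H \<sigma>" for F G H \<sigma> \<tau>
    unfolding is_nat_trans_def Set_cat_sel
  proof (intro conjI ballI)
    show "(\<lambda>a\<in>obj C. compose (fobj F a) (\<sigma> a) (\<tau> a)) \<in> (\<Pi>\<^sub>E a\<in>obj C. fobj F a \<rightarrow>\<^sub>E fobj H a)"
      using compose_in_PiE[OF nt[OF \<tau>] nt[OF \<sigma>]] by simp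
    fix a b f assume a: "a \<in> obj C" and b: "b \<in> obj C" and f: "f \<in> hom C a b"
    have "\<sigma> b (\<tau> b (fmap F a b f x)) = fmap H a b f (\<sigma> a (\<tau> a x))" "fmap F a b f x \<in> fobj F b"
      if "x \<in> fobj F a" for x
      using nat_trans_fmap[OF \<tau> a b f that] nat_trans_fmap[OF \<sigma> a b f nat_trans_in[OF \<tau> a that]]
        PiE_mem[OF fm[OF F a b f] that] by simp_all
    then show "compose (fobj F a) ((\<lambda>a\<in>obj C. compose (fobj F a) (\<sigma> a) (\<tau> a)) b) (fmap F a b f) =
        compose (fobj F a) (fmap H a b f) ((\<lambda>a\<in>obj C. compose (fobj F a) (\<sigma> a) (\<tau> a)) a)"
      using a b by (auto simp: compose_def intro!: restrict_ext)
  qed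
  have unit: "(\<lambda>a\<in>obj C. compose (fobj F a) ((\<lambda>a\<in>obj C. \<lambda>x\<in>fobj G a. x) a) (\<tau> a)) = \<tau>"
      "(\<lambda>a\<in>obj C. compose (fobj F a) (\<tau> a) ((\<lambda>a\<in>obj C. \<lambda>x\<in>fobj F a. x) a)) = \<tau>"
    if \<tau>: "is_nat_trans C (Set_cat U) F G \<tau>" for F G \<tau>
  proof -
    have ext: "\<tau> \<in> extensional (obj C)"
      using \<tau> by (simp add: is_nat_trans_def PiE_iff)
    show "(\<lambda>a\<in>obj C. compose (fobj F a) ((\<lambda>a\<in>obj C. \<lambda>x\<in>fobj G a. x) a) (\<tau> a)) = \<tau>"
      "(\<lambda>a\<in>obj C. compose (fobj F a) (\<tau> a) ((\<lambda>a\<in>obj C. \<lambda>x\<in>fobj F a. x) a)) = \<tau>"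
      by (rule extensionalityI[OF _ ext],
        simp_all add: compose_restrict_id[OF nt[OF \<tau>]] compose_id_restrict[OF nt[OF \<tau>]])+
  qed
  have assoc: "(\<lambda>a\<in>obj C. compose (fobj F a) (\<rho> a) ((\<lambda>a\<in>obj C. compose (fobj F a) (\<sigma> a) (\<tau> a)) a)) =
      (\<lambda>a\<in>obj C. compose (fobj F a) ((\<lambda>a\<in>obj C. compose (fobj G a) (\<rho> a) (\<sigma> a)) a) (\<tau> a))"
    if \<tau>: "is_nat_trans C (Set_cat U) F G \<tau>" for F G \<rho> \<sigma> \<tau>
    by (rule restrict_ext) (simp add: compose_compose[OF nt[OF \<tau>]])
  show ?thesis
    unfolding is_category_def functor_cat_def cat.simps Set_cat_sel
    by (intro conjI ballI; unfold mem_Collect_eq) (rule id comp unit assoc; assumption)+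
qed

lemma is_iso_model:
  assumes A: "is_model S U A" and B: "is_model S U B" and h: "is_model_hom S A B h"
    and bij: "\<And>n. bij_betw (h n) (fobj (carr A) n) (fobj (carr B) n)"
  shows "is_iso (model_cat S U) A B h"
proof -
  have c: "clone S (clone_of A)" "clone S (clone_of B)"
    using A B by (auto intro: model.clone_clone_of model.intro)
  let ?g = "\<lambda>n. \<lambda>y\<in>fobj (carr B) n. inv_into (fobj (carr A) n) (h n) y"
  have "is_clone_hom S (clone_of B) (clone_of A) (\<lambda>n. inv_into (fobj (carr A) n) (h n))"
    using clone.clone_hom_inv[OF c, of h] h bij unfolding is_model_hom_iff[OF A B] by simp
  then have "is_clone_hom S (clone_of B) (clone_of A) ?g"
    by (rule clone.clone_hom_cong[OF c(2,1)]) simp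
  then have "is_model_hom S B A ?g"
    unfolding is_model_hom_iff[OF B A] by simp
  moreover have "compose (fobj (carr A) n) (?g n) (h n) = psh_id (carr A) n" for n
    using bij_betw_inv_into_left[OF bij] bij_betw_apply[OF bij] by (auto simp: compose_def psh_id_def intro!: restrict_ext)
  moreover have "compose (fobj (carr B) n) (h n) (?g n) = psh_id (carr B) n" for n
    using bij_betw_inv_into_right[OF bij] by (auto simp: compose_def psh_id_def intro!: restrict_ext)
  ultimately show ?thesis
    using h unfolding is_iso_def model_cat_def by (auto intro!: bexI[of _ ?g])
qed

lemma is_iso_functor_cat_Set:
  assumes F: "is_functor C (Set_cat U) F" and G: "is_functor C (Set_cat U) G"
    and \<tau>: "is_nat_trans C (Set_cat U) F G \<tau>"
    and bij: "\<And>a. a \<in> obj C \<Longrightarrow> bij_betw (\<tau> a) (fobj F a) (fobj G a)"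
  shows "is_iso (functor_cat C (Set_cat U)) F G \<tau>"
proof -
  let ?\<sigma> = "\<lambda>a\<in>obj C. \<lambda>y\<in>fobj G a. inv_into (fobj F a) (\<tau> a) y"
  have inv_in: "inv_into (fobj F a) (\<tau> a) y \<in> fobj F a" if "a \<in> obj C" "y \<in> fobj G a" for a y
    by (rule bij_betw_apply[OF bij_betw_inv_into[OF bij[OF that(1)]] that(2)])
  have Fin: "fmap F a b f x \<in> fobj F b" if "a \<in> obj C" "b \<in> obj C" "f \<in> hom C a b" "x \<in> fobj F a" for a b f x
    using functor_fmap[OF F that(1,2)] that(3,4) by (auto dest!: PiE_mem)
  have Gin: "fmap G a b f x \<in> fobj G b" if "a \<in> obj C" "b \<in> obj C" "f \<in> hom C a b" "x \<in> fobj G a" for a b f x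
    using functor_fmap[OF G that(1,2)] that(3,4) by (auto dest!: PiE_mem)
  have "is_nat_trans C (Set_cat U) G F ?\<sigma>"
    unfolding is_nat_trans_def Set_cat_sel
  proof (intro conjI ballI)
    show "?\<sigma> \<in> (\<Pi>\<^sub>E a\<in>obj C. fobj G a \<rightarrow>\<^sub>E fobj F a)"
      using inv_in by auto
    fix a b f assume a: "a \<in> obj C" and b: "b \<in> obj C" and f: "f \<in> hom C a b"
    have "inv_into (fobj F b) (\<tau> b) (fmap G a b f y) = fmap F a b f (inv_into (fobj F a) (\<tau> a) y)"
      if y: "y \<in> fobj G a" for y
    proof -
      let ?x = "inv_into (fobj F a) (\<tau> a) y"
      have "\<tau> b (fmap F a b f ?x) = fmap G a b f y"
        using nat_trans_fmap[OF \<tau> a b f inv_in[OF a y]] bij_betw_inv_into_right[OF bij[OF a] y] by simp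
      then show ?thesis
        using bij_betw_inv_into_left[OF bij[OF b] Fin[OF a b f inv_in[OF a y]]] by simp
    qed
    then show "compose (fobj G a) (?\<sigma> b) (fmap G a b f) = compose (fobj G a) (fmap F a b f) (?\<sigma> a)"
      using a b Gin[OF a b f] by (auto simp: compose_def intro!: restrict_ext)
  qed
  moreover have "compose (fobj F a) (?\<sigma> a) (\<tau> a) = (\<lambda>x\<in>fobj F a. x)" if "a \<in> obj C" for a
    using bij_betw_inv_into_left[OF bij[OF that]] bij_betw_apply[OF bij[OF that]] that
    by (auto simp: compose_def intro!: restrict_ext)
  moreover have "compose (fobj G a) (\<tau> a) (?\<sigma> a) = (\<lambda>x\<in>fobj G a. x)" if "a \<in> obj C" for a
    using bij_betw_inv_into_right[OF bij[OF that]] that by (auto simp: compose_def intro!: restrict_ext)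
  ultimately show ?thesis
    using \<tau> unfolding is_iso_def functor_cat_def
    by (auto intro!: bexI[of _ ?\<sigma>] restrict_ext)
qed

lemma is_iso_full_subcat: "is_iso (full_subcat C P) = is_iso C"
  by (simp add: is_iso_def full_subcat_def fun_eq_iff)

section \<open>The equivalence\<close>

locale clone_model_hom = A: clone_model S E A U + B: clone_model S E B U
  for S :: "'o signature" and E and A B :: "('o, 'u) clone_ops" and U +
  fixes h :: "nat \<Rightarrow> 'u \<Rightarrow> 'u"
  assumes clone_hom: "is_clone_hom S A B h"
begin

definition functor_map :: "nat list \<Rightarrow> 'u \<Rightarrow> 'u" where
  "functor_map = (\<lambda>ms. \<lambda>x\<in>A.prodB ms. B.encB ms (map2 h ms (A.decB ms x)))"

lemma map2_in_metas: "\<xi> \<in> metas A 0 ms \<Longrightarrow> map2 h ms \<xi> \<in> metas B 0 ms"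
  by (rule A.map2_hom_in_metas[OF clone_hom])

lemma functor_map_in: "x \<in> A.prodB ms \<Longrightarrow> functor_map ms x \<in> B.prodB ms"
  by (simp add: functor_map_def B.encB_in map2_in_metas A.decB_in)

lemma functor_map_encB: "\<xi> \<in> metas A 0 ms \<Longrightarrow> functor_map ms (A.encB ms \<xi>) = B.encB ms (map2 h ms \<xi>)"
  by (simp add: functor_map_def A.encB_in A.decB_encB)

text \<open>A clone homomorphism commutes with denotations; naturality at \<open>f\<close> is this
  fact for each component of \<open>f\<close>.\<close>

lemma nat_trans_functor_map:
  "is_nat_trans (classifying_cat S E) (Set_cat U) A.functor_of B.functor_of functor_map"
  unfolding is_nat_trans_def Set_cat_sel A.obj_M A.fobj_functor_of B.fobj_functor_of
proof (intro conjI ballI)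
  show "functor_map \<in> (\<Pi>\<^sub>E ms\<in>UNIV. A.prodB ms \<rightarrow>\<^sub>E B.prodB ms)"
    using functor_map_in by (auto simp: functor_map_def PiE_iff)
  fix ms ns f assume "f \<in> hom A.M ms ns"
  then obtain ts where ts: "ts \<in> metas (A.T ms) 0 ns" and f: "f = A.classes ms ns ts"
    by (rule A.hom_M_E)
  have "functor_map ns (fmap A.functor_of ms ns f x) = fmap B.functor_of ms ns f (functor_map ms x)"
    if x: "x \<in> A.prodB ms" for x
  proof -
    have "map2 h ns (map2 (denote A 0 (A.decB ms x)) ns ts) =
        map2 (denote B 0 (map2 h ms (A.decB ms x))) ns ts"
      using ts A.denote_hom_0[OF clone_hom _ A.decB_in[OF x]]
      by (intro nth_equalityI) (simp_all add: in_metas)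
    then have "functor_map ns (fmap A.functor_of ms ns f x) =
        B.encB ns (map2 (denote B 0 (map2 h ms (A.decB ms x))) ns ts)"
      unfolding f A.fmap_functor_of[OF ts x]
      using functor_map_encB[OF A.map2_denote_in_metas[OF ts A.decB_in[OF x]]] by (simp only:)
    also have "\<dots> = fmap B.functor_of ms ns f (functor_map ms x)"
      unfolding f B.fmap_functor_of[OF ts functor_map_in[OF x]]
      using x by (simp add: functor_map_def B.decB_encB map2_in_metas A.decB_in)
    finally show ?thesis .
  qed
  then show "compose (A.prodB ms) (functor_map ns) (fmap A.functor_of ms ns f) =
      compose (A.prodB ms) (fmap B.functor_of ms ns f) (functor_map ms)"
    by (auto simp: compose_def intro!: restrict_ext)
qed

end

section \<open>The counit at a cartesian functor\<close>

context functorial_model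
begin

lemma fobj_in_universe: "fobj F ms \<in> U"
  using functor_fobj[OF is_functor, of ms] by simp

abbreviation model :: "('o, 'u) model" where
  "model \<equiv> model_of S C"

lemma is_model_model: "is_model S U model"
  by (rule C.is_model_model_of) (simp add: fobj_in_universe)

text \<open>The functor is rebuilt from \<open>clone_of model\<close> rather than from
  \<open>C\<close>, since the equivalence passes through models. Both clones have the same
  denotations of well-formed terms.\<close>

sublocale model: clone_model S E "clone_of model" U
proof (unfold_locales)
  show "elts (clone_of model) n \<in> U" for n
    by (simp add: fobj_in_universe)
  have "clone_satisfies (clone_of model) (\<Theta>, n, s, t)" if eq: "(\<Theta>, n, s, t) \<in> E" for \<Theta> n s t
  proof -
    have "wf_trm S \<Theta> n s" "wf_trm S \<Theta> n t"
      using presentation eq by (auto simp: is_presentation_def)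
    then show ?thesis
      using clone_satisfies_C[OF eq]
      by (simp add: clone_satisfies_def C.denote_clone_of_model_of C.metas_clone_of_model_of)
  qed
  then show "\<forall>eq\<in>E. clone_satisfies (clone_of model) eq" by auto
qed (use universe C.clone_clone_of_model_of in \<open>auto simp: clone_def\<close>)

definition counit :: "nat list \<Rightarrow> 'u \<Rightarrow> 'u" where
  "counit = (\<lambda>ms. \<lambda>x\<in>model.prodB ms. untup F ms (model.decB ms x))"

lemma model_decB_in: "x \<in> model.prodB ms \<Longrightarrow> model.decB ms x \<in> metas C 0 ms"
  using model.decB_in[of x ms] by (simp add: C.metas_clone_of_model_of)

text \<open>On decoded tuples both functors act by \<open>sem\<close>: the rebuilt one by
  \<open>denote_C\<close>, the given one by \<open>fmap_untup\<close>.\<close>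

lemma nat_trans_counit: "is_nat_trans M (Set_cat U) model.functor_of F counit"
  unfolding is_nat_trans_def Set_cat_sel obj_M model.fobj_functor_of
proof (intro conjI ballI)
  show "counit \<in> (\<Pi>\<^sub>E ms\<in>UNIV. model.prodB ms \<rightarrow>\<^sub>E fobj F ms)"
    using untup_in[OF model_decB_in] by (auto simp: counit_def PiE_iff)
  fix ms ns f assume "f \<in> hom M ms ns"
  then obtain ts where ts: "ts \<in> metas (T ms) 0 ns" and f: "f = classes ms ns ts"
    by (rule hom_M_E)
  have "counit ns (fmap model.functor_of ms ns f x) = fmap F ms ns f (counit ms x)"
    if x: "x \<in> model.prodB ms" for x
  proof -
    have "denote (clone_of model) 0 (model.decB ms x) n t = sem F ms n t (model.decB ms x)"
      if "wf_trm S ms n t" for n t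
      using C.denote_clone_of_model_of[OF that model_decB_in[OF x]] denote_C[OF that model_decB_in[OF x]]
      by simp
    then have "map2 (denote (clone_of model) 0 (model.decB ms x)) ns ts =
        map2 (\<lambda>n t. sem F ms n t (model.decB ms x)) ns ts"
      using ts by (intro nth_equalityI) (simp_all add: in_metas_term_clone)
    moreover have "fmap model.functor_of ms ns f x \<in> model.prodB ns"
      unfolding f by (rule model.fmap_functor_of_in[OF classes_in_hom[OF ts] x])
    ultimately have "counit ns (fmap model.functor_of ms ns f x) =
        untup F ns (map2 (\<lambda>n t. sem F ms n t (model.decB ms x)) ns ts)"
      using model.decB_fmap[OF ts x] by (simp only: counit_def restrict_apply' f)
    then show ?thesis
      using x fmap_untup[OF ts model_decB_in[OF x]] by (simp add: counit_def f)
  qed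
  then show "compose (model.prodB ms) (counit ns) (fmap model.functor_of ms ns f) =
      compose (model.prodB ms) (fmap F ms ns f) (counit ms)"
    by (auto simp: compose_def intro!: restrict_ext)
qed

lemma bij_counit: "bij_betw (counit ms) (model.prodB ms) (fobj F ms)"
proof -
  have "bij_betw (model.decB ms) (model.prodB ms) (metas C 0 ms)"
    using model.bij_decB[of ms] by (simp add: C.metas_clone_of_model_of)
  moreover have "bij_betw (untup F ms) (metas C 0 ms) (fobj F ms)"
    unfolding untup_def by (rule bij_betw_inv_into[OF bij_tup])
  ultimately have "bij_betw (untup F ms \<circ> model.decB ms) (model.prodB ms) (fobj F ms)"
    by (rule bij_betw_trans)
  then show ?thesis
    by (rule bij_betw_cong[THEN iffD1, rotated]) (simp add: counit_def)
qed

end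

context functorial_model_hom
begin

lemma is_model_hom_\<tau>: "is_model_hom S F.model G.model (\<lambda>n. \<tau> [n])"
proof -
  have "is_clone_hom S (clone_of F.model) G.C (\<lambda>n. \<tau> [n])"
    using clone.clone_hom_comp[OF F.C.clone_clone_of_model_of F.clone_C G.clone_C
        F.C.clone_hom_model_of clone_hom_\<tau>] .
  then have "is_clone_hom S (clone_of F.model) (clone_of G.model) (\<lambda>n. \<tau> [n])"
    using clone.clone_hom_comp[OF F.C.clone_clone_of_model_of G.clone_C G.C.clone_clone_of_model_of
        _ G.C.clone_hom_to_model_of] by blast
  moreover have "\<tau> [n] \<in> extensional (fobj F [n])" for n
    using nat by (simp add: is_nat_trans_def PiE_iff)
  ultimately show ?thesis
    unfolding is_model_hom_iff[OF F.is_model_model G.is_model_model] by simp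
qed

sublocale model_hom: clone_model_hom S E "clone_of F.model" "clone_of G.model" U "\<lambda>n. \<tau> [n]"
  by unfold_locales
    (use is_model_hom_\<tau> in \<open>simp add: is_model_hom_iff[OF F.is_model_model G.is_model_model]\<close>)

text \<open>Decoding turns \<open>functor_map\<close> into the componentwise action of the maps
  \<open>\<tau> [n]\<close>, and \<open>\<tau>_untup\<close> carries this action through
  \<open>untup\<close>.\<close>

lemma counit_natural:
  assumes x: "x \<in> F.model.prodB ms"
  shows "G.counit ms (model_hom.functor_map ms x) = \<tau> ms (F.counit ms x)"
proof -
  have "model_hom.functor_map ms x \<in> G.model.prodB ms"
    by (rule model_hom.functor_map_in[OF x])
  moreover have "G.model.decB ms (model_hom.functor_map ms x) = map2 (\<lambda>n. \<tau> [n]) ms (F.model.decB ms x)"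
    using x by (simp add: model_hom.functor_map_def G.model.decB_encB model_hom.map2_in_metas F.model.decB_in)
  ultimately show ?thesis
    using x \<tau>_untup[OF F.model_decB_in[OF x]] by (simp add: F.counit_def G.counit_def)
qed

end

text \<open>Makes arbitrary maps extensional, so that functor and equivalence conditions can be
  checked on arguments from the categories, free of restrictions.\<close>

definition mk_ftor ::
  "('o, 'm) cat \<Rightarrow> ('o \<Rightarrow> 'p) \<Rightarrow> ('o \<Rightarrow> 'o \<Rightarrow> 'm \<Rightarrow> 'n) \<Rightarrow> ('o, 'm, 'p, 'n) ftor" where
  "mk_ftor C fo fm = \<lparr>fobj = (\<lambda>a\<in>obj C. fo a), fmap = (\<lambda>a\<in>obj C. \<lambda>b\<in>obj C. \<lambda>f\<in>hom C a b. fm a b f)\<rparr>"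

lemma mk_ftor_sel [simp]:
  "a \<in> obj C \<Longrightarrow> fobj (mk_ftor C fo fm) a = fo a"
  "a \<in> obj C \<Longrightarrow> b \<in> obj C \<Longrightarrow> f \<in> hom C a b \<Longrightarrow> fmap (mk_ftor C fo fm) a b f = fm a b f"
  by (simp_all add: mk_ftor_def)

lemma is_functor_mk_ftor:
  assumes "is_category C" "is_category D" "\<And>a. a \<in> obj C \<Longrightarrow> fo a \<in> obj D"
    and "\<And>a b f. a \<in> obj C \<Longrightarrow> b \<in> obj C \<Longrightarrow> f \<in> hom C a b \<Longrightarrow> fm a b f \<in> hom D (fo a) (fo b)"
    and "\<And>a. a \<in> obj C \<Longrightarrow> fm a a (idt C a) = idt D (fo a)"
    and "\<And>a b c f g. a \<in> obj C \<Longrightarrow> b \<in> obj C \<Longrightarrow> c \<in> obj C \<Longrightarrow> f \<in> hom C a b \<Longrightarrow> g \<in> hom C b c \<Longrightarrow>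
      fm a c (cmp C a b c g f) = cmp D (fo a) (fo b) (fo c) (fm b c g) (fm a b f)"
  shows "is_functor C D (mk_ftor C fo fm)"
  unfolding is_functor_def
proof (intro conjI)
  show "fobj (mk_ftor C fo fm) \<in> obj C \<rightarrow>\<^sub>E obj D"
    using assms(3) by (simp add: mk_ftor_def)
  show "fmap (mk_ftor C fo fm) \<in> (\<Pi>\<^sub>E a\<in>obj C. \<Pi>\<^sub>E b\<in>obj C. hom C a b \<rightarrow>\<^sub>E
      hom D (fobj (mk_ftor C fo fm) a) (fobj (mk_ftor C fo fm) b))"
    using assms(4) by (simp add: mk_ftor_def)
qed (use assms cat_idt[OF assms(1)] cat_cmp[OF assms(1)] in simp_all)

lemma equivalent_categoriesI:
  fixes C :: "('o, 'm) cat" and D :: "('p, 'n) cat"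
  assumes F: "is_functor C D (mk_ftor C fo fm)" and G: "is_functor D C (mk_ftor D go gm)"
    and \<eta>: "\<And>a. a \<in> obj C \<Longrightarrow> is_iso C a (go (fo a)) (\<eta> a)"
      "\<And>a b f. a \<in> obj C \<Longrightarrow> b \<in> obj C \<Longrightarrow> f \<in> hom C a b \<Longrightarrow>
        cmp C a b (go (fo b)) (\<eta> b) f =
        cmp C a (go (fo a)) (go (fo b)) (gm (fo a) (fo b) (fm a b f)) (\<eta> a)"
    and \<epsilon>: "\<And>x. x \<in> obj D \<Longrightarrow> is_iso D (fo (go x)) x (\<epsilon> x)"
      "\<And>x y f. x \<in> obj D \<Longrightarrow> y \<in> obj D \<Longrightarrow> f \<in> hom D x y \<Longrightarrow>
        cmp D (fo (go x)) (fo (go y)) y (\<epsilon> y) (fm (go x) (go y) (gm x y f)) =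
        cmp D (fo (go x)) x y f (\<epsilon> x)"
  shows "equivalent_categories C D"
proof -
  have fo: "fo a \<in> obj D" if "a \<in> obj C" for a
    using functor_fobj[OF F that] that by simp
  have go: "go x \<in> obj C" if "x \<in> obj D" for x
    using functor_fobj[OF G that] that by simp
  have fm: "fm a b f \<in> hom D (fo a) (fo b)" if "a \<in> obj C" "b \<in> obj C" "f \<in> hom C a b" for a b f
    using PiE_mem[OF functor_fmap[OF F that(1,2)] that(3)] that by simp
  have gm: "gm x y f \<in> hom C (go x) (go y)" if "x \<in> obj D" "y \<in> obj D" "f \<in> hom D x y" for x y f
    using PiE_mem[OF functor_fmap[OF G that(1,2)] that(3)] that by simp
  have "is_nat_iso C C (id_ftor C) (comp_ftor C (mk_ftor D go gm) (mk_ftor C fo fm)) (\<lambda>a\<in>obj C. \<eta> a)"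
    using \<eta> fo fm by (auto simp: is_nat_iso_def is_nat_trans_def id_ftor_def comp_ftor_def is_iso_def)
  moreover have "is_nat_iso D D (comp_ftor D (mk_ftor C fo fm) (mk_ftor D go gm)) (id_ftor D) (\<lambda>x\<in>obj D. \<epsilon> x)"
    using \<epsilon> go gm by (auto simp: is_nat_iso_def is_nat_trans_def id_ftor_def comp_ftor_def is_iso_def)
  ultimately show ?thesis
    using F G unfolding equivalent_categories_def by blast
qed

lemma Mod_sel:
  "obj (Mod S E U) = {A. is_model S U A \<and> (\<forall>e\<in>E. satisfies A e)}"
  "hom (Mod S E U) A B = {h. is_model_hom S A B h}"
  "idt (Mod S E U) A = psh_id (carr A)"
  "cmp (Mod S E U) A B C k h = (\<lambda>n. compose (fobj (carr A) n) (k n) (h n))"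
  by (auto simp: Mod_def full_subcat_def model_cat_def)

lemma FunMod_sel:
  "obj (FunMod S E U) = {F. is_functor (classifying_cat S E) (Set_cat U) F \<and>
     preserves_finite_products (classifying_cat S E) (Set_cat U) F}"
  "hom (FunMod S E U) F G = {\<tau>. is_nat_trans (classifying_cat S E) (Set_cat U) F G \<tau>}"
  "idt (FunMod S E U) F = (\<lambda>ms. \<lambda>x\<in>fobj F ms. x)"
  "cmp (FunMod S E U) F G H \<sigma> \<tau> = (\<lambda>ms. compose (fobj F ms) (\<sigma> ms) (\<tau> ms))"
  by (auto simp: FunMod_def cartesian_functor_cat_def full_subcat_def functor_cat_def classifying_cat_def)

section \<open>The two functors, the unit and the counit\<close>

locale presentation_in_universe = presentation S E for S :: "'o signature" and E +
  fixes U :: "'u set set"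
  assumes universe: "universe_of_sets U"
begin

abbreviation Mods :: "(('o, 'u) model, nat \<Rightarrow> 'u \<Rightarrow> 'u) cat" where
  "Mods \<equiv> Mod S E U"

abbreviation FunMods ::
  "((nat list, 'o trm set list, 'u set, 'u \<Rightarrow> 'u) ftor, nat list \<Rightarrow> 'u \<Rightarrow> 'u) cat" where
  "FunMods \<equiv> FunMod S E U"

abbreviation to_ftor :: "('o, 'u) model \<Rightarrow> (nat list, 'o trm set list, 'u set, 'u \<Rightarrow> 'u) ftor" where
  "to_ftor A \<equiv> clone_model.functor_of S E (clone_of A) U"

abbreviation to_ftor_map :: "('o, 'u) model \<Rightarrow> ('o, 'u) model \<Rightarrow> (nat \<Rightarrow> 'u \<Rightarrow> 'u) \<Rightarrow> nat list \<Rightarrow> 'u \<Rightarrow> 'u" where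
  "to_ftor_map A B h \<equiv> clone_model_hom.functor_map (clone_of A) (clone_of B) U h"

abbreviation to_model :: "(nat list, 'o trm set list, 'u set, 'u \<Rightarrow> 'u) ftor \<Rightarrow> ('o, 'u) model" where
  "to_model F \<equiv> model_of S (ftor_clone F)"

abbreviation encA :: "('o, 'u) model \<Rightarrow> nat list \<Rightarrow> 'u list \<Rightarrow> 'u" where
  "encA A \<equiv> clone_model.encB (clone_of A) U"

abbreviation decA :: "('o, 'u) model \<Rightarrow> nat list \<Rightarrow> 'u \<Rightarrow> 'u list" where
  "decA A \<equiv> clone_model.decB (clone_of A) U"

definition unit :: "('o, 'u) model \<Rightarrow> nat \<Rightarrow> 'u \<Rightarrow> 'u" where
  "unit A = (\<lambda>n. \<lambda>x\<in>fobj (carr A) n. encA A [n] [x])"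

lemma clone_model_clone_of:
  assumes A: "A \<in> obj Mods"
  shows "clone_model S E (clone_of A) U"
proof -
  have mA: "is_model S U A" and sat: "\<forall>e\<in>E. satisfies A e"
    using A by (simp_all add: Mod_sel)
  interpret A: model S U A by (rule model.intro[OF mA])
  have "clone_satisfies (clone_of A) (\<Theta>, n, s, t)" if eq: "(\<Theta>, n, s, t) \<in> E" for \<Theta> n s t
  proof -
    have "wf_trm S \<Theta> n s" "wf_trm S \<Theta> n t"
      using presentation eq by (auto simp: is_presentation_def)
    then show ?thesis
      using A.satisfies_iff[of \<Theta> n s t] sat eq by auto
  qed
  moreover have "fobj (carr A) n \<in> U" for n
    using mA functor_fobj[of FF "Set_cat U" "carr A" n] by (simp add: is_model_def)
  ultimately show ?thesis
    by unfold_locales (auto simp: universe)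
qed

lemma functorial_model: "F \<in> obj FunMods \<Longrightarrow> functorial_model S E U F"
  by unfold_locales (simp_all add: FunMod_sel universe)

lemma clone_model_hom:
  assumes A: "A \<in> obj Mods" and B: "B \<in> obj Mods" and h: "h \<in> hom Mods A B"
  shows "clone_model_hom S E (clone_of A) (clone_of B) U h"
proof -
  have "is_clone_hom S (clone_of A) (clone_of B) h"
    using A B h is_model_hom_iff[of S U A B h] by (simp add: Mod_sel)
  then show ?thesis
    by (intro clone_model_hom.intro clone_model_hom_axioms.intro clone_model_clone_of A B)
qed

lemma functorial_model_hom:
  "F \<in> obj FunMods \<Longrightarrow> G \<in> obj FunMods \<Longrightarrow> \<tau> \<in> hom FunMods F G \<Longrightarrow> functorial_model_hom S E U F G \<tau>"
  by (intro functorial_model_hom.intro functorial_model_hom_axioms.intro functorial_model)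
    (simp_all add: FunMod_sel)

lemma category_Mods: "is_category Mods"
  unfolding Mod_def by (rule category_full_subcat[OF category_model_cat])

lemma category_FunMods: "is_category FunMods"
  unfolding FunMod_def cartesian_functor_cat_def
  by (intro category_full_subcat category_functor_cat_Set category_M)

lemma to_ftor_in: "A \<in> obj Mods \<Longrightarrow> to_ftor A \<in> obj FunMods"
  using clone_model.is_functor_functor_of[OF clone_model_clone_of]
    clone_model.preserves_finite_products_functor_of[OF clone_model_clone_of]
  by (simp add: FunMod_sel)

lemma to_model_in:
  assumes F: "F \<in> obj FunMods"
  shows "to_model F \<in> obj Mods"
proof -
  interpret F: functorial_model S E U F by (rule functorial_model[OF F])
  interpret A: model S U "to_model F" by (rule model.intro[OF F.is_model_model])
  have "satisfies (to_model F) (\<Theta>, n, s, t)" if eq: "(\<Theta>, n, s, t) \<in> E" for \<Theta> n s t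
  proof -
    have "wf_trm S \<Theta> n s" "wf_trm S \<Theta> n t"
      using presentation eq by (auto simp: is_presentation_def)
    then show ?thesis
      using A.satisfies_iff[of \<Theta> n s t] F.model.satisfies eq by auto
  qed
  then show ?thesis
    using F.is_model_model by (auto simp: Mod_sel)
qed

lemma functor_to_ftor: "is_functor Mods FunMods (mk_ftor Mods to_ftor to_ftor_map)"
proof (rule is_functor_mk_ftor[OF category_Mods category_FunMods to_ftor_in])
  fix A B h assume "A \<in> obj Mods" "B \<in> obj Mods" "h \<in> hom Mods A B"
  then show "to_ftor_map A B h \<in> hom FunMods (to_ftor A) (to_ftor B)"
    using clone_model_hom.nat_trans_functor_map[OF clone_model_hom] by (simp add: FunMod_sel)
next
  fix A assume A: "A \<in> obj Mods"
  interpret A: clone_model S E "clone_of A" U by (rule clone_model_clone_of[OF A])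
  interpret h: clone_model_hom S E "clone_of A" "clone_of A" U "psh_id (carr A)"
    using cat_idt[OF category_Mods A] by (intro clone_model_hom A) (simp add: Mod_sel)
  have "map2 (psh_id (carr A)) ms \<xi> = \<xi>" if "\<xi> \<in> metas (clone_of A) 0 ms" for ms \<xi>
    using that by (intro nth_equalityI) (simp_all add: in_metas psh_id_def)
  then show "to_ftor_map A A (idt Mods A) = idt FunMods (to_ftor A)"
    by (auto simp: Mod_sel FunMod_sel h.functor_map_def A.decB_in A.encB_decB fun_eq_iff)
next
  fix A B C h k assume A: "A \<in> obj Mods" and B: "B \<in> obj Mods" and C: "C \<in> obj Mods"
    and h: "h \<in> hom Mods A B" and k: "k \<in> hom Mods B C"
  interpret h: clone_model_hom S E "clone_of A" "clone_of B" U h by (rule clone_model_hom[OF A B h])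
  interpret k: clone_model_hom S E "clone_of B" "clone_of C" U k by (rule clone_model_hom[OF B C k])
  interpret kh: clone_model_hom S E "clone_of A" "clone_of C" U "cmp Mods A B C k h"
    using cat_cmp[OF category_Mods A B C h k] by (rule clone_model_hom[OF A C])
  have "kh.functor_map ms x = k.functor_map ms (h.functor_map ms x)" if x: "x \<in> h.A.prodB ms" for ms x
  proof -
    have "map2 (cmp Mods A B C k h) ms (h.A.decB ms x) = map2 k ms (map2 h ms (h.A.decB ms x))"
      using h.A.decB_in[OF x] by (intro nth_equalityI) (simp_all add: in_metas Mod_sel compose_eq)
    then show ?thesis
      using x k.functor_map_encB[OF h.map2_in_metas[OF h.A.decB_in[OF x]]]
      by (simp add: h.functor_map_def kh.functor_map_def)
  qed
  then show "to_ftor_map A C (cmp Mods A B C k h) =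
      cmp FunMods (to_ftor A) (to_ftor B) (to_ftor C) (to_ftor_map B C k) (to_ftor_map A B h)"
    by (auto simp: FunMod_sel fun_eq_iff compose_def) (simp add: kh.functor_map_def)
qed

lemma functor_to_model: "is_functor FunMods Mods (mk_ftor FunMods to_model (\<lambda>F G \<tau> n. \<tau> [n]))"
proof (rule is_functor_mk_ftor[OF category_FunMods category_Mods to_model_in])
  fix F G \<tau> assume "F \<in> obj FunMods" "G \<in> obj FunMods" "\<tau> \<in> hom FunMods F G"
  then show "(\<lambda>n. \<tau> [n]) \<in> hom Mods (to_model F) (to_model G)"
    using functorial_model_hom.is_model_hom_\<tau>[OF functorial_model_hom] by (simp add: Mod_sel)
qed (simp_all add: Mod_sel FunMod_sel psh_id_def fun_eq_iff)

text \<open>A bijective homomorphism of models is an isomorphism. The unit is the encoding of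
  singletons followed by the identity homomorphism \<open>clone_hom_to_model_of\<close>.\<close>

lemma is_iso_unit:
  assumes A: "A \<in> obj Mods"
  shows "is_iso Mods A (to_model (to_ftor A)) (unit A)"
proof -
  interpret A: clone_model S E "clone_of A" U by (rule clone_model_clone_of[OF A])
  interpret F: functorial_model S E U A.functor_of by (rule A.functorial_model_functor_of)
  have mA: "is_model S U A" using A by (simp add: Mod_sel)
  have "is_clone_hom S (clone_of A) (clone_of F.model) (\<lambda>n x. A.encB [n] [x])"
    using A.clone_hom_comp[OF F.clone_C F.C.clone_clone_of_model_of A.clone_hom_unit F.C.clone_hom_to_model_of] .
  then have "is_clone_hom S (clone_of A) (clone_of F.model) (unit A)"
    by (rule A.clone_hom_cong[OF F.C.clone_clone_of_model_of]) (simp add: unit_def)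
  then have "is_model_hom S A F.model (unit A)"
    unfolding is_model_hom_iff[OF mA F.is_model_model] by (simp add: unit_def)
  moreover have "bij_betw (unit A n) (fobj (carr A) n) (fobj (carr F.model) n)" for n
    using A.bij_unit[of n] bij_betw_cong[of "fobj (carr A) n" "unit A n" "\<lambda>x. A.encB [n] [x]"]
    by (simp add: unit_def)
  ultimately show ?thesis
    unfolding Mod_def is_iso_full_subcat by (rule is_iso_model[OF mA F.is_model_model])
qed

lemma unit_natural:
  assumes A: "A \<in> obj Mods" and B: "B \<in> obj Mods" and h: "h \<in> hom Mods A B"
  shows "cmp Mods A B (to_model (to_ftor B)) (unit B) h =
    cmp Mods A (to_model (to_ftor A)) (to_model (to_ftor B)) (\<lambda>n. to_ftor_map A B h [n]) (unit A)"
proof -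
  interpret h: clone_model_hom S E "clone_of A" "clone_of B" U h by (rule clone_model_hom[OF A B h])
  have "h n x \<in> fobj (carr B) n" "[x] \<in> metas (clone_of A) 0 [n]" if "x \<in> fobj (carr A) n" for n x
    using that h.clone_hom by (simp_all add: is_clone_hom_def in_metas)
  then show ?thesis
    using h.functor_map_encB by (auto simp: Mod_sel unit_def compose_def fun_eq_iff)
qed

lemma is_iso_counit:
  assumes F: "F \<in> obj FunMods"
  shows "is_iso FunMods (to_ftor (to_model F)) F (functorial_model.counit S E U F)"
proof -
  interpret F: functorial_model S E U F by (rule functorial_model[OF F])
  show ?thesis
    unfolding FunMod_def cartesian_functor_cat_def is_iso_full_subcat
    by (rule is_iso_functor_cat_Set[OF F.model.is_functor_functor_of F.is_functor F.nat_trans_counit])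
      (simp add: F.bij_counit)
qed

lemma counit_natural:
  assumes F: "F \<in> obj FunMods" and G: "G \<in> obj FunMods" and \<tau>: "\<tau> \<in> hom FunMods F G"
  shows "cmp FunMods (to_ftor (to_model F)) (to_ftor (to_model G)) G (functorial_model.counit S E U G)
      (to_ftor_map (to_model F) (to_model G) (\<lambda>n. \<tau> [n])) =
    cmp FunMods (to_ftor (to_model F)) F G \<tau> (functorial_model.counit S E U F)"
proof -
  interpret \<tau>: functorial_model_hom S E U F G \<tau> by (rule functorial_model_hom[OF F G \<tau>])
  show ?thesis
    using \<tau>.counit_natural by (auto simp: FunMod_sel compose_def fun_eq_iff)
qed

lemma equivalence: "equivalent_categories Mods FunMods"
  by (rule equivalent_categoriesI[OF functor_to_ftor functor_to_model,
        where \<eta> = unit and \<epsilon> = "functorial_model.counit S E U"])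
    (rule is_iso_unit unit_natural is_iso_counit counit_natural; assumption)+

end

theorem theorem4:
  fixes S :: "'o signature" and E :: "'o equation set" and U :: "'u set set"
  assumes "is_presentation S E"
    and "universe_of_sets U"
  shows "equivalent_categories (Mod S E U) (FunMod S E U)"
proof -
  interpret presentation_in_universe S E U
    by unfold_locales (rule assms)+
  show ?thesis by (rule equivalence)
qed

end
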